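(* There is an absolute constant $C$ such that the following holds. Let $\mathcal G=(V,E)$ be a finite simple graph with $V=\{1,\dots,N\}$ and chromatic index $\chi\ge1$; fix a proper edge coloring of $\mathcal G$ with $\chi$ colors and color classes $E_1,\dots,E_\chi$, and let $\nu=\lceil\chi/2\rceil$. For each $\ell\in\{1,\dots,\nu\}$ orient the edges in $E_{2\ell-1}\cup E_{2\ell}$ (with $E_{2\ell}=\emptyset$ if $2\ell>\chi$) so that every vertex has at most one outgoing and at most one incoming edge among them, and for each such edge, oriented from $i$ to $j$, set $P_{ij}=i\,c_i^{(\ell)}d_j^{(\ell)}$. Then there is an adaptive quantum circuit on qubits with all-to-all connectivity, acting on the Jordan--Wigner qubits of the physical and auxiliary modes together with further ancillary qubits, so that the number of ancillary qubits including the $\nu N$ qubits of the auxiliary modes is $(2\nu+1)N$, of depth at most $C(\chi\log\chi+\chi\log N)$, which, starting from the auxiliary modes in the vacuum, prepares a state $|\Psi_{\mathrm{aux}}\rangle$ of the auxiliary modes that satisfies, for signs $s_{ij}\in\{+1,-1\}$ determined by the measurement outcomes, $$s_{ij}P_{ij}|\Psi_{\mathrm{aux}}\rangle=|\Psi_{\mathrm{aux}}\rangle\quad\text{for every edge of }\mathcal G .$$ That is, after redefining each stabilizer $P_{ij}$ as $s_{ij}P_{ij}$, the state is in the joint $+1$ eigenspace of all stabilizers.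
   Context: Fermionic modes: $a_i$ ($1\le i\le N$) are the annihilation operators of the physical modes and $b_i^{(\ell)}$ ($1\le i\le N$, $1\le\ell\le\nu$) those of the auxiliary modes; all satisfy the canonical anticommutation relations jointly. The auxiliary Majorana operators are $c_i^{(\ell)}=b_i^{(\ell)}+b_i^{(\ell)\dagger}$ and $d_i^{(\ell)}=-i(b_i^{(\ell)}-b_i^{(\ell)\dagger})$. The Jordan--Wigner encoding uses one qubit per mode with mode ordering $(a_1,b_1^{(1)},\dots,b_1^{(\nu)},\dots,a_N,b_N^{(1)},\dots,b_N^{(\nu)})$. A proper edge coloring assigns colors to edges so that edges sharing a vertex have distinct colors; the chromatic index $\chi$ is the minimum number of colors in such a coloring. Circuits: a circuit consists of layers; in each layer one applies one- and two-qubit gates (on arbitrary pairs of qubits) and single-qubit measurements, acting on disjoint qubits; later gates may depend on earlier measurement outcomes (adaptive circuit), classical processing is free, and depth is the number of layers. In depth bounds, $\log x$ is read as $\max\{1,\log x\}$. *)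

theory Defs
  imports "HOL-Analysis.Analysis"
begin

section \<open>Graphs, edge colorings and orientations\<close>

definition simple_graph :: "'v set \<Rightarrow> 'v set set \<Rightarrow> bool" where
  "simple_graph V E \<longleftrightarrow> finite V \<and> (\<forall>e\<in>E. e \<subseteq> V \<and> card e = 2)"

definition proper_edge_coloring :: "'v set set \<Rightarrow> nat \<Rightarrow> ('v set \<Rightarrow> nat) \<Rightarrow> bool" where
  "proper_edge_coloring E k col \<longleftrightarrow>
     (\<forall>e\<in>E. col e \<in> {1..k}) \<and>
     (\<forall>e\<in>E. \<forall>f\<in>E. e \<noteq> f \<and> e \<inter> f \<noteq> {} \<longrightarrow> col e \<noteq> col f)"

definition chromatic_index :: "'v set set \<Rightarrow> nat" where
  "chromatic_index E = (LEAST k. \<exists>col. proper_edge_coloring E k col)"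

text \<open>For a proper coloring with \<open>k\<close> colors, the class of any color beyond \<open>k\<close> is empty.\<close>

definition color_class :: "'v set set \<Rightarrow> ('v set \<Rightarrow> nat) \<Rightarrow> nat \<Rightarrow> 'v set set" where
  "color_class E col c = {e \<in> E. col e = c}"

definition orientation :: "'v set set \<Rightarrow> ('v \<times> 'v) set \<Rightarrow> bool" where
  "orientation E D \<longleftrightarrow>
     (\<forall>(i, j)\<in>D. {i, j} \<in> E) \<and> (\<forall>e\<in>E. \<exists>!a. a \<in> D \<and> {fst a, snd a} = e)"

definition at_most_one_out_in :: "('v \<times> 'v) set \<Rightarrow> bool" where
  "at_most_one_out_in D \<longleftrightarrow>
     (\<forall>i j j'. (i, j) \<in> D \<and> (i, j') \<in> D \<longrightarrow> j = j') \<and>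
     (\<forall>i i' j. (i, j) \<in> D \<and> (i', j) \<in> D \<longrightarrow> i = i')"


section \<open>Qubit registers and states\<close>

text \<open>
  \<open>Phys i\<close> is the Jordan--Wigner qubit of the physical mode \<open>a\<^sub>i\<close>, \<open>Aux i l\<close> that of the
  auxiliary mode \<open>b\<^sub>i\<^sup>(\<^sup>l\<^sup>)\<close>, and \<open>Anc k\<close> is a further ancillary qubit.
\<close>

datatype qubit = Phys nat | Aux nat nat | Anc nat

definition phys_qubits :: "nat \<Rightarrow> qubit set" where
  "phys_qubits N = {Phys i | i. i \<in> {1..N}}"

definition aux_qubits :: "nat \<Rightarrow> nat \<Rightarrow> qubit set" where
  "aux_qubits N \<nu> = {Aux i l | i l. i \<in> {1..N} \<and> l \<in> {1..\<nu>}}"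

definition anc_qubits :: "nat \<Rightarrow> qubit set" where
  "anc_qubits m = {Anc k | k. k \<in> {1..m}}"

text \<open>
  A computational basis vector of a finite register \<open>R\<close> is identified with the set \<open>S \<subseteq> R\<close> of the
  qubits that are in state 1, and a vector with its amplitudes; amplitudes off \<open>Pow R\<close> vanish.
  Hence a vector of \<open>R\<close> is also the vector of any larger register in which the additional qubits
  are in state 0 (the additional modes are in the vacuum).
\<close>

type_synonym state = "qubit set \<Rightarrow> complex"

definition state_of :: "qubit set \<Rightarrow> state \<Rightarrow> bool" where
  "state_of R \<psi> \<longleftrightarrow> (\<forall>S. \<psi> S \<noteq> 0 \<longrightarrow> S \<subseteq> R)"

definition unit_state_of :: "qubit set \<Rightarrow> state \<Rightarrow> bool" where
  "unit_state_of R \<psi> \<longleftrightarrow> state_of R \<psi> \<and> (\<Sum>S\<in>Pow R. (cmod (\<psi> S))\<^sup>2) = 1"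

definition tensor_state :: "qubit set \<Rightarrow> qubit set \<Rightarrow> state \<Rightarrow> state \<Rightarrow> state" where
  "tensor_state R R' \<psi> \<alpha> =
     (\<lambda>S. if S \<subseteq> R \<union> R' then \<psi> (S \<inter> R) * \<alpha> (S \<inter> R') else 0)"


section \<open>Fermionic modes in the Jordan--Wigner encoding\<close>

text \<open>The mode ordering \<open>a\<^sub>1, b\<^sub>1\<^sup>(\<^sup>1\<^sup>), \<dots>, b\<^sub>1\<^sup>(\<^sup>\<nu>\<^sup>), \<dots>, a\<^sub>N, b\<^sub>N\<^sup>(\<^sup>1\<^sup>), \<dots>, b\<^sub>N\<^sup>(\<^sup>\<nu>\<^sup>)\<close>; the qubits \<open>Anc k\<close> carry no mode.\<close>

fun jw_before :: "qubit \<Rightarrow> qubit \<Rightarrow> bool" where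
  "jw_before (Phys i) (Phys j) \<longleftrightarrow> i < j"
| "jw_before (Phys i) (Aux j l) \<longleftrightarrow> i \<le> j"
| "jw_before (Aux i l) (Phys j) \<longleftrightarrow> i < j"
| "jw_before (Aux i l) (Aux j m) \<longleftrightarrow> i < j \<or> i = j \<and> l < m"
| "jw_before _ _ \<longleftrightarrow> False"

text \<open>
  Eigenvalue, on the basis vector \<open>S\<close>, of the product of the Pauli-Z operators of all modes that
  precede \<open>k\<close>. The annihilation operator of mode \<open>k\<close> is this string times the lowering operator
  \<open>|0\<rangle>\<langle>1|\<close> of qubit \<open>k\<close>.
\<close>

definition jw_sign :: "qubit \<Rightarrow> qubit set \<Rightarrow> complex" where
  "jw_sign k S = (-1) ^ card {q \<in> S. jw_before q k}"

definition annihilate :: "qubit \<Rightarrow> state \<Rightarrow> state" where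
  "annihilate k \<psi> = (\<lambda>S. if k \<in> S then 0 else jw_sign k S * \<psi> (insert k S))"

definition create :: "qubit \<Rightarrow> state \<Rightarrow> state" where
  "create k \<psi> = (\<lambda>S. if k \<in> S then jw_sign k S * \<psi> (S - {k}) else 0)"

definition is_mode :: "qubit \<Rightarrow> bool" where
  "is_mode q \<longleftrightarrow> q \<notin> range Anc"

lemma jw_before_irrefl: "\<not> jw_before q q"
  by (cases q) auto

lemma jw_before_swap:
  "is_mode p \<Longrightarrow> is_mode q \<Longrightarrow> p \<noteq> q \<Longrightarrow> jw_before p q \<longleftrightarrow> \<not> jw_before q p"
  by (cases p; cases q) (auto simp: is_mode_def)

lemma jw_sign_insert:
  assumes "finite S" "m \<notin> S"
  shows "jw_sign k (insert m S) = (if jw_before m k then - jw_sign k S else jw_sign k S)"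
proof -
  have "{q \<in> insert m S. jw_before q k} =
      (if jw_before m k then insert m {q \<in> S. jw_before q k} else {q \<in> S. jw_before q k})"
    by auto
  then show ?thesis
    using assms by (simp add: jw_sign_def)
qed

lemma jw_sign_remove:
  assumes "finite S" "m \<in> S"
  shows "jw_sign k (S - {m}) = (if jw_before m k then - jw_sign k S else jw_sign k S)"
  using jw_sign_insert[of "S - {m}" m k] assms by (auto simp: insert_absorb)

lemma jw_sign_square: "jw_sign k S * jw_sign k S = 1"
  by (simp add: jw_sign_def flip: power_add mult_2)

lemma car_annihilate_annihilate:
  assumes "is_mode k" "is_mode m" "finite S"
  shows "annihilate k (annihilate m \<psi>) S + annihilate m (annihilate k \<psi>) S = 0"
  using assms jw_before_swap[of k m]
  by (cases "k = m") (auto simp: annihilate_def jw_sign_insert insert_commute)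

lemma car_create_create:
  assumes "is_mode k" "is_mode m" "finite S"
  shows "create k (create m \<psi>) S + create m (create k \<psi>) S = 0"
proof -
  have "S - {k} - {m} = S - {m} - {k}" by auto
  then show ?thesis
    using assms jw_before_swap[of k m]
    by (cases "k = m") (auto simp: create_def jw_sign_remove)
qed

lemma car_annihilate_create:
  assumes "is_mode k" "is_mode m" "finite S"
  shows "annihilate k (create m \<psi>) S + create m (annihilate k \<psi>) S = (if k = m then \<psi> S else 0)"
proof (cases "k = m")
  case True
  then show ?thesis
    using assms
    by (auto simp: annihilate_def create_def jw_sign_insert jw_sign_remove jw_before_irrefl
        jw_sign_square insert_absorb simp flip: mult.assoc)
next
  case False
  then have "insert k S - {m} = insert k (S - {m})" by auto
  with False show ?thesis
    using assms jw_before_swap[of k m]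
    by (auto simp: annihilate_def create_def jw_sign_insert jw_sign_remove)
qed

definition majorana_c :: "nat \<Rightarrow> nat \<Rightarrow> state \<Rightarrow> state" where
  "majorana_c l i \<psi> = (\<lambda>S. annihilate (Aux i l) \<psi> S + create (Aux i l) \<psi> S)"

definition majorana_d :: "nat \<Rightarrow> nat \<Rightarrow> state \<Rightarrow> state" where
  "majorana_d l i \<psi> = (\<lambda>S. - \<i> * (annihilate (Aux i l) \<psi> S - create (Aux i l) \<psi> S))"

definition stabilizer :: "nat \<Rightarrow> nat \<Rightarrow> nat \<Rightarrow> state \<Rightarrow> state" where
  "stabilizer l i j \<psi> = (\<lambda>S. \<i> * majorana_c l i (majorana_d l j \<psi>) S)"

text \<open>
  The joint state of a state \<open>\<phi>\<close> of the physical modes and a state \<open>\<Psi>\<close> of the auxiliary modes, that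
  is \<open>A B |vac\<rangle>\<close> for \<open>\<phi> = A |vac\<rangle>\<close> and \<open>\<Psi> = B |vac\<rangle>\<close>, where \<open>A\<close> and \<open>B\<close> are polynomials in the
  physical and in the auxiliary creation operators. Bringing the creation operators of a
  basis vector into the Jordan--Wigner order costs the sign of the number of inversions, so
  this is in general not the tensor product of the qubit states.
\<close>

definition fermionic_product :: "nat \<Rightarrow> nat \<Rightarrow> state \<Rightarrow> state \<Rightarrow> state" where
  "fermionic_product N \<nu> \<phi> \<Psi> =
     (\<lambda>S. if S \<subseteq> phys_qubits N \<union> aux_qubits N \<nu>
          then (\<Prod>p \<in> S \<inter> phys_qubits N. jw_sign p (S \<inter> aux_qubits N \<nu>)) *
               \<phi> (S \<inter> phys_qubits N) * \<Psi> (S \<inter> aux_qubits N \<nu>)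
          else 0)"

lemma finite_mode_qubits: "finite (phys_qubits N)" "finite (aux_qubits N \<nu>)"
proof -
  have "phys_qubits N = Phys ` {1..N}" "aux_qubits N \<nu> = (\<lambda>(i, l). Aux i l) ` ({1..N} \<times> {1..\<nu>})"
    by (auto simp: phys_qubits_def aux_qubits_def)
  then show "finite (phys_qubits N)" "finite (aux_qubits N \<nu>)" by simp_all
qed

lemma jw_sign_split:
  assumes "S \<subseteq> phys_qubits N \<union> aux_qubits N \<nu>"
  shows "jw_sign k S = jw_sign k (S \<inter> phys_qubits N) * jw_sign k (S \<inter> aux_qubits N \<nu>)"
proof -
  have "{q \<in> S. jw_before q k} =
      {q \<in> S \<inter> phys_qubits N. jw_before q k} \<union> {q \<in> S \<inter> aux_qubits N \<nu>. jw_before q k}"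
    using assms by auto
  moreover have "phys_qubits N \<inter> aux_qubits N \<nu> = {}"
    by (auto simp: phys_qubits_def aux_qubits_def)
  ultimately show ?thesis
    unfolding jw_sign_def
    by (subst (1) power_add[symmetric], subst card_Un_disjoint[symmetric])
       (auto simp: finite_mode_qubits)
qed

lemma annihilate_phys_fermionic_product:
  assumes "k \<in> phys_qubits N"
  shows "annihilate k (fermionic_product N \<nu> \<phi> \<Psi>) = fermionic_product N \<nu> (annihilate k \<phi>) \<Psi>"
proof
  fix S
  let ?P = "phys_qubits N" and ?A = "aux_qubits N \<nu>"
  have kA: "k \<notin> ?A" using assms by (auto simp: phys_qubits_def aux_qubits_def)
  consider "\<not> S \<subseteq> ?P \<union> ?A" | "k \<in> S" | "S \<subseteq> ?P \<union> ?A" "k \<notin> S" by blast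
  then show "annihilate k (fermionic_product N \<nu> \<phi> \<Psi>) S = fermionic_product N \<nu> (annihilate k \<phi>) \<Psi> S"
  proof cases
    case 3
    have "insert k S \<inter> ?P = insert k (S \<inter> ?P)" "insert k S \<inter> ?A = S \<inter> ?A"
      using assms kA by auto
    moreover have "finite (S \<inter> ?P)" by (simp add: finite_mode_qubits)
    ultimately have "annihilate k (fermionic_product N \<nu> \<phi> \<Psi>) S =
      (jw_sign k (S \<inter> ?A) * jw_sign k (S \<inter> ?A)) * jw_sign k (S \<inter> ?P) *
      (\<Prod>p \<in> S \<inter> ?P. jw_sign p (S \<inter> ?A)) * \<phi> (insert k (S \<inter> ?P)) * \<Psi> (S \<inter> ?A)"
      using 3 assms by (simp add: annihilate_def fermionic_product_def jw_sign_split)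
    also have "\<dots> = fermionic_product N \<nu> (annihilate k \<phi>) \<Psi> S"
      unfolding jw_sign_square using 3 assms
      by (simp add: annihilate_def fermionic_product_def)
    finally show ?thesis .
  qed (use assms in \<open>auto simp: annihilate_def fermionic_product_def\<close>)
qed

lemma prod_jw_sign_insert:
  assumes "k \<in> aux_qubits N \<nu>" "k \<notin> T" "finite T" "finite X" "X \<subseteq> phys_qubits N"
  shows "(\<Prod>p\<in>X. jw_sign p (insert k T)) * jw_sign k X = (-1) ^ card X * (\<Prod>p\<in>X. jw_sign p T)"
  using assms(4,5)
proof (induction X)
  case empty
  then show ?case by (simp add: jw_sign_def)
next
  case (insert p X)
  then have "is_mode p" "is_mode k" "p \<noteq> k"
    using assms(1) by (auto simp: is_mode_def phys_qubits_def aux_qubits_def)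
  then have "jw_before k p \<longleftrightarrow> \<not> jw_before p k" using jw_before_swap by metis
  with insert assms(2,3) show ?case
    by (auto simp: jw_sign_insert algebra_simps)
qed

lemma annihilate_aux_fermionic_product:
  assumes "k \<in> aux_qubits N \<nu>"
  shows "annihilate k (fermionic_product N \<nu> \<phi> \<Psi>) =
         fermionic_product N \<nu> (\<lambda>X. (-1) ^ card X * \<phi> X) (annihilate k \<Psi>)"
proof
  fix S
  let ?P = "phys_qubits N" and ?A = "aux_qubits N \<nu>"
  have kP: "k \<notin> ?P" using assms by (auto simp: phys_qubits_def aux_qubits_def)
  consider "\<not> S \<subseteq> ?P \<union> ?A" | "k \<in> S" | "S \<subseteq> ?P \<union> ?A" "k \<notin> S" by blast
  then show "annihilate k (fermionic_product N \<nu> \<phi> \<Psi>) S =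
      fermionic_product N \<nu> (\<lambda>X. (-1) ^ card X * \<phi> X) (annihilate k \<Psi>) S"
  proof cases
    case 3
    have "insert k S \<inter> ?P = S \<inter> ?P" "insert k S \<inter> ?A = insert k (S \<inter> ?A)"
      using assms kP by auto
    then have "annihilate k (fermionic_product N \<nu> \<phi> \<Psi>) S =
      ((\<Prod>p \<in> S \<inter> ?P. jw_sign p (insert k (S \<inter> ?A))) * jw_sign k (S \<inter> ?P)) *
      jw_sign k (S \<inter> ?A) * \<phi> (S \<inter> ?P) * \<Psi> (insert k (S \<inter> ?A))"
      using 3 assms by (simp add: annihilate_def fermionic_product_def jw_sign_split)
    also have "\<dots> = fermionic_product N \<nu> (\<lambda>X. (-1) ^ card X * \<phi> X) (annihilate k \<Psi>) S"
      using 3 assms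
      by (subst prod_jw_sign_insert)
         (auto simp: annihilate_def fermionic_product_def finite_mode_qubits)
    finally show ?thesis .
  qed (use assms in \<open>auto simp: annihilate_def fermionic_product_def\<close>)
qed


section \<open>Adaptive circuits\<close>

definition conj_transpose :: "complex^'n^'m \<Rightarrow> complex^'m^'n" where
  "conj_transpose U = (\<chi> i j. cnj (U $ j $ i))"

definition unitary_matrix :: "complex^'n^'n \<Rightarrow> bool" where
  "unitary_matrix U \<longleftrightarrow> U ** conj_transpose U = mat 1 \<and> conj_transpose U ** U = mat 1"

datatype operation =
    Gate1 qubit "complex^bool^bool"
  | Gate2 qubit qubit "complex^(bool \<times> bool)^(bool \<times> bool)"
  | Measure qubit

fun op_qubits :: "operation \<Rightarrow> qubit list" where
  "op_qubits (Gate1 q U) = [q]"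
| "op_qubits (Gate2 p q U) = [p, q]"
| "op_qubits (Measure q) = [q]"

fun valid_op :: "operation \<Rightarrow> bool" where
  "valid_op (Gate1 q U) \<longleftrightarrow> unitary_matrix U"
| "valid_op (Gate2 p q U) \<longleftrightarrow> unitary_matrix U"
| "valid_op (Measure q) \<longleftrightarrow> True"

definition set_qubit :: "qubit \<Rightarrow> bool \<Rightarrow> qubit set \<Rightarrow> qubit set" where
  "set_qubit q b S = (if b then insert q S else S - {q})"

definition apply_gate1 :: "qubit \<Rightarrow> complex^bool^bool \<Rightarrow> state \<Rightarrow> state" where
  "apply_gate1 q U \<psi> = (\<lambda>S. \<Sum>b\<in>UNIV. U $ (q \<in> S) $ b * \<psi> (set_qubit q b S))"

definition apply_gate2 ::
    "qubit \<Rightarrow> qubit \<Rightarrow> complex^(bool \<times> bool)^(bool \<times> bool) \<Rightarrow> state \<Rightarrow> state" where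
  "apply_gate2 p q U \<psi> =
     (\<lambda>S. \<Sum>(a, b)\<in>UNIV. U $ (p \<in> S, q \<in> S) $ (a, b) * \<psi> (set_qubit p a (set_qubit q b S)))"

definition project_qubit :: "qubit \<Rightarrow> bool \<Rightarrow> state \<Rightarrow> state" where
  "project_qubit q b \<psi> = (\<lambda>S. if (q \<in> S) = b then \<psi> S else 0)"

text \<open>
  A branch is the record of all measurement outcomes so far (oldest first) together with the
  unnormalized state; the squared norm of the state is the probability of the record, so the
  records that can occur are those whose state is nonzero. Measurements are in the
  computational basis.
\<close>

type_synonym branch = "bool list \<times> state"

fun op_branches :: "operation \<Rightarrow> branch \<Rightarrow> branch set" where
  "op_branches (Gate1 q U) (r, \<psi>) = {(r, apply_gate1 q U \<psi>)}"
| "op_branches (Gate2 p q U) (r, \<psi>) = {(r, apply_gate2 p q U \<psi>)}"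
| "op_branches (Measure q) (r, \<psi>) = {(r @ [b], project_qubit q b \<psi>) | b. b \<in> UNIV}"

fun layer_branches :: "operation list \<Rightarrow> branch \<Rightarrow> branch set" where
  "layer_branches [] x = {x}"
| "layer_branches (g # gs) x = (\<Union>y \<in> op_branches g x. layer_branches gs y)"

text \<open>
  In an adaptive circuit each layer is an arbitrary function of the record of the outcomes of the
  preceding layers. The length of the list is the depth.
\<close>

type_synonym adaptive_circuit = "(bool list \<Rightarrow> operation list) list"

fun circuit_branches :: "adaptive_circuit \<Rightarrow> branch \<Rightarrow> branch set" where
  "circuit_branches [] x = {x}"
| "circuit_branches (L # Ls) x =
     (\<Union>y \<in> layer_branches (L (fst x)) x. circuit_branches Ls y)"

definition valid_layer :: "qubit set \<Rightarrow> operation list \<Rightarrow> bool" where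
  "valid_layer R gs \<longleftrightarrow>
     (\<forall>g\<in>set gs. valid_op g) \<and> distinct (concat (map op_qubits gs)) \<and>
     set (concat (map op_qubits gs)) \<subseteq> R"

definition valid_circuit :: "qubit set \<Rightarrow> adaptive_circuit \<Rightarrow> bool" where
  "valid_circuit R Ls \<longleftrightarrow> (\<forall>L\<in>set Ls. \<forall>r. valid_layer R (L r))"

definition circuit_depth :: "adaptive_circuit \<Rightarrow> nat" where
  "circuit_depth Ls = length Ls"

definition log_ge1 :: "real \<Rightarrow> real" where
  "log_ge1 x = max 1 (log 2 x)"

end

theory Submission
  imports Defs
begin

text \<open>
  Let \<open>s\<^sub>e\<close> be signs and \<open>T\<close> range over the sets of edges of one layer. Expanding the product of the
  operators \<open>1 + s\<^sub>e P\<^sub>e\<close> gives the sum of \<open>s\<^sub>T P\<^sub>T\<close>, where \<open>P\<^sub>T\<close> flips the qubits of the end points of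
  \<open>T\<close>, up to a sign that is a quadratic form in \<open>T\<close> and in the parities of the sites. Hence the
  joint eigenspace of a layer is reached as follows: one ancilla per edge is put into the uniform
  superposition of all \<open>T\<close>, the sign is imprinted, \<open>T\<close> is added onto the end points, and the ancillas
  are measured in the X basis; the outcomes are the signs \<open>s\<^sub>e\<close>.

  The quadratic form is a sum over pairs of sites \<open>j \<le> i\<close>. Such a prefix form is imprinted in constant
  depth: two fresh qubits per site, coupled along a chain and measured in the X basis, evaluate all
  prefix sums at once, and wrong outcomes cost Pauli Z corrections only. The number of inversions
  \<open>j < i\<close>, \<open>\<sigma> j < \<sigma> i\<close> splits into logarithmically many prefix forms, one for each binary digit of \<open>\<sigma>\<close>.
\<close>

section \<open>Products of stabilizers\<close>

text \<open>The Jordan--Wigner strings of the stabilizers run over the lower layers and over the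
  physical qubits, whose state is arbitrary and must not be disturbed. The circuit is therefore
  described by operators: each outcome record fixes one operator for all input states, so the
  auxiliary factor can be computed on the vacuum alone. Two facts about stabilizers carry the
  argument: those of different layers commute, so later rounds preserve what earlier ones achieved,
  and each has even degree in the auxiliary modes, so it passes the physical creation operators
  without a sign. All factors of the sign but one compare positions along a single chain of sites.
  The inversion factor compares sources and targets at once; this is the origin of the logarithm in
  the depth. They are reset after each measurement and used again.\<close>

definition pm :: "bool \<Rightarrow> complex" where
  "pm b = (if b then -1 else 1)"

lemma pm_simps [simp]: "pm True = -1" "pm False = 1" "pm (\<not> a) = - pm a" "pm b * pm b = 1"
  by (auto simp: pm_def)

lemma pm_mult: "pm a * pm b = pm (a \<noteq> b)"
  by (auto simp: pm_def)

lemma pm_square_left [simp]: "pm b * (pm b * x) = x"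
  by (auto simp: pm_def)

text \<open>Addition of subsets as vectors over the field with two elements; on basis vectors it
  flips the qubits of \<open>B\<close>.\<close>

definition sd :: "'a set \<Rightarrow> 'a set \<Rightarrow> 'a set" where
  "sd A B = {x. (x \<in> A) \<noteq> (x \<in> B)}"

lemma in_sd [simp]: "x \<in> sd A B \<longleftrightarrow> (x \<in> A) \<noteq> (x \<in> B)"
  by (simp add: sd_def)

lemma sd_assoc: "sd (sd A B) C = sd A (sd B C)"
  by auto

lemma sd_sd [simp]: "sd (sd A B) B = A" and sd_empty [simp]: "sd A {} = A"
  by auto

lemma finite_sd [simp]: "finite A \<Longrightarrow> finite B \<Longrightarrow> finite (sd A B)"
  by (rule finite_subset[of _ "A \<union> B"]) auto

lemma jw_sign_flip:
  assumes "finite S"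
  shows "jw_sign k (sd S {q}) = jw_sign k S * pm (jw_before q k)"
proof (cases "q \<in> S")
  case True
  then have "sd S {q} = S - {q}" by auto
  with True show ?thesis using jw_sign_remove[OF assms True, of k] by (auto simp: pm_def)
next
  case False
  then have "sd S {q} = insert q S" by auto
  with False show ?thesis using jw_sign_insert[OF assms False, of k] by (auto simp: pm_def)
qed

lemma jw_sign_flip2:
  assumes "finite S" "p \<noteq> q"
  shows "jw_sign k (sd S {p, q}) = jw_sign k S * pm (jw_before p k) * pm (jw_before q k)"
proof -
  have "sd S {p, q} = sd (sd S {p}) {q}" using assms by auto
  then show ?thesis using assms by (simp add: jw_sign_flip)
qed

text \<open>Each of the two Majorana operators flips one qubit and contributes its string; the
  scalars \<i> and -\<i> multiply to 1. \<open>pm (i < j)\<close> arises because the string of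
  \<open>Aux j l\<close> is evaluated after \<open>Aux i l\<close> has been flipped, and the last
  factor is the sign that distinguishes d from c.\<close>

definition stab_sign :: "nat \<Rightarrow> nat \<Rightarrow> nat \<Rightarrow> qubit set \<Rightarrow> complex" where
  "stab_sign l i j S =
     jw_sign (Aux i l) S * jw_sign (Aux j l) S * pm (i < j) * pm (Aux j l \<in> S)"

lemma stabilizer_apply:
  assumes "finite S" "i \<noteq> j"
  shows "stabilizer l i j \<psi> S = stab_sign l i j S * \<psi> (sd S {Aux i l, Aux j l})"
proof -
  let ?i = "Aux i l" and ?j = "Aux j l"
  have c: "majorana_c l i \<eta> S = jw_sign ?i S * \<eta> (sd S {?i})" for \<eta>
  proof (cases "?i \<in> S")
    case True
    then have "sd S {?i} = S - {?i}" by auto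
    with True show ?thesis by (simp add: majorana_c_def annihilate_def create_def)
  next
    case False
    then have "sd S {?i} = insert ?i S" by auto
    with False show ?thesis by (simp add: majorana_c_def annihilate_def create_def)
  qed
  have d: "majorana_d l j \<psi> U = - \<i> * jw_sign ?j U * pm (?j \<in> U) * \<psi> (sd U {?j})" for U
  proof (cases "?j \<in> U")
    case True
    then have "sd U {?j} = U - {?j}" by auto
    with True show ?thesis by (simp add: majorana_d_def annihilate_def create_def)
  next
    case False
    then have "sd U {?j} = insert ?j U" by auto
    with False show ?thesis by (simp add: majorana_d_def annihilate_def create_def)
  qed
  have s: "sd (sd S {?i}) {?j} = sd S {?i, ?j}" using assms by auto
  show ?thesis
    unfolding stabilizer_def c d s stab_sign_def using assms
    by (simp add: jw_sign_flip mult_ac)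
qed

lemma stab_sign_square [simp]: "stab_sign l i j S * stab_sign l i j S = 1"
proof -
  have "stab_sign l i j S * stab_sign l i j S =
    (jw_sign (Aux i l) S * jw_sign (Aux i l) S) * (jw_sign (Aux j l) S * jw_sign (Aux j l) S) *
    (pm (i < j) * pm (i < j)) * (pm (Aux j l \<in> S) * pm (Aux j l \<in> S))"
    unfolding stab_sign_def by (simp only: mult_ac)
  then show ?thesis by (simp only: jw_sign_square pm_simps mult_1)
qed

text \<open>
  The circuit works in a frame in which the physical qubit of a site carries the parity of its own
  value and of the auxiliary qubits of that site in the layers up to \<open>l\<close>. In this frame
  Jordan--Wigner strings are prefix parities of the physical qubits.
\<close>

definition vmap :: "nat \<Rightarrow> qubit set \<Rightarrow> qubit set" where
  "vmap l S = sd S {Phys i | i. odd (card {m \<in> {1..l}. Aux i m \<in> S})}"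

definition prefix_sign :: "nat \<Rightarrow> nat \<Rightarrow> nat \<Rightarrow> qubit set \<Rightarrow> complex" where
  "prefix_sign N l i S = (\<Prod>i'\<in>{1..N}. pm (i' \<le> i \<and> Phys i' \<in> vmap (l - 1) S))"

lemma Phys_vmap_insert:
  assumes "q \<in> phys_qubits N \<union> aux_qubits N l" "q \<notin> S"
  shows "Phys i \<in> vmap l (insert q S) \<longleftrightarrow>
    (Phys i \<in> vmap l S) \<noteq> (q = Phys i \<or> (\<exists>m. q = Aux i m))"
proof (cases "\<exists>m. q = Aux i m")
  case True
  then obtain m where m: "q = Aux i m" by blast
  then have "m \<in> {1..l}" "Aux i m \<notin> S" using assms by (auto simp: aux_qubits_def phys_qubits_def)
  then have "{m' \<in> {1..l}. Aux i m' \<in> insert q S} = insert m {m' \<in> {1..l}. Aux i m' \<in> S}"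
    using m by auto
  then have "card {m' \<in> {1..l}. Aux i m' \<in> insert q S} = Suc (card {m' \<in> {1..l}. Aux i m' \<in> S})"
    using \<open>Aux i m \<notin> S\<close> by simp
  then show ?thesis using m by (simp add: vmap_def)
next
  case False
  then have "{m' \<in> {1..l}. Aux i m' \<in> insert q S} = {m' \<in> {1..l}. Aux i m' \<in> S}" by auto
  then show ?thesis using False assms(2) by (auto simp: vmap_def)
qed

text \<open>A physical qubit, or an auxiliary qubit of a layer below \<open>l\<close>, precedes
  \<open>Aux i l\<close> exactly when its site is at most \<open>i\<close>. Every qubit of
  \<open>S\<close> toggles the frame bit of its own site, so the string is the parity of the frame
  bits up to \<open>i\<close>.\<close>

lemma jw_sign_prefix:
  assumes "S \<subseteq> phys_qubits N \<union> aux_qubits N (l - 1)"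
  shows "jw_sign (Aux i l) S = prefix_sign N l i S"
proof -
  have "finite S" using assms by (rule finite_subset) (simp add: finite_mode_qubits)
  then show ?thesis using assms
  proof (induction S)
    case empty
    then show ?case by (simp add: jw_sign_def prefix_sign_def vmap_def)
  next
    case (insert q S)
    then have q: "q \<in> phys_qubits N \<union> aux_qubits N (l - 1)" by blast
    obtain p where p: "p \<in> {1..N}" "q = Phys p \<or> (\<exists>m. q = Aux p m)" "jw_before q (Aux i l) \<longleftrightarrow> p \<le> i"
    proof (cases q)
      case (Aux p m)
      then have "m < l" using q by (auto simp: phys_qubits_def aux_qubits_def)
      moreover have "p < i \<or> p = i \<longleftrightarrow> p \<le> i" by auto
      ultimately show ?thesis using that[of p] Aux q by (auto simp: phys_qubits_def aux_qubits_def)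
    qed (use q in \<open>auto simp: phys_qubits_def aux_qubits_def\<close>)
    have eq: "(q = Phys i' \<or> (\<exists>m. q = Aux i' m)) \<longleftrightarrow> i' = p" for i' using p(2) by auto
    have "prefix_sign N l i (insert q S) =
        (\<Prod>i'\<in>{1..N}. pm (i' \<le> i \<and> Phys i' \<in> vmap (l - 1) S) * (if i' = p then pm (p \<le> i) else 1))"
      unfolding prefix_sign_def Phys_vmap_insert[OF q insert(2)] eq
      by (rule prod.cong) (auto simp: pm_def)
    also have "\<dots> = prefix_sign N l i S * pm (p \<le> i)"
      unfolding prod.distrib prefix_sign_def using p(1) by (simp add: prod.delta)
    finally show ?case
      using insert p(3) by (auto simp: jw_sign_insert pm_def)
  qed
qed

text \<open>
  On a basis vector with empty layer \<open>l\<close>, the product of the stabilizers of the edges with sources in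
  \<open>T\<close> (\<open>\<sigma>\<close> maps a source to its target) flips \<open>edge_flip\<close>; the sign is quadratic in \<open>T\<close>.
\<close>

definition edge_flip :: "(nat \<Rightarrow> nat) \<Rightarrow> nat \<Rightarrow> nat set \<Rightarrow> qubit set" where
  "edge_flip \<sigma> l T = sd ((\<lambda>i. Aux i l) ` T) ((\<lambda>i. Aux (\<sigma> i) l) ` T)"

definition edge_sign :: "nat \<Rightarrow> (nat \<Rightarrow> nat) \<Rightarrow> nat \<Rightarrow> nat set \<Rightarrow> qubit set \<Rightarrow> complex" where
  "edge_sign N \<sigma> l T S = (\<Prod>i\<in>T. prefix_sign N l i S) * (\<Prod>i\<in>T. prefix_sign N l (\<sigma> i) S) *
     (\<Prod>i\<in>T. \<Prod>i'\<in>T. pm (i' \<le> \<sigma> i)) * (\<Prod>i\<in>T. \<Prod>i'\<in>T. pm (i' < i \<and> \<sigma> i' < \<sigma> i))"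

definition edge_product :: "nat \<Rightarrow> (nat \<Rightarrow> nat) \<Rightarrow> nat \<Rightarrow> nat set \<Rightarrow> state \<Rightarrow> state" where
  "edge_product N \<sigma> l T \<psi> =
     (\<lambda>S. edge_sign N \<sigma> l T (sd S (edge_flip \<sigma> l T)) * \<psi> (sd S (edge_flip \<sigma> l T)))"

lemma edge_flip_insert:
  assumes "i \<notin> T" "\<sigma> i \<notin> \<sigma> ` T" "\<sigma> i \<noteq> i"
  shows "edge_flip \<sigma> l (insert i T) = sd (edge_flip \<sigma> l T) {Aux i l, Aux (\<sigma> i) l}"
  using assms by (auto simp: edge_flip_def)

lemma finite_edge_flip [simp]: "finite T \<Longrightarrow> finite (edge_flip \<sigma> l T)"
  by (simp add: edge_flip_def)

text \<open>In contrast to the lower layers, qubits of layer \<open>l\<close> itself enter the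
  string at \<open>k\<close> only from sites strictly before \<open>k\<close>; each edge of
  \<open>T\<close> contributes its two end points.\<close>

lemma jw_sign_edge_flip:
  assumes "finite T" "inj_on \<sigma> T" "\<forall>i\<in>T. \<sigma> i \<noteq> i"
    and "S \<subseteq> phys_qubits N \<union> aux_qubits N (l - 1)"
  shows "jw_sign (Aux k l) (sd S (edge_flip \<sigma> l T)) =
    prefix_sign N l k S * (\<Prod>i\<in>T. pm (i < k) * pm (\<sigma> i < k))"
  using assms(1-3)
proof (induction T)
  case empty
  then show ?case by (simp add: edge_flip_def jw_sign_prefix[OF assms(4)])
next
  case (insert i T)
  have "finite S" using assms(4) by (rule finite_subset) (simp add: finite_mode_qubits)
  then have fin: "finite (sd S (edge_flip \<sigma> l T))" using insert by simp
  have "sd S (edge_flip \<sigma> l (insert i T)) = sd (sd S (edge_flip \<sigma> l T)) {Aux i l, Aux (\<sigma> i) l}"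
    unfolding sd_assoc by (rule arg_cong[of _ _ "sd S"], rule edge_flip_insert) (use insert in auto)
  then show ?case
    using insert jw_sign_flip2[OF fin, of "Aux i l" "Aux (\<sigma> i) l"] by simp
qed

text \<open>The new stabilizer compares its end points with those of every \<open>k\<close> in
  \<open>T\<close>. These comparisons have to reproduce the cross terms with \<open>i\<close> in the
  two double products, and the comparison of the new edge with itself has to give the diagonal term
  \<open>pm (i \<le> \<sigma> i)\<close>.\<close>

lemma edge_sign_insert:
  assumes T: "finite T" "i \<notin> T" "inj_on \<sigma> (insert i T)" "\<forall>k\<in>insert i T. \<sigma> k \<noteq> k"
    and S: "S \<subseteq> phys_qubits N \<union> aux_qubits N (l - 1)" and l: "l \<ge> 1"
  shows "stab_sign l i (\<sigma> i) (sd S (edge_flip \<sigma> l (insert i T))) * edge_sign N \<sigma> l T S =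
    edge_sign N \<sigma> l (insert i T) S"
proof -
  let ?T = "insert i T"
  have nin: "Aux k l \<notin> S" for k using S l by (auto simp: aux_qubits_def phys_qubits_def)
  \<comment> \<open>The target qubit is 1 after the flips unless \<sigma> i is also the source of an
    edge of \<open>T\<close>; in that case two edges flip it.\<close>
  have mem: "Aux (\<sigma> i) l \<in> sd S (edge_flip \<sigma> l ?T) \<longleftrightarrow> \<sigma> i \<notin> ?T"
    using nin by (auto simp: edge_flip_def)
  have pmT: "pm (\<sigma> i \<notin> ?T) = - (\<Prod>k\<in>T. pm (k = \<sigma> i))"
  proof (cases "\<sigma> i \<in> T")
    case True
    then have "(\<Prod>k\<in>T. pm (k = \<sigma> i)) = (\<Prod>k\<in>T. if k = \<sigma> i then -1 else 1)"
      by (intro prod.cong) (auto simp: pm_def)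
    then show ?thesis using True T(1) by simp
  next
    case False
    then have "(\<Prod>k\<in>T. pm (k = \<sigma> i)) = (\<Prod>k\<in>T. 1)"
      by (intro prod.cong) (auto simp: pm_def)
    then show ?thesis using False T by (auto simp: pm_def)
  qed
  \<comment> \<open>As the sources and the targets are distinct,
    \<open>pm (k < i) * pm (\<sigma> k < \<sigma> i)\<close> is minus the sign that records whether
    the two comparisons agree. This minus cancels the one in
    \<open>pm (\<sigma> k < i) = - pm (i \<le> \<sigma> k)\<close>.\<close>
  have key: "(pm (k < i) * pm (\<sigma> k < i)) * (pm (k < \<sigma> i) * pm (\<sigma> k < \<sigma> i)) * pm (k = \<sigma> i) =
      pm (k \<le> \<sigma> i) * pm (i \<le> \<sigma> k) * (pm (k < i \<and> \<sigma> k < \<sigma> i) * pm (i < k \<and> \<sigma> i < \<sigma> k))"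
    if "k \<in> T" for k
  proof -
    have "k \<noteq> i" "\<sigma> k \<noteq> \<sigma> i" using that T(2,3) by (auto simp: inj_on_def)
    then show ?thesis by (auto simp: pm_def)
  qed
  let ?A = "\<lambda>k. pm (k < i) * pm (\<sigma> k < i)" and ?B = "\<lambda>k. pm (k < \<sigma> i) * pm (\<sigma> k < \<sigma> i)"
  have own: "(?A i * ?B i) * pm (i < \<sigma> i) * (-1) = pm (i \<le> \<sigma> i)"
    using T(4) by (auto simp: pm_def)
  have "stab_sign l i (\<sigma> i) (sd S (edge_flip \<sigma> l ?T)) =
      (prefix_sign N l i S * (\<Prod>k\<in>?T. ?A k)) * (prefix_sign N l (\<sigma> i) S * (\<Prod>k\<in>?T. ?B k)) *
      pm (i < \<sigma> i) * pm (\<sigma> i \<notin> ?T)"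
    unfolding stab_sign_def mem using T S by (simp only: jw_sign_edge_flip finite_insert)
  also have "\<dots> = prefix_sign N l i S * prefix_sign N l (\<sigma> i) S *
      ((?A i * ?B i) * pm (i < \<sigma> i) * (-1)) *
      ((\<Prod>k\<in>T. ?A k) * (\<Prod>k\<in>T. ?B k) * (\<Prod>k\<in>T. pm (k = \<sigma> i)))"
    unfolding pmT prod.insert[OF T(1,2)] by (simp only: mult_ac mult_minus_left mult_minus_right mult_1_right mult_1_left)
  also have "(\<Prod>k\<in>T. ?A k) * (\<Prod>k\<in>T. ?B k) * (\<Prod>k\<in>T. pm (k = \<sigma> i)) =
      (\<Prod>k\<in>T. ?A k * ?B k * pm (k = \<sigma> i))"
    by (simp only: prod.distrib)
  also have "\<dots> = (\<Prod>k\<in>T. pm (k \<le> \<sigma> i) * pm (i \<le> \<sigma> k) * (pm (k < i \<and> \<sigma> k < \<sigma> i) * pm (i < k \<and> \<sigma> i < \<sigma> k)))"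
    by (rule prod.cong[OF refl key])
  finally have st: "stab_sign l i (\<sigma> i) (sd S (edge_flip \<sigma> l ?T)) =
      prefix_sign N l i S * prefix_sign N l (\<sigma> i) S * pm (i \<le> \<sigma> i) *
      ((\<Prod>k\<in>T. pm (k \<le> \<sigma> i)) * (\<Prod>k\<in>T. pm (i \<le> \<sigma> k)) *
       ((\<Prod>k\<in>T. pm (k < i \<and> \<sigma> k < \<sigma> i)) * (\<Prod>k\<in>T. pm (i < k \<and> \<sigma> i < \<sigma> k))))"
    unfolding own prod.distrib .
  show ?thesis
    unfolding st edge_sign_def prod.insert[OF T(1,2)] prod.distrib
    by (simp add: mult_ac)
qed

section \<open>Stabilizers as operators on the states of a finite register\<close>

lemma state_ofI: "(\<And>S. \<not> S \<subseteq> R \<Longrightarrow> \<psi> S = 0) \<Longrightarrow> state_of R \<psi>"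
  unfolding state_of_def by blast

lemma state_of_mono: "state_of R \<psi> \<Longrightarrow> R \<subseteq> R' \<Longrightarrow> state_of R' \<psi>"
  unfolding state_of_def by blast

lemma state_of_scale: "state_of R \<psi> \<Longrightarrow> state_of R (\<lambda>S. c S * \<psi> S)"
  by (simp add: state_of_def)

lemma stabilizer_scale: "stabilizer l i j (\<lambda>S. c * \<psi> S) = (\<lambda>S. c * stabilizer l i j \<psi> S)"
  by (rule ext)
    (simp add: stabilizer_def majorana_c_def majorana_d_def annihilate_def create_def algebra_simps)

lemma stabilizer_add:
  "stabilizer l i j (\<lambda>S. \<psi> S + \<theta> S) = (\<lambda>S. stabilizer l i j \<psi> S + stabilizer l i j \<theta> S)"
  by (rule ext)
    (simp add: stabilizer_def majorana_c_def majorana_d_def annihilate_def create_def algebra_simps)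

lemma stabilizer_zero: "stabilizer l i j (\<lambda>S. 0) = (\<lambda>S. 0)"
  by (rule ext) (simp add: stabilizer_def majorana_c_def majorana_d_def annihilate_def create_def)

lemma stabilizer_sum:
  "stabilizer l i j (\<lambda>S. \<Sum>x\<in>A. c x * \<psi> x S) = (\<lambda>S. \<Sum>x\<in>A. c x * stabilizer l i j (\<psi> x) S)"
  by (induction A rule: infinite_finite_induct)
    (simp_all add: stabilizer_zero stabilizer_add stabilizer_scale)

text \<open>The sign rule for strings relies on \<open>card\<close> and thus on finite sets. A state
  of a finite register vanishes elsewhere, and so do both sides.\<close>

lemma stabilizer_eq:
  assumes "state_of R \<psi>" "finite R" "i \<noteq> j"
  shows "stabilizer l i j \<psi> = (\<lambda>S. stab_sign l i j S * \<psi> (sd S {Aux i l, Aux j l}))"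
proof
  fix S
  show "stabilizer l i j \<psi> S = stab_sign l i j S * \<psi> (sd S {Aux i l, Aux j l})"
  proof (cases "finite S")
    case True
    then show ?thesis using assms(3) by (rule stabilizer_apply)
  next
    case False
    have z: "\<psi> U = 0" if "infinite U" for U
      using that assms(1,2) finite_subset unfolding state_of_def by blast
    have "sd (sd S {Aux i l, Aux j l}) {Aux i l, Aux j l} = S" by (rule sd_sd)
    then have "infinite (sd S {Aux i l, Aux j l})"
      using False finite_sd[of "sd S {Aux i l, Aux j l}" "{Aux i l, Aux j l}"] by auto
    then have "\<psi> (sd S {Aux i l, Aux j l}) = 0" by (rule z)
    moreover have "stabilizer l i j \<psi> S = 0"
      using False z by (simp add: stabilizer_def majorana_c_def majorana_d_def annihilate_def create_def)
    ultimately show ?thesis by simp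
  qed
qed

lemma state_of_stabilizer:
  assumes "state_of R \<psi>" "finite R" "i \<noteq> j" "Aux i l \<in> R" "Aux j l \<in> R"
  shows "state_of R (stabilizer l i j \<psi>)"
proof (rule state_ofI)
  fix S assume "\<not> S \<subseteq> R"
  then obtain t where "t \<in> S" "t \<notin> R" by blast
  then have "t \<in> sd S {Aux i l, Aux j l}" "t \<notin> R" using assms(4,5) by auto
  then have "\<not> sd S {Aux i l, Aux j l} \<subseteq> R" by blast
  then show "stabilizer l i j \<psi> S = 0"
    using assms(1) unfolding stabilizer_eq[OF assms(1-3)] state_of_def by auto
qed

text \<open>Of the two strings exactly one passes over the other end point, and its change of sign
  cancels that of the Pauli Z factor at \<open>j\<close>. This is why a stabilizer squares to the
  identity.\<close>

lemma stab_sign_flip: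
  assumes "finite S" "i \<noteq> j"
  shows "stab_sign l i j (sd S {Aux i l, Aux j l}) = stab_sign l i j S"
proof -
  have m: "Aux j l \<in> sd S {Aux i l, Aux j l} \<longleftrightarrow> Aux j l \<notin> S" by auto
  show ?thesis
    unfolding stab_sign_def m using assms
    by (cases "i < j") (simp_all add: jw_sign_flip2 nat_neq_iff)
qed

lemma stabilizer_stabilizer:
  assumes "state_of R \<psi>" "finite R" "i \<noteq> j" "Aux i l \<in> R" "Aux j l \<in> R"
  shows "stabilizer l i j (stabilizer l i j \<psi>) = \<psi>"
proof
  fix S
  have st: "state_of R (stabilizer l i j \<psi>)" using assms by (rule state_of_stabilizer)
  show "stabilizer l i j (stabilizer l i j \<psi>) S = \<psi> S"
  proof (cases "finite S")
    case True
    then show ?thesis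
      using stab_sign_flip[OF True assms(3), of l] fun_cong[OF stabilizer_eq[where l=l, OF st assms(2,3)], where x=S]
        stabilizer_eq[where l=l, OF assms(1-3)] by (simp flip: mult.assoc)
  next
    case False
    then have "\<not> S \<subseteq> R" using assms(2) finite_subset by blast
    then show ?thesis
      using state_of_stabilizer[OF st assms(2-5)] assms(1) unfolding state_of_def by metis
  qed
qed

lemma stab_sign_other:
  assumes "finite S" "p \<noteq> q" "l \<noteq> m"
  shows "stab_sign l i j (sd S {Aux p m, Aux q m}) = stab_sign l i j S *
     (pm (jw_before (Aux p m) (Aux i l)) * pm (jw_before (Aux q m) (Aux i l)) *
      (pm (jw_before (Aux p m) (Aux j l)) * pm (jw_before (Aux q m) (Aux j l))))"
proof -
  have "Aux j l \<in> sd S {Aux p m, Aux q m} \<longleftrightarrow> Aux j l \<in> S" using assms by auto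
  then show ?thesis
    unfolding stab_sign_def using assms by (simp only: jw_sign_flip2 qubit.inject not_False_eq_True simp_thms mult_ac)
qed

lemma stabilizer_commute:
  assumes "state_of R \<psi>" "finite R" "l \<noteq> m" "i \<noteq> j" "p \<noteq> q"
    and "Aux i l \<in> R" "Aux j l \<in> R" "Aux p m \<in> R" "Aux q m \<in> R"
  shows "stabilizer l i j (stabilizer m p q \<psi>) = stabilizer m p q (stabilizer l i j \<psi>)"
proof
  fix S
  have st: "state_of R (stabilizer m p q \<psi>)" "state_of R (stabilizer l i j \<psi>)"
    using assms by (auto intro!: state_of_stabilizer)
  show "stabilizer l i j (stabilizer m p q \<psi>) S = stabilizer m p q (stabilizer l i j \<psi>) S"
  proof (cases "finite S")
    case True
    have swap: "pm (jw_before (Aux x m) (Aux y l)) = - pm (jw_before (Aux y l) (Aux x m))" for x y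
      using jw_before_swap[of "Aux x m" "Aux y l"] assms(3) by (auto simp: is_mode_def pm_def)
    have "sd (sd S {Aux i l, Aux j l}) {Aux p m, Aux q m} =
        sd (sd S {Aux p m, Aux q m}) {Aux i l, Aux j l}" by auto
    moreover have "stab_sign l i j S * stab_sign m p q (sd S {Aux i l, Aux j l}) =
        stab_sign m p q S * stab_sign l i j (sd S {Aux p m, Aux q m})"
      using True assms(3-5) by (simp add: stab_sign_other swap mult_ac del: jw_before.simps)
    ultimately show ?thesis
      using fun_cong[OF stabilizer_eq[where l=l, OF st(1) assms(2,4)], where x=S]
        fun_cong[OF stabilizer_eq[where l=m, OF st(2) assms(2,5)], where x=S]
        stabilizer_eq[where l=l, OF assms(1,2,4)] stabilizer_eq[where l=m, OF assms(1,2,5)]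
      by (simp flip: mult.assoc)
  next
    case False
    then have "\<not> S \<subseteq> R" using assms(2) finite_subset by blast
    then show ?thesis
      using state_of_stabilizer[OF st(1) assms(2,4,6,7)] state_of_stabilizer[OF st(2) assms(2,5,8,9)]
      unfolding state_of_def by metis
  qed
qed

text \<open>Each of the two Majorana operators picks up the parity of the physical modes when it
  passes them; the two parities cancel.\<close>

lemma stabilizer_fermionic_product:
  assumes "state_of (aux_qubits N \<nu>) \<Psi>" "i \<noteq> j" "Aux i l \<in> aux_qubits N \<nu>" "Aux j l \<in> aux_qubits N \<nu>"
  shows "stabilizer l i j (fermionic_product N \<nu> \<phi> \<Psi>) = fermionic_product N \<nu> \<phi> (stabilizer l i j \<Psi>)"
proof
  fix S
  let ?P = "phys_qubits N" and ?A = "aux_qubits N \<nu>" and ?X = "{Aux i l, Aux j l}"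
  have fin: "finite ?P" "finite ?A" by (simp_all add: finite_mode_qubits)
  have st: "state_of (?P \<union> ?A) (fermionic_product N \<nu> \<phi> \<Psi>)"
    by (rule state_ofI) (simp add: fermionic_product_def)
  have XP: "?X \<inter> ?P = {}" by (auto simp: phys_qubits_def)
  have XA: "?X \<subseteq> ?A" using assms by simp
  show "stabilizer l i j (fermionic_product N \<nu> \<phi> \<Psi>) S = fermionic_product N \<nu> \<phi> (stabilizer l i j \<Psi>) S"
  proof (cases "S \<subseteq> ?P \<union> ?A")
    case True
    have phys: "jw_sign (Aux k l) (S \<inter> ?P) * (\<Prod>p\<in>S \<inter> ?P. pm (jw_before (Aux k l) p)) =
        (-1) ^ card (S \<inter> ?P)" for k
    proof -
      have "jw_sign (Aux k l) Y = (\<Prod>p\<in>Y. pm (jw_before p (Aux k l)))" if "finite Y" for Y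
        using that
      proof (induction Y)
        case empty
        then show ?case by (simp add: jw_sign_def)
      next
        case (insert x F)
        then show ?case by (simp add: jw_sign_insert pm_def)
      qed
      then have "jw_sign (Aux k l) (S \<inter> ?P) * (\<Prod>p\<in>S \<inter> ?P. pm (jw_before (Aux k l) p)) =
          (\<Prod>p\<in>S \<inter> ?P. pm (jw_before p (Aux k l)) * pm (jw_before (Aux k l) p))"
        using fin by (simp add: prod.distrib)
      also have "\<dots> = (\<Prod>p\<in>S \<inter> ?P. -1)"
      proof (rule prod.cong[OF refl])
        fix p assume "p \<in> S \<inter> ?P"
        then obtain x where "p = Phys x" by (auto simp: phys_qubits_def)
        then show "pm (jw_before p (Aux k l)) * pm (jw_before (Aux k l) p) = -1"
          by (auto simp: pm_def)
      qed
      finally show ?thesis by simp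
    qed
    have "sd S ?X \<inter> ?P = S \<inter> ?P" using XP by auto
    moreover have "sd S ?X \<inter> ?A = sd (S \<inter> ?A) ?X" using XA by auto
    moreover have "sd S ?X \<subseteq> ?P \<union> ?A" using True XA by (auto simp: sd_def)
    moreover have "(\<Prod>p\<in>S \<inter> ?P. jw_sign p (sd (S \<inter> ?A) ?X)) =
        (\<Prod>p\<in>S \<inter> ?P. jw_sign p (S \<inter> ?A)) *
        ((\<Prod>p\<in>S \<inter> ?P. pm (jw_before (Aux i l) p)) * (\<Prod>p\<in>S \<inter> ?P. pm (jw_before (Aux j l) p)))"
      using fin assms(2) by (simp add: jw_sign_flip2 prod.distrib mult_ac)
    moreover have "stab_sign l i j S = stab_sign l i j (S \<inter> ?A) *
        (jw_sign (Aux i l) (S \<inter> ?P) * jw_sign (Aux j l) (S \<inter> ?P))"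
      using True assms(4) unfolding stab_sign_def by (simp add: jw_sign_split[OF True] mult_ac)
    moreover have "(jw_sign (Aux i l) (S \<inter> ?P) * (\<Prod>p\<in>S \<inter> ?P. pm (jw_before (Aux i l) p))) *
        (jw_sign (Aux j l) (S \<inter> ?P) * (\<Prod>p\<in>S \<inter> ?P. pm (jw_before (Aux j l) p))) = 1"
      unfolding phys by (simp flip: power_mult_distrib)
    ultimately show ?thesis
      unfolding stabilizer_eq[OF st finite_UnI[OF fin] assms(2)] stabilizer_eq[OF assms(1) fin(2) assms(2)]
      using True by (simp add: fermionic_product_def mult_ac)
  next
    case False
    then have "stabilizer l i j (fermionic_product N \<nu> \<phi> \<Psi>) S = 0"
      using state_of_stabilizer[OF st _ assms(2), of l] fin assms(3,4) unfolding state_of_def by auto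
    with False show ?thesis by (simp add: fermionic_product_def)
  qed
qed

section \<open>Projection onto the joint eigenspaces of the layers\<close>

lemma sum_Pow_insert:
  assumes "finite A" "i \<notin> A"
  shows "sum f (Pow (insert i A)) = (\<Sum>T\<in>Pow A. f T + f (insert i T))"
proof -
  have "inj_on (insert i) (Pow A)" using assms(2) by (auto simp: inj_on_def)
  moreover have "Pow A \<inter> insert i ` Pow A = {}" using assms(2) by auto
  ultimately show ?thesis
    using assms(1) by (simp add: Pow_insert sum.union_disjoint sum.reindex sum.distrib)
qed

text \<open>With at most one outgoing and one incoming edge per vertex, a layer is the graph of a
  partial injection without fixed points. It is stored as its domain and its values, so that sets of
  edges become sets of sources.\<close>

locale edge_layers =
  fixes N :: nat and src :: "nat \<Rightarrow> nat set" and tgt :: "nat \<Rightarrow> nat \<Rightarrow> nat"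
  assumes src_subset: "src l \<subseteq> {1..N}"
    and tgt_in: "i \<in> src l \<Longrightarrow> tgt l i \<in> {1..N}"
    and tgt_neq: "i \<in> src l \<Longrightarrow> tgt l i \<noteq> i"
    and tgt_inj: "inj_on (tgt l) (src l)"
begin

lemma finite_src [simp]: "finite (src l)"
  using src_subset by (rule finite_subset) simp

lemma src_tgt_Aux:
  "i \<in> src l \<Longrightarrow> 1 \<le> l \<Longrightarrow> l \<le> n \<Longrightarrow> Aux i l \<in> aux_qubits N n \<and> Aux (tgt l i) l \<in> aux_qubits N n"
  using src_subset[of l] tgt_in[of i l] by (auto simp: aux_qubits_def)

lemma aux_qubits_mono: "n \<le> n' \<Longrightarrow> aux_qubits N n \<subseteq> aux_qubits N n'"
  by (auto simp: aux_qubits_def)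

abbreviation layer_product :: "nat \<Rightarrow> nat set \<Rightarrow> state \<Rightarrow> state" where
  "layer_product l \<equiv> edge_product N (tgt l) l"

lemma state_of_layer_product:
  assumes "T \<subseteq> src l" "1 \<le> l" "state_of (Q \<union> aux_qubits N (l - 1)) \<psi>"
  shows "state_of (Q \<union> aux_qubits N l) (layer_product l T \<psi>)"
proof (rule state_ofI)
  fix S assume S: "\<not> S \<subseteq> Q \<union> aux_qubits N l"
  have "edge_flip (tgt l) l T \<subseteq> aux_qubits N l"
    using assms(1,2) src_tgt_Aux[of _ l l] by (force simp: edge_flip_def)
  moreover have "aux_qubits N (l - 1) \<subseteq> aux_qubits N l" by (rule aux_qubits_mono) simp
  ultimately have "\<not> sd S (edge_flip (tgt l) l T) \<subseteq> Q \<union> aux_qubits N (l - 1)" using S by (auto simp: subset_iff)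
  then show "layer_product l T \<psi> S = 0" using assms(3) by (auto simp: edge_product_def state_of_def)
qed

lemma layer_product_empty [simp]: "layer_product l {} \<psi> = \<psi>"
  by (simp add: edge_product_def edge_flip_def edge_sign_def)

text \<open>This identifies \<open>edge_product\<close> with the product of the stabilizers of
  \<open>T\<close>, in whatever order the edges are inserted. The closed form of the sign is correct
  because layer \<open>l\<close> is empty in \<psi>.\<close>

lemma stabilizer_layer_product:
  assumes T: "insert i T \<subseteq> src l" "i \<notin> T" and l: "1 \<le> l"
    and \<psi>: "state_of (phys_qubits N \<union> aux_qubits N (l - 1)) \<psi>"
  shows "stabilizer l i (tgt l i) (layer_product l T \<psi>) = layer_product l (insert i T) \<psi>"
proof
  fix S
  have st: "state_of (phys_qubits N \<union> aux_qubits N l) (layer_product l T \<psi>)"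
    using state_of_layer_product T l \<psi> by simp
  have fin: "finite (phys_qubits N \<union> aux_qubits N l)" by (simp add: finite_mode_qubits)
  have ne: "i \<noteq> tgt l i" using tgt_neq[of i l] T by auto
  have finT: "finite T" using T by (auto intro: finite_subset[OF _ finite_src[of l]])
  have inj: "inj_on (tgt l) (insert i T)" using tgt_inj T(1) by (rule inj_on_subset)
  have nej: "\<forall>k\<in>insert i T. tgt l k \<noteq> k" using tgt_neq T(1) by blast
  define S0 where "S0 = sd S (edge_flip (tgt l) l (insert i T))"
  have S: "S = sd S0 (edge_flip (tgt l) l (insert i T))" by (simp add: S0_def)
  have S0: "sd (sd S {Aux i l, Aux (tgt l i) l}) (edge_flip (tgt l) l T) = S0"
  proof -
    have "edge_flip (tgt l) l (insert i T) = sd (edge_flip (tgt l) l T) {Aux i l, Aux (tgt l i) l}"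
      using T(2) inj nej by (intro edge_flip_insert) (auto simp: inj_on_def)
    then show ?thesis unfolding S0_def by auto
  qed
  have "stabilizer l i (tgt l i) (layer_product l T \<psi>) S =
      stab_sign l i (tgt l i) S * edge_sign N (tgt l) l T S0 * \<psi> S0"
    unfolding stabilizer_eq[OF st fin ne] unfolding edge_product_def S0 by simp
  also have "\<dots> = edge_sign N (tgt l) l (insert i T) S0 * \<psi> S0"
  proof (cases "\<psi> S0 = 0")
    case False
    then have "S0 \<subseteq> phys_qubits N \<union> aux_qubits N (l - 1)" using \<psi> by (simp add: state_of_def)
    from edge_sign_insert[OF finT T(2) inj nej this l] show ?thesis by (simp add: S[symmetric])
  qed simp
  finally show "stabilizer l i (tgt l i) (layer_product l T \<psi>) S = layer_product l (insert i T) \<psi> S"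
    by (simp add: edge_product_def S0_def)
qed

definition layer_projection :: "nat \<Rightarrow> (nat \<Rightarrow> complex) \<Rightarrow> state \<Rightarrow> state" where
  "layer_projection l s \<psi> = (\<lambda>S. \<Sum>T\<in>Pow (src l). (\<Prod>i\<in>T. s i) * layer_product l T \<psi> S)"

lemma state_of_layer_projection:
  assumes "1 \<le> l" "state_of (Q \<union> aux_qubits N (l - 1)) \<psi>"
  shows "state_of (Q \<union> aux_qubits N l) (layer_projection l s \<psi>)"
proof (rule state_ofI)
  fix S assume S: "\<not> S \<subseteq> Q \<union> aux_qubits N l"
  then have "layer_product l T \<psi> S = 0" if "T \<in> Pow (src l)" for T
    using state_of_layer_product[OF _ assms] that by (auto simp: state_of_def)
  then show "layer_projection l s \<psi> S = 0" by (simp add: layer_projection_def)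
qed

text \<open>The stabilizer of \<open>i\<close> exchanges the terms of \<open>T\<close> and
  \<open>insert i T\<close>, and \<open>s i * s i = 1\<close> turns this exchange into
  multiplication by \<open>s i\<close>.\<close>

lemma stabilizer_layer_projection:
  assumes i: "i \<in> src l" and l: "1 \<le> l" and s: "s i * s i = 1"
    and \<psi>: "state_of (phys_qubits N \<union> aux_qubits N (l - 1)) \<psi>"
  shows "stabilizer l i (tgt l i) (layer_projection l s \<psi>) = (\<lambda>S. s i * layer_projection l s \<psi> S)"
proof
  fix S
  define A where "A = src l - {i}"
  have A: "src l = insert i A" "i \<notin> A" "finite A" using i by (auto simp: A_def)
  let ?P = "\<lambda>T. layer_product l T \<psi>" and ?st = "stabilizer l i (tgt l i)"
  have 1: "?st (?P T) = ?P (insert i T)" and 2: "?st (?P (insert i T)) = ?P T" if "T \<in> Pow A" for T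
  proof -
    show "?st (?P T) = ?P (insert i T)"
      using that A by (intro stabilizer_layer_product l \<psi>) auto
    moreover have "?st (?st (?P T)) = ?P T"
    proof (rule stabilizer_stabilizer)
      show "state_of (phys_qubits N \<union> aux_qubits N l) (?P T)"
        using that A l \<psi> by (intro state_of_layer_product) auto
    qed (use src_tgt_Aux[OF i l] tgt_neq[OF i] in \<open>auto simp: finite_mode_qubits\<close>)
    ultimately show "?st (?P (insert i T)) = ?P T" by simp
  qed
  have pr: "(\<Prod>i\<in>insert i T. s i) = s i * (\<Prod>i\<in>T. s i)" if "T \<in> Pow A" for T
    using that A(2,3) by (subst prod.insert) (auto intro: finite_subset)
  have "?st (layer_projection l s \<psi>) S = (\<Sum>T\<in>Pow (src l). (\<Prod>i\<in>T. s i) * ?st (?P T) S)"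
    unfolding layer_projection_def stabilizer_sum ..
  also have "\<dots> = (\<Sum>T\<in>Pow A. (\<Prod>i\<in>T. s i) * (?P (insert i T) S + s i * ?P T S))"
    unfolding A(1) sum_Pow_insert[OF A(3,2)]
    by (rule sum.cong[OF refl]) (simp only: 1 2 pr algebra_simps)
  also have "\<dots> = s i * (\<Sum>T\<in>Pow A. (\<Prod>i\<in>T. s i) * (?P T S + s i * ?P (insert i T) S))"
    unfolding sum_distrib_left
  proof (rule sum.cong[OF refl])
    fix T
    have "s i * (x * (y + s i * z)) = x * ((s i * s i) * z + s i * y)" for x y z
      by (simp add: algebra_simps)
    then show "(\<Prod>i\<in>T. s i) * (?P (insert i T) S + s i * ?P T S) =
        s i * ((\<Prod>i\<in>T. s i) * (?P T S + s i * ?P (insert i T) S))" unfolding s by (simp only: mult_1)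
  qed
  also have "(\<Sum>T\<in>Pow A. (\<Prod>i\<in>T. s i) * (?P T S + s i * ?P (insert i T) S)) = layer_projection l s \<psi> S"
    unfolding layer_projection_def A(1) sum_Pow_insert[OF A(3,2)]
    by (rule sum.cong[OF refl]) (simp only: pr algebra_simps)
  finally show "?st (layer_projection l s \<psi>) S = s i * layer_projection l s \<psi> S" .
qed

text \<open>Whatever commutes with each stabilizer of a layer commutes with their products.
  \<open>F\<close> will be a stabilizer of a lower layer, with \<open>Q\<close> the physical
  register, or the product with a physical state, with \<open>Q\<close> empty.\<close>

lemma layer_product_commute:
  assumes T: "T \<subseteq> src l" and l: "1 \<le> l" and Q: "Q \<subseteq> phys_qubits N"
    and \<psi>: "state_of (Q \<union> aux_qubits N (l - 1)) \<psi>"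
    and F\<psi>: "state_of (phys_qubits N \<union> aux_qubits N (l - 1)) (F \<psi>)"
    and comm: "\<And>i \<theta>. i \<in> src l \<Longrightarrow> state_of (Q \<union> aux_qubits N l) \<theta> \<Longrightarrow>
        F (stabilizer l i (tgt l i) \<theta>) = stabilizer l i (tgt l i) (F \<theta>)"
  shows "F (layer_product l T \<psi>) = layer_product l T (F \<psi>)"
proof -
  have "finite T" using T by (auto intro: finite_subset[OF _ finite_src[of l]])
  then show ?thesis using T
  proof (induction T)
    case empty
    then show ?case by simp
  next
    case (insert i T)
    have \<psi>': "state_of (phys_qubits N \<union> aux_qubits N (l - 1)) \<psi>" using \<psi> Q by (auto elim: state_of_mono)
    have "F (layer_product l (insert i T) \<psi>) = F (stabilizer l i (tgt l i) (layer_product l T \<psi>))"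
      using insert by (subst stabilizer_layer_product[OF _ _ l \<psi>']) auto
    also have "\<dots> = stabilizer l i (tgt l i) (layer_product l T (F \<psi>))"
      using insert state_of_layer_product[OF _ l \<psi>, of T] by (subst comm) auto
    also have "\<dots> = layer_product l (insert i T) (F \<psi>)"
      using insert by (subst stabilizer_layer_product[OF _ _ l F\<psi>]) auto
    finally show ?case .
  qed
qed

fun code_state :: "(nat \<Rightarrow> nat \<Rightarrow> complex) \<Rightarrow> nat \<Rightarrow> state \<Rightarrow> state" where
  "code_state s 0 \<psi> = \<psi>"
| "code_state s (Suc n) \<psi> = layer_projection (Suc n) (s (Suc n)) (code_state s n \<psi>)"

lemma aux_qubits_0 [simp]: "aux_qubits N 0 = {}"
  by (simp add: aux_qubits_def)

lemma state_of_code_state: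
  "state_of Q \<psi> \<Longrightarrow> state_of (Q \<union> aux_qubits N n) (code_state s n \<psi>)"
  by (induction n) (auto intro!: state_of_layer_projection)

text \<open>The eigenvalue equation is created by the projection of layer \<open>l\<close> and
  survives the later ones, because their terms are products of stabilizers of other layers.\<close>

lemma stabilizer_code_state:
  assumes i: "i \<in> src l" and l: "1 \<le> l" "l \<le> n" and s: "s l i * s l i = 1"
    and \<psi>: "state_of Q \<psi>" "Q \<subseteq> phys_qubits N"
  shows "stabilizer l i (tgt l i) (code_state s n \<psi>) = (\<lambda>S. s l i * code_state s n \<psi> S)"
  using l(2)
proof (induction n rule: dec_induct)
  case base
  obtain m where m: "l = Suc m" using l(1) by (cases l) auto
  have "state_of (phys_qubits N \<union> aux_qubits N (l - 1)) (code_state s m \<psi>)"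
    using state_of_code_state[OF \<psi>(1), of m s] \<psi>(2) m by (auto elim!: state_of_mono)
  from stabilizer_layer_projection[where s="s l", OF i l(1) s this] show ?case
    unfolding m code_state.simps .
next
  case (step n)
  let ?F = "stabilizer l i (tgt l i)" and ?c = "code_state s n \<psi>" and ?R = "phys_qubits N \<union> aux_qubits N n"
  have st: "state_of ?R ?c"
    using state_of_code_state[OF \<psi>(1), of n s] \<psi>(2) by (auto elim!: state_of_mono)
  have mem: "Aux i l \<in> aux_qubits N n" "Aux (tgt l i) l \<in> aux_qubits N n"
    using src_tgt_Aux[OF i l(1) step(1)] by auto
  have fin: "finite ?R" by (simp add: finite_mode_qubits)
  have comm: "?F (layer_product (Suc n) T ?c) = layer_product (Suc n) T (?F ?c)" if "T \<subseteq> src (Suc n)" for T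
  proof (rule layer_product_commute[OF that _ order_refl])
    show "state_of (phys_qubits N \<union> aux_qubits N (Suc n - 1)) (?F ?c)"
      using st fin tgt_neq[OF i] mem by (auto intro!: state_of_stabilizer)
    fix i' \<theta> assume i': "i' \<in> src (Suc n)" and \<theta>: "state_of (phys_qubits N \<union> aux_qubits N (Suc n)) \<theta>"
    have "aux_qubits N n \<subseteq> aux_qubits N (Suc n)" by (rule aux_qubits_mono) simp
    then show "?F (stabilizer (Suc n) i' (tgt (Suc n) i') \<theta>) = stabilizer (Suc n) i' (tgt (Suc n) i') (?F \<theta>)"
      using mem src_tgt_Aux[OF i', of "Suc n"] tgt_neq[OF i] tgt_neq[OF i'] step(1)
      by (intro stabilizer_commute[OF \<theta>]) (auto simp: finite_mode_qubits)
  qed (use st in auto)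
  have pr: "layer_product (Suc n) T (?F ?c) S = s l i * layer_product (Suc n) T ?c S" for T S
    unfolding step.IH by (simp add: edge_product_def)
  show ?case
    unfolding code_state.simps layer_projection_def stabilizer_sum
  proof
    fix S
    show "(\<Sum>T\<in>Pow (src (Suc n)). (\<Prod>i\<in>T. s (Suc n) i) * ?F (layer_product (Suc n) T ?c) S) =
        s l i * (\<Sum>T\<in>Pow (src (Suc n)). (\<Prod>i\<in>T. s (Suc n) i) * layer_product (Suc n) T ?c S)"
      unfolding sum_distrib_left
      by (rule sum.cong[OF refl]) (simp only: comm pr PowD mult.left_commute)
  qed
qed

text \<open>Here \<Psi> is a multiple of the vacuum. The projections act on the auxiliary factor
  alone, so what they make of it depends on the signs and not on \<phi>.\<close>

lemma code_state_fermionic_product: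
  assumes "n \<le> \<nu>" "state_of {} \<Psi>"
  shows "code_state s n (fermionic_product N \<nu> \<phi> \<Psi>) = fermionic_product N \<nu> \<phi> (code_state s n \<Psi>)"
  using assms(1)
proof (induction n)
  case 0
  then show ?case by simp
next
  case (Suc n)
  let ?F = "fermionic_product N \<nu> \<phi>" and ?c = "code_state s n \<Psi>"
  have st: "state_of ({} \<union> aux_qubits N n) ?c" by (rule state_of_code_state[OF assms(2)])
  have comm: "?F (layer_product (Suc n) T ?c) = layer_product (Suc n) T (?F ?c)" if "T \<subseteq> src (Suc n)" for T
  proof (rule layer_product_commute[OF that])
    show "state_of (phys_qubits N \<union> aux_qubits N (Suc n - 1)) (?F ?c)"
    proof (rule state_ofI)
      fix S assume S: "\<not> S \<subseteq> phys_qubits N \<union> aux_qubits N (Suc n - 1)"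
      show "?F ?c S = 0"
      proof (cases "S \<subseteq> phys_qubits N \<union> aux_qubits N \<nu>")
        case True
        then have "\<not> S \<inter> aux_qubits N \<nu> \<subseteq> aux_qubits N n" using S by auto
        then have "?c (S \<inter> aux_qubits N \<nu>) = 0" using st by (auto simp: state_of_def)
        then show ?thesis by (simp add: fermionic_product_def)
      qed (simp add: fermionic_product_def)
    qed
    fix i \<theta> assume i: "i \<in> src (Suc n)" and \<theta>: "state_of ({} \<union> aux_qubits N (Suc n)) \<theta>"
    then have "state_of (aux_qubits N \<nu>) \<theta>"
      using aux_qubits_mono[OF Suc.prems] by (auto elim: state_of_mono)
    then show "?F (stabilizer (Suc n) i (tgt (Suc n) i) \<theta>) = stabilizer (Suc n) i (tgt (Suc n) i) (?F \<theta>)"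
      using src_tgt_Aux[OF i _ Suc.prems] tgt_neq[OF i]
      by (subst stabilizer_fermionic_product) auto
  qed (use st in auto)
  have "code_state s (Suc n) (?F \<Psi>) = layer_projection (Suc n) (s (Suc n)) (?F ?c)"
    using Suc by simp
  also have "\<dots> = (\<lambda>S. \<Sum>T\<in>Pow (src (Suc n)). (\<Prod>i\<in>T. s (Suc n) i) * ?F (layer_product (Suc n) T ?c) S)"
    unfolding layer_projection_def by (rule ext, rule sum.cong) (simp_all add: comm)
  also have "\<dots> = ?F (code_state s (Suc n) \<Psi>)"
    unfolding code_state.simps layer_projection_def
    by (rule ext) (simp add: fermionic_product_def sum_distrib_left mult_ac)
  finally show ?case .
qed

end

section \<open>Operators of adaptive circuits\<close>

definition H_gate :: "complex^bool^bool" where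
  "H_gate = (\<chi> i j. pm (i \<and> j) / complex_of_real (sqrt 2))"

definition X_gate :: "complex^bool^bool" where
  "X_gate = (\<chi> i j. if i = j then 0 else 1)"

definition Z_gate :: "complex^bool^bool" where
  "Z_gate = (\<chi> i j. if i = j then pm i else 0)"

definition CZ_gate :: "complex^(bool \<times> bool)^(bool \<times> bool)" where
  "CZ_gate = (\<chi> i j. if i = j then pm (fst i \<and> snd i) else 0)"

definition CX_gate :: "complex^(bool \<times> bool)^(bool \<times> bool)" where
  "CX_gate = (\<chi> i j. if fst i = fst j \<and> snd i = (snd j \<noteq> fst j) then 1 else 0)"

lemma sum_bool_pair:
  "(\<Sum>x\<in>UNIV. f (x :: bool \<times> bool)) = f (False, False) + f (False, True) + f (True, False) + f (True, True)"
  unfolding UNIV_Times_UNIV[symmetric] sum.Sigma[symmetric, of UNIV "\<lambda>_. UNIV", simplified]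
  by (simp add: UNIV_bool sum.cartesian_product[symmetric] add_ac)

lemma unitary_gates:
  "unitary_matrix H_gate" "unitary_matrix X_gate" "unitary_matrix Z_gate"
  "unitary_matrix CZ_gate" "unitary_matrix CX_gate"
proof -
  have s: "complex_of_real (sqrt 2) * complex_of_real (sqrt 2) = 2"
    by (simp flip: of_real_mult)
  show "unitary_matrix H_gate"
    by (simp add: unitary_matrix_def conj_transpose_def matrix_matrix_mult_def mat_def vec_eq_iff
        H_gate_def UNIV_bool all_bool_eq s)
  show "unitary_matrix X_gate" "unitary_matrix Z_gate"
    by (simp_all add: unitary_matrix_def conj_transpose_def matrix_matrix_mult_def mat_def vec_eq_iff
        X_gate_def Z_gate_def UNIV_bool all_bool_eq)
  show "unitary_matrix CZ_gate" "unitary_matrix CX_gate"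
    by (simp_all add: unitary_matrix_def conj_transpose_def matrix_matrix_mult_def mat_def vec_eq_iff
        CZ_gate_def CX_gate_def sum_bool_pair all_bool_eq)
qed

lemma sd_singleton: "sd S {q} = (if q \<in> S then S - {q} else insert q S)"
  by auto

lemma apply_H:
  "apply_gate1 q H_gate \<psi> S =
    (\<psi> (S - {q}) + pm (q \<in> S) * \<psi> (insert q S)) / complex_of_real (sqrt 2)"
  by (simp add: apply_gate1_def H_gate_def UNIV_bool set_qubit_def add_divide_distrib)

lemma apply_X: "apply_gate1 q X_gate \<psi> S = \<psi> (sd S {q})"
  by (cases "q \<in> S") (simp_all add: apply_gate1_def X_gate_def UNIV_bool set_qubit_def sd_singleton)

lemma apply_Z: "apply_gate1 q Z_gate \<psi> S = pm (q \<in> S) * \<psi> S"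
  by (cases "q \<in> S") (simp_all add: apply_gate1_def Z_gate_def UNIV_bool set_qubit_def insert_absorb)

lemma apply_CZ:
  assumes "p \<noteq> q"
  shows "apply_gate2 p q CZ_gate \<psi> S = pm (p \<in> S \<and> q \<in> S) * \<psi> S"
proof -
  have "set_qubit p (p \<in> S) (set_qubit q (q \<in> S) S) = S" by (auto simp: set_qubit_def)
  then show ?thesis
    by (cases "p \<in> S"; cases "q \<in> S")
      (simp_all add: apply_gate2_def CZ_gate_def sum_bool_pair case_prod_beta)
qed

lemma apply_CX:
  assumes "p \<noteq> q"
  shows "apply_gate2 p q CX_gate \<psi> S = \<psi> (if p \<in> S then sd S {q} else S)"
proof -
  have "set_qubit p (p \<in> S) (set_qubit q ((q \<in> S) \<noteq> (p \<in> S)) S) = (if p \<in> S then sd S {q} else S)"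
    using assms by (auto simp: set_qubit_def)
  then show ?thesis
    by (cases "p \<in> S"; cases "q \<in> S")
      (simp_all add: apply_gate2_def CX_gate_def sum_bool_pair case_prod_beta)
qed

lemma apply_gate_ext:
  "apply_gate1 q X_gate \<psi> = (\<lambda>S. \<psi> (sd S {q}))"
  "apply_gate1 q Z_gate \<psi> = (\<lambda>S. pm (q \<in> S) * \<psi> S)"
  "p \<noteq> q \<Longrightarrow> apply_gate2 p q CZ_gate \<psi> = (\<lambda>S. pm (p \<in> S \<and> q \<in> S) * \<psi> S)"
  "p \<noteq> q \<Longrightarrow> apply_gate2 p q CX_gate \<psi> = (\<lambda>S. \<psi> (if p \<in> S then sd S {q} else S))"
  by (auto simp: apply_X apply_Z apply_CZ apply_CX)

definition parity_sign :: "'a set \<Rightarrow> 'a set \<Rightarrow> complex" where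
  "parity_sign U S = (\<Prod>q\<in>U. pm (q \<in> S))"

lemma layer_Z:
  "distinct qs \<Longrightarrow> layer_branches (map (\<lambda>q. Gate1 q Z_gate) qs) (r, \<psi>) =
    {(r, \<lambda>S. parity_sign (set qs) S * \<psi> S)}"
  by (induction qs arbitrary: \<psi>) (auto simp: parity_sign_def apply_gate_ext mult_ac)

lemma layer_X:
  "distinct qs \<Longrightarrow> layer_branches (map (\<lambda>q. Gate1 q X_gate) qs) (r, \<psi>) =
    {(r, \<lambda>S. \<psi> (sd S (set qs)))}"
proof (induction qs arbitrary: \<psi>)
  case (Cons q qs)
  have "sd (sd S (set qs)) {q} = sd S (insert q (set qs))" for S using Cons by auto
  then show ?case using Cons by (simp add: apply_gate_ext)
qed simp

lemma layer_CZ: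
  assumes "distinct is" "\<forall>i\<in>set is. a i \<noteq> b i"
  shows "layer_branches (map (\<lambda>i. Gate2 (a i) (b i) CZ_gate) is) (r, \<psi>) =
    {(r, \<lambda>S. (\<Prod>i\<in>set is. pm (a i \<in> S \<and> b i \<in> S)) * \<psi> S)}"
  using assms by (induction "is" arbitrary: \<psi>) (auto simp: apply_gate_ext mult_ac)

text \<open>No target is a control, so every control is read from the original basis vector and the
  gates of the layer act simultaneously.\<close>

lemma layer_CX:
  assumes "distinct is" "inj_on b (set is)" "a ` set is \<inter> b ` set is = {}"
  shows "layer_branches (map (\<lambda>i. Gate2 (a i) (b i) CX_gate) is) (r, \<psi>) =
    {(r, \<lambda>S. \<psi> (sd S (b ` {i \<in> set is. a i \<in> S})))}"
  using assms
proof (induction "is" arbitrary: \<psi>)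
  case (Cons i "is")
  let ?f = "\<lambda>S. sd S (b ` {i \<in> set is. a i \<in> S})"
  have ne: "a i \<noteq> b i" using Cons.prems by auto
  have ai: "a i \<in> ?f S \<longleftrightarrow> a i \<in> S" for S using Cons.prems by auto
  have "(if a i \<in> ?f S then sd (?f S) {b i} else ?f S) = sd S (b ` {j \<in> set (i # is). a j \<in> S})" for S
  proof (cases "a i \<in> S")
    case True
    then have "{j \<in> set (i # is). a j \<in> S} = insert i {i \<in> set is. a i \<in> S}" by auto
    moreover have "b i \<notin> b ` {i \<in> set is. a i \<in> S}" using Cons.prems by (auto simp: inj_on_def)
    ultimately show ?thesis using True ai by auto
  next
    case False
    then have "{j \<in> set (i # is). a j \<in> S} = {i \<in> set is. a i \<in> S}" by auto
    moreover have "a i \<notin> b ` {i \<in> set is. a i \<in> S}" using Cons.prems by auto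
    ultimately show ?thesis using False by simp
  qed
  moreover have "inj_on b (set is)" "a ` set is \<inter> b ` set is = {}" using Cons.prems by auto
  ultimately show ?case using Cons by (simp add: apply_gate_ext(4)[OF ne])
qed simp

lemma layer_H:
  "distinct qs \<Longrightarrow> layer_branches (map (\<lambda>q. Gate1 q H_gate) qs) (r, \<psi>) =
    {(r, \<lambda>S. (1 / complex_of_real (sqrt 2)) ^ length qs *
       (\<Sum>U\<in>Pow (set qs). parity_sign U S * \<psi> ((S - set qs) \<union> U)))}"
proof (induction qs arbitrary: \<psi>)
  case Nil
  then show ?case by (simp add: parity_sign_def)
next
  case (Cons q qs)
  let ?Q = "set qs" and ?c = "1 / complex_of_real (sqrt 2)"
  have "?c ^ length qs * (\<Sum>U\<in>Pow ?Q. parity_sign U S * apply_gate1 q H_gate \<psi> ((S - ?Q) \<union> U)) =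
      ?c ^ length (q # qs) * (\<Sum>U\<in>Pow (set (q # qs)). parity_sign U S * \<psi> ((S - set (q # qs)) \<union> U))" for S
  proof -
    have "parity_sign U S * apply_gate1 q H_gate \<psi> ((S - ?Q) \<union> U) =
        ?c * (parity_sign U S * \<psi> ((S - insert q ?Q) \<union> U) +
          parity_sign (insert q U) S * \<psi> ((S - insert q ?Q) \<union> insert q U))" if U: "U \<in> Pow ?Q" for U
    proof -
      have q: "q \<notin> U" "finite U" "q \<notin> ?Q" using U Cons.prems finite_subset[of U ?Q] by auto
      have "((S - ?Q) \<union> U) - {q} = (S - insert q ?Q) \<union> U" using q by auto
      moreover have "insert q ((S - ?Q) \<union> U) = (S - insert q ?Q) \<union> insert q U" by auto
      moreover have "q \<in> (S - ?Q) \<union> U \<longleftrightarrow> q \<in> S" using q by auto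
      moreover have "parity_sign (insert q U) S = pm (q \<in> S) * parity_sign U S"
        using q by (simp add: parity_sign_def)
      ultimately show ?thesis by (simp only: apply_H) (simp add: field_simps)
    qed
    then show ?thesis
      using Cons.prems by (simp add: sum_Pow_insert flip: sum_divide_distrib)
  qed
  then show ?case using Cons by simp
qed

text \<open>The qubits of \<open>qs\<close> start in state 0, so only the term \<open>U = {}\<close>
  of the Hadamard sum survives and the superposition is uniform.\<close>

lemma layer_H_vacuum:
  assumes "distinct qs" "set qs \<inter> R = {}" "state_of R \<psi>"
  shows "layer_branches (map (\<lambda>q. Gate1 q H_gate) qs) (r, \<psi>) =
    {(r, \<lambda>S. (1 / complex_of_real (sqrt 2)) ^ length qs * \<psi> (S - set qs))}"
proof -
  let ?Q = "set qs"
  have "(\<Sum>U\<in>Pow ?Q. parity_sign U S * \<psi> (S - ?Q \<union> U)) = \<psi> (S - ?Q)" for S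
  proof -
    have "(\<Sum>U\<in>Pow ?Q. parity_sign U S * \<psi> (S - ?Q \<union> U)) =
        (\<Sum>U\<in>Pow ?Q. if U = {} then parity_sign {} S * \<psi> (S - ?Q) else 0)"
    proof (rule sum.cong[OF refl])
      fix U assume U: "U \<in> Pow ?Q"
      show "parity_sign U S * \<psi> (S - ?Q \<union> U) = (if U = {} then parity_sign {} S * \<psi> (S - ?Q) else 0)"
      proof (cases "U = {}")
        case False
        then have "\<not> (S - ?Q \<union> U \<subseteq> R)" using U assms(2) by auto
        then show ?thesis using assms(3) False by (auto simp: state_of_def)
      qed simp
    qed
    also have "\<dots> = \<psi> (S - ?Q)" by (subst sum.delta) (auto simp: parity_sign_def)
    finally show ?thesis .
  qed
  then show ?thesis unfolding layer_H[OF assms(1)] by simp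
qed

lemma layer_Measure:
  assumes "distinct qs" "(r', \<xi>) \<in> layer_branches (map Measure qs) (r, \<psi>)"
  shows "\<exists>w. r' = r @ map w qs \<and> \<xi> = (\<lambda>S. if \<forall>q\<in>set qs. (q \<in> S) = w q then \<psi> S else 0)"
  using assms
proof (induction qs arbitrary: r \<psi>)
  case (Cons q qs)
  then obtain b where b: "(r', \<xi>) \<in> layer_branches (map Measure qs) (r @ [b], project_qubit q b \<psi>)"
    by auto
  obtain w where w: "r' = (r @ [b]) @ map w qs"
    "\<xi> = (\<lambda>S. if \<forall>q\<in>set qs. (q \<in> S) = w q then project_qubit q b \<psi> S else 0)"
    using Cons.IH[OF _ b] Cons.prems(1) by auto
  have *: "(\<forall>q'\<in>set qs. (q' \<in> S) = (w(q := b)) q') \<longleftrightarrow> (\<forall>q'\<in>set qs. (q' \<in> S) = w q')" for S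
    using Cons.prems(1) by auto
  have "r' = r @ map (w(q := b)) (q # qs)" using w(1) Cons.prems(1) by auto
  moreover have "\<xi> = (\<lambda>S. if \<forall>q'\<in>set (q # qs). (q' \<in> S) = (w(q := b)) q' then \<psi> S else 0)"
    unfolding w(2) by (rule ext) (simp add: * project_qubit_def del: fun_upd_apply, simp)
  ultimately show ?case by blast
qed simp

text \<open>
  The operator that a branch applies is a function of its record alone. The records of one
  circuit have a fixed number of new outcomes, so the record of the first of two consecutive
  circuits can be read off the joint record.
\<close>

definition realizes :: "(state \<Rightarrow> bool) \<Rightarrow> adaptive_circuit \<Rightarrow> (state \<Rightarrow> state) set \<Rightarrow> bool" where
  "realizes P Ls X \<longleftrightarrow>
     (\<exists>n. \<forall>r \<psi> r' \<xi>. P \<psi> \<and> (r', \<xi>) \<in> circuit_branches Ls (r, \<psi>) \<longrightarrow> (\<exists>e. length e = n \<and> r' = r @ e)) \<and>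
     (\<forall>r r'. \<exists>F\<in>X. \<forall>\<psi> \<xi>. P \<psi> \<and> (r', \<xi>) \<in> circuit_branches Ls (r, \<psi>) \<longrightarrow> \<xi> = F \<psi>)"

lemma circuit_branches_append:
  "circuit_branches (Ls @ Ms) x = (\<Union>y\<in>circuit_branches Ls x. circuit_branches Ms y)"
  by (induction Ls arbitrary: x) auto

lemma realizes_append:
  assumes "realizes P Ls X" "realizes Q Ms Y"
    and PQ: "\<And>F \<psi>. F \<in> X \<Longrightarrow> P \<psi> \<Longrightarrow> Q (F \<psi>)"
    and Z: "\<And>F G. F \<in> X \<Longrightarrow> G \<in> Y \<Longrightarrow> \<exists>K\<in>Z. \<forall>\<psi>. P \<psi> \<longrightarrow> K \<psi> = G (F \<psi>)"
  shows "realizes P (Ls @ Ms) Z"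
proof -
  obtain n1 where n1: "\<And>r \<psi> r' \<xi>. P \<psi> \<Longrightarrow> (r', \<xi>) \<in> circuit_branches Ls (r, \<psi>) \<Longrightarrow> \<exists>e. length e = n1 \<and> r' = r @ e"
    using assms(1) unfolding realizes_def by meson
  obtain n2 where n2: "\<And>r \<psi> r' \<xi>. Q \<psi> \<Longrightarrow> (r', \<xi>) \<in> circuit_branches Ms (r, \<psi>) \<Longrightarrow> \<exists>e. length e = n2 \<and> r' = r @ e"
    using assms(2) unfolding realizes_def by meson
  have X: "\<exists>F\<in>X. \<forall>\<psi> \<xi>. P \<psi> \<and> (r', \<xi>) \<in> circuit_branches Ls (r, \<psi>) \<longrightarrow> \<xi> = F \<psi>" for r r'
    using assms(1) unfolding realizes_def by simp
  have Y: "\<exists>F\<in>Y. \<forall>\<psi> \<xi>. Q \<psi> \<and> (r', \<xi>) \<in> circuit_branches Ms (r, \<psi>) \<longrightarrow> \<xi> = F \<psi>" for r r'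
    using assms(2) unfolding realizes_def by simp
  have mid: "\<exists>\<xi>1 e1 e2. (r @ e1, \<xi>1) \<in> circuit_branches Ls (r, \<psi>) \<and> Q \<xi>1 \<and>
      (r', \<xi>) \<in> circuit_branches Ms (r @ e1, \<xi>1) \<and> length e1 = n1 \<and> length e2 = n2 \<and> r' = r @ e1 @ e2"
    if \<psi>: "P \<psi>" and br: "(r', \<xi>) \<in> circuit_branches (Ls @ Ms) (r, \<psi>)" for r \<psi> r' \<xi>
  proof -
    obtain r1 \<xi>1 where 1: "(r1, \<xi>1) \<in> circuit_branches Ls (r, \<psi>)" "(r', \<xi>) \<in> circuit_branches Ms (r1, \<xi>1)"
      using br unfolding circuit_branches_append by auto
    have "Q \<xi>1" using X[of r1 r] 1(1) \<psi> PQ by blast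
    moreover obtain e1 where "length e1 = n1" "r1 = r @ e1" using n1[OF \<psi> 1(1)] by blast
    moreover obtain e2 where "length e2 = n2" "r' = r1 @ e2" using n2[OF \<open>Q \<xi>1\<close> 1(2)] by blast
    ultimately show ?thesis using 1 by auto
  qed
  have "\<exists>K\<in>Z. \<forall>\<psi> \<xi>. P \<psi> \<and> (r', \<xi>) \<in> circuit_branches (Ls @ Ms) (r, \<psi>) \<longrightarrow> \<xi> = K \<psi>" for r r'
  proof -
    \<comment> \<open>The first circuit adds exactly \<open>n1\<close> outcomes, so this prefix is
      the intermediate record of every branch that ends in \<open>r'\<close>. Hence \<open>F\<close>
      and \<open>G\<close> can be fixed before the state is given.\<close>
    define r1 where "r1 = take (length r + n1) r'"
    obtain F where F: "F \<in> X" "\<And>\<psi> \<xi>. P \<psi> \<Longrightarrow> (r1, \<xi>) \<in> circuit_branches Ls (r, \<psi>) \<Longrightarrow> \<xi> = F \<psi>"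
      using X[of r1 r] by blast
    obtain G where G: "G \<in> Y" "\<And>\<psi> \<xi>. Q \<psi> \<Longrightarrow> (r', \<xi>) \<in> circuit_branches Ms (r1, \<psi>) \<Longrightarrow> \<xi> = G \<psi>"
      using Y[of r' r1] by blast
    obtain K where K: "K \<in> Z" "\<And>\<psi>. P \<psi> \<Longrightarrow> K \<psi> = G (F \<psi>)" using Z[OF F(1) G(1)] by blast
    have "\<xi> = K \<psi>" if \<psi>: "P \<psi>" and br: "(r', \<xi>) \<in> circuit_branches (Ls @ Ms) (r, \<psi>)" for \<psi> \<xi>
    proof -
      obtain \<xi>1 e1 e2 where 1: "(r @ e1, \<xi>1) \<in> circuit_branches Ls (r, \<psi>)" "Q \<xi>1"
        "(r', \<xi>) \<in> circuit_branches Ms (r @ e1, \<xi>1)" "length e1 = n1" "r' = r @ e1 @ e2"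
        using mid[OF \<psi> br] by blast
      then have "r1 = r @ e1" by (simp add: r1_def)
      then show ?thesis using 1 F(2)[OF \<psi>] G(2) K(2)[OF \<psi>] by simp
    qed
    then show ?thesis using K(1) by blast
  qed
  moreover have "\<exists>n. \<forall>r \<psi> r' \<xi>. P \<psi> \<and> (r', \<xi>) \<in> circuit_branches (Ls @ Ms) (r, \<psi>) \<longrightarrow>
      (\<exists>e. length e = n \<and> r' = r @ e)"
  proof (intro exI[of _ "n1 + n2"] allI impI, elim conjE)
    fix r \<psi> r' \<xi> assume "P \<psi>" "(r', \<xi>) \<in> circuit_branches (Ls @ Ms) (r, \<psi>)"
    then obtain e1 e2 where "length e1 = n1" "length e2 = n2" "r' = r @ e1 @ e2" using mid by blast
    then show "\<exists>e. length e = n1 + n2 \<and> r' = r @ e" by (intro exI[of _ "e1 @ e2"]) simp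
  qed
  ultimately show ?thesis unfolding realizes_def by simp
qed

lemma realizes_mono:
  assumes "realizes P Ls X" "\<And>\<psi>. Q \<psi> \<Longrightarrow> P \<psi>"
    and "\<And>F. F \<in> X \<Longrightarrow> \<exists>G\<in>Y. \<forall>\<psi>. Q \<psi> \<longrightarrow> F \<psi> = G \<psi>"
  shows "realizes Q Ls Y"
  unfolding realizes_def
proof (intro conjI allI)
  show "\<exists>n. \<forall>r \<psi> r' \<xi>. Q \<psi> \<and> (r', \<xi>) \<in> circuit_branches Ls (r, \<psi>) \<longrightarrow> (\<exists>e. length e = n \<and> r' = r @ e)"
    using assms(1,2) unfolding realizes_def by meson
next
  fix r r'
  obtain F where F: "F \<in> X" "\<And>\<psi> \<xi>. P \<psi> \<Longrightarrow> (r', \<xi>) \<in> circuit_branches Ls (r, \<psi>) \<Longrightarrow> \<xi> = F \<psi>"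
    using assms(1) unfolding realizes_def by meson
  then show "\<exists>G\<in>Y. \<forall>\<psi> \<xi>. Q \<psi> \<and> (r', \<xi>) \<in> circuit_branches Ls (r, \<psi>) \<longrightarrow> \<xi> = G \<psi>"
    using assms(2) assms(3)[OF F(1)] by metis
qed

lemma realizes_Nil: "realizes P [] {\<lambda>\<psi>. \<psi>}"
  by (auto simp: realizes_def)

lemma realizes_singleton:
  assumes "\<And>r \<psi>. P \<psi> \<Longrightarrow> circuit_branches Ls (r, \<psi>) = {(r, F \<psi>)}"
  shows "realizes P Ls {F}"
  using assms by (auto simp: realizes_def)

section \<open>Measurement in the X basis, followed by reset and corrections\<close>

definition last_outcomes :: "qubit list \<Rightarrow> bool list \<Rightarrow> qubit set" where
  "last_outcomes qs r = fst ` {x \<in> set (zip qs (drop (length r - length qs) r)). snd x}"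

lemma last_outcomes_append: "last_outcomes qs (r @ map w qs) = {q \<in> set qs. w q}"
proof -
  have "zip qs (map w qs) = map (\<lambda>q. (q, w q)) qs" by (induction qs) auto
  then show ?thesis by (force simp: last_outcomes_def)
qed

text \<open>The Pauli X layer returns the measured qubits to state 0, so that they can be used
  again. The Pauli Z corrections take two layers because \<open>f\<close> and \<open>g\<close> may
  name the same qubit.\<close>

definition X_measure ::
    "qubit list \<Rightarrow> (qubit set \<Rightarrow> qubit list) \<Rightarrow> (qubit set \<Rightarrow> qubit list) \<Rightarrow> adaptive_circuit" where
  "X_measure qs f g =
     [\<lambda>r. map (\<lambda>q. Gate1 q H_gate) qs, \<lambda>r. map Measure qs,
      \<lambda>r. map (\<lambda>q. Gate1 q X_gate) (filter (\<lambda>q. q \<in> last_outcomes qs r) qs),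
      \<lambda>r. map (\<lambda>q. Gate1 q Z_gate) (f (last_outcomes qs r)),
      \<lambda>r. map (\<lambda>q. Gate1 q Z_gate) (g (last_outcomes qs r))]"

text \<open>Up to normalization the sum is the overlap of the qubits \<open>qs\<close> with the X
  basis vector labelled by the outcome \<open>W\<close>; the measured qubits are left in state
  0.\<close>

definition X_measured ::
    "qubit list \<Rightarrow> (qubit set \<Rightarrow> qubit list) \<Rightarrow> (qubit set \<Rightarrow> qubit list) \<Rightarrow> qubit set \<Rightarrow> state \<Rightarrow> state" where
  "X_measured qs f g W \<psi> = (\<lambda>S. if S \<inter> set qs = {} then
     (1 / complex_of_real (sqrt 2)) ^ length qs *
     (\<Sum>U\<in>Pow (set qs). parity_sign U W * \<psi> (S \<union> U)) *
     (parity_sign (set (f W)) S * parity_sign (set (g W)) S) else 0)"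

lemma circuit_X_measure:
  assumes "distinct qs" "\<And>W. W \<subseteq> set qs \<Longrightarrow> distinct (f W) \<and> distinct (g W)"
    and "(r', \<xi>) \<in> circuit_branches (X_measure qs f g) (r, \<psi>)"
  shows "\<exists>w. r' = r @ map w qs \<and> \<xi> = X_measured qs f g {q \<in> set qs. w q} \<psi>"
proof -
  let ?Q = "set qs"
  define \<psi>H where "\<psi>H = (\<lambda>S. (1 / complex_of_real (sqrt 2)) ^ length qs *
       (\<Sum>U\<in>Pow ?Q. parity_sign U S * \<psi> ((S - ?Q) \<union> U)))"
  have "\<exists>y\<in>layer_branches (map Measure qs) (r, \<psi>H). (r', \<xi>) \<in> circuit_branches (drop 2 (X_measure qs f g)) y"
    using assms(3) unfolding X_measure_def \<psi>H_def by (simp add: layer_H[OF assms(1)])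
  then obtain r1 \<xi>1 where 1: "(r1, \<xi>1) \<in> layer_branches (map Measure qs) (r, \<psi>H)"
    and 2: "(r', \<xi>) \<in> circuit_branches (drop 2 (X_measure qs f g)) (r1, \<xi>1)"
    by (metis surj_pair)
  obtain w where w: "r1 = r @ map w qs" "\<xi>1 = (\<lambda>S. if \<forall>q\<in>?Q. (q \<in> S) = w q then \<psi>H S else 0)"
    using layer_Measure[OF assms(1) 1] by blast
  define W where "W = {q \<in> ?Q. w q}"
  have W: "last_outcomes qs r1 = W" "W \<subseteq> ?Q" by (auto simp: w(1) last_outcomes_append W_def)
  have fl: "set (filter (\<lambda>q. q \<in> W) qs) = W" "distinct (filter (\<lambda>q. q \<in> W) qs)"
    using assms(1) by (auto simp: W_def)
  have dis: "distinct (f W)" "distinct (g W)" using assms(2) W(2) by auto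
  have "(r', \<xi>) = (r1, \<lambda>S. parity_sign (set (g W)) S * (parity_sign (set (f W)) S * \<xi>1 (sd S W)))"
    using 2 unfolding X_measure_def
    by (simp add: W(1) layer_X[OF fl(2)] layer_Z[OF dis(1)] layer_Z[OF dis(2)] fl(1) del: set_filter)
  then have r': "r' = r1" and \<xi>: "\<xi> = (\<lambda>S. parity_sign (set (g W)) S * (parity_sign (set (f W)) S * \<xi>1 (sd S W)))"
    by auto
  have "\<xi>1 (sd S W) = (if S \<inter> ?Q = {} then (1 / complex_of_real (sqrt 2)) ^ length qs *
     (\<Sum>U\<in>Pow ?Q. parity_sign U W * \<psi> (S \<union> U)) else 0)" for S
  proof (cases "S \<inter> ?Q = {}")
    case True
    have "(\<forall>q\<in>?Q. (q \<in> sd S W) = w q)" using True by (auto simp: W_def)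
    moreover have "sd S W - ?Q \<union> U = S \<union> U" for U using True W(2) by auto
    moreover have "parity_sign U (sd S W) = parity_sign U W" if "U \<in> Pow ?Q" for U
      unfolding parity_sign_def using that True by (intro prod.cong refl arg_cong[of _ _ pm]) (auto simp: disjoint_iff)
    ultimately show ?thesis unfolding w(2) \<psi>H_def using True by simp
  next
    case False
    then have "\<not> (\<forall>q\<in>?Q. (q \<in> sd S W) = w q)" by (auto simp: W_def)
    then show ?thesis unfolding w(2) using False by auto
  qed
  then have "\<xi> S = X_measured qs f g W \<psi> S" for S
    unfolding \<xi> X_measured_def by (cases "S \<inter> ?Q = {}") (simp_all only: if_True if_False mult_zero_right mult_zero_left mult_ac simp_thms)
  then have "\<xi> = X_measured qs f g W \<psi>" by (rule ext)
  then show ?thesis using r' w(1) unfolding W_def by (intro exI[of _ w] conjI) simp_all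
qed

lemma realizes_X_measure:
  assumes "distinct qs" "\<And>W. W \<subseteq> set qs \<Longrightarrow> distinct (f W) \<and> distinct (g W)"
  shows "realizes P (X_measure qs f g) {X_measured qs f g W | W. W \<subseteq> set qs}"
  unfolding realizes_def
proof (intro conjI allI)
  show "\<exists>n. \<forall>r \<psi> r' \<xi>. P \<psi> \<and> (r', \<xi>) \<in> circuit_branches (X_measure qs f g) (r, \<psi>) \<longrightarrow> (\<exists>e. length e = n \<and> r' = r @ e)"
  proof (intro exI[of _ "length qs"] allI impI, elim conjE)
    fix r \<psi> r' \<xi> assume "(r', \<xi>) \<in> circuit_branches (X_measure qs f g) (r, \<psi>)"
    from circuit_X_measure[OF assms this] obtain w where "r' = r @ map w qs" by blast
    then show "\<exists>e. length e = length qs \<and> r' = r @ e" by (intro exI[of _ "map w qs"]) simp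
  qed
  fix r r'
  let ?W = "last_outcomes qs r'"
  have "?W \<subseteq> set qs" by (auto simp: last_outcomes_def dest: set_zip_leftD)
  moreover have "\<xi> = X_measured qs f g ?W \<psi>" if "(r', \<xi>) \<in> circuit_branches (X_measure qs f g) (r, \<psi>)" for \<psi> \<xi>
  proof -
    from circuit_X_measure[OF assms that] obtain w where
      w: "r' = r @ map w qs" "\<xi> = X_measured qs f g {q \<in> set qs. w q} \<psi>" by blast
    show ?thesis unfolding w(2) unfolding w(1) last_outcomes_append ..
  qed
  ultimately show "\<exists>F\<in>{X_measured qs f g W | W. W \<subseteq> set qs}. \<forall>\<psi> \<xi>. P \<psi> \<and>
      (r', \<xi>) \<in> circuit_branches (X_measure qs f g) (r, \<psi>) \<longrightarrow> \<xi> = F \<psi>"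
    by blast
qed

section \<open>Validity of layers and circuits\<close>

lemma valid_layer_Gate1:
  "distinct qs \<Longrightarrow> set qs \<subseteq> R \<Longrightarrow> unitary_matrix U \<Longrightarrow> valid_layer R (map (\<lambda>q. Gate1 q U) qs)"
  by (auto simp: valid_layer_def comp_def)

lemma valid_layer_Measure:
  "distinct qs \<Longrightarrow> set qs \<subseteq> R \<Longrightarrow> valid_layer R (map Measure qs)"
  by (auto simp: valid_layer_def comp_def)

lemma valid_layer_Gate2:
  assumes "distinct is" "inj_on a (set is)" "inj_on b (set is)" "a ` set is \<inter> b ` set is = {}"
    and "a ` set is \<subseteq> R" "b ` set is \<subseteq> R" "unitary_matrix U"
  shows "valid_layer R (map (\<lambda>i. Gate2 (a i) (b i) U) is)"
proof -
  have "distinct (concat (map (\<lambda>i. [a i, b i]) is))"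
    using assms(1-4)
  proof (induction "is")
    case (Cons i "is")
    have "inj_on a (set is)" "inj_on b (set is)" "a ` set is \<inter> b ` set is = {}" using Cons.prems by auto
    then show ?case using Cons by (auto simp: inj_on_def)
  qed simp
  then show ?thesis using assms by (auto simp: valid_layer_def comp_def)
qed

lemma valid_circuit_append:
  "valid_circuit R (Ls @ Ms) \<longleftrightarrow> valid_circuit R Ls \<and> valid_circuit R Ms"
  by (auto simp: valid_circuit_def)

lemma valid_circuit_X_measure:
  assumes "distinct qs" "set qs \<subseteq> R"
    and "\<And>W. distinct (f W) \<and> distinct (g W) \<and> set (f W) \<subseteq> R \<and> set (g W) \<subseteq> R"
  shows "valid_circuit R (X_measure qs f g)"
  using assms unfolding valid_circuit_def X_measure_def
  by (auto intro!: valid_layer_Gate1 valid_layer_Measure unitary_gates)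

section \<open>Prefix forms in constant depth\<close>

lemma pm_odd_card: "finite J \<Longrightarrow> pm (odd (card {j \<in> J. P j})) = (\<Prod>j\<in>J. pm (P j))"
proof (induction J rule: finite_induct)
  case (insert x F)
  have "{j \<in> insert x F. P j} = (if P x then insert x {j \<in> F. P j} else {j \<in> F. P j})" by auto
  then show ?case using insert by auto
qed simp

lemma prod_pm_superset: "finite K \<Longrightarrow> J \<subseteq> K \<Longrightarrow> (\<Prod>i\<in>J. pm (P i)) = (\<Prod>i\<in>K. pm (i \<in> J \<and> P i))"
  by (rule prod.mono_neutral_cong_left) (auto simp: pm_def)

lemma sum_Pow_prod: "finite I \<Longrightarrow> (\<Sum>B\<in>Pow I. \<Prod>i\<in>B. x i) = (\<Prod>i\<in>I. 1 + x i :: complex)"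
proof (induction I rule: finite_induct)
  case (insert i F)
  have "(\<Prod>i\<in>insert i B. x i) = x i * (\<Prod>i\<in>B. x i)" if "B \<in> Pow F" for B
    using that insert by (subst prod.insert) (auto intro: finite_subset)
  then show ?case using insert
    by (simp add: sum_Pow_insert sum.distrib sum_distrib_left[symmetric] distrib_right)
qed simp

lemma sum_Pow_images:
  assumes "inj_on y I" "inj_on z I" "y ` I \<inter> z ` I = {}"
  shows "(\<Sum>U\<in>Pow (y ` I \<union> z ` I). f U) = (\<Sum>A\<in>Pow I. \<Sum>B\<in>Pow I. f (y ` A \<union> z ` B))"
proof -
  have U: "y ` {i \<in> I. y i \<in> U} \<union> z ` {i \<in> I. z i \<in> U} = U" if "U \<subseteq> y ` I \<union> z ` I" for U
    using that by auto
  have A: "{i \<in> I. y i \<in> y ` A \<union> z ` B} = A" if "A \<subseteq> I" "B \<subseteq> I" for A B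
  proof -
    have "y i \<notin> z ` B" if "i \<in> I" for i using assms(3) that \<open>B \<subseteq> I\<close> by blast
    moreover have "y i \<in> y ` A \<longleftrightarrow> i \<in> A" if "i \<in> I" for i
      using inj_on_image_mem_iff[OF assms(1) that \<open>A \<subseteq> I\<close>] .
    ultimately show ?thesis using that by blast
  qed
  have B: "{i \<in> I. z i \<in> y ` A \<union> z ` B} = B" if "A \<subseteq> I" "B \<subseteq> I" for A B
  proof -
    have "z i \<notin> y ` A" if "i \<in> I" for i using assms(3) that \<open>A \<subseteq> I\<close> by blast
    moreover have "z i \<in> z ` B \<longleftrightarrow> i \<in> B" if "i \<in> I" for i
      using inj_on_image_mem_iff[OF assms(2) that \<open>B \<subseteq> I\<close>] .
    ultimately show ?thesis using that by blast
  qed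
  show ?thesis
    unfolding sum.cartesian_product
  proof (rule sum.reindex_bij_witness[of _ "\<lambda>(A, B). y ` A \<union> z ` B" "\<lambda>U. ({i \<in> I. y i \<in> U}, {i \<in> I. z i \<in> U})"])
    fix p assume "p \<in> Pow I \<times> Pow I"
    then obtain A' B' where p: "p = (A', B')" "A' \<subseteq> I" "B' \<subseteq> I" by auto
    show "({i \<in> I. y i \<in> (case p of (A, B) \<Rightarrow> y ` A \<union> z ` B)}, {i \<in> I. z i \<in> (case p of (A, B) \<Rightarrow> y ` A \<union> z ` B)}) = p"
      using A[OF p(2,3)] B[OF p(2,3)] by (simp add: p(1) del: Un_iff)
    show "(case p of (A, B) \<Rightarrow> y ` A \<union> z ` B) \<in> Pow (y ` I \<union> z ` I)" using p by auto
  qed (auto simp: U simp del: Un_iff)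
qed

text \<open>The sites are divided into the fibres of \<open>blk\<close>, and prefix sums are taken
  inside each block; a constant \<open>blk\<close> gives ordinary prefix sums.\<close>

locale blocks =
  fixes N :: nat and blk :: "nat \<Rightarrow> nat"
begin

text \<open>The first site of a block has no predecessor, and \<open>prev\<close> is then the
  maximum of the empty set. Each coupling along the chain is guarded by this predicate.\<close>

definition has_prev :: "nat \<Rightarrow> bool" where
  "has_prev i \<longleftrightarrow> {j \<in> {1..<i}. blk j = blk i} \<noteq> {}"

definition prev :: "nat \<Rightarrow> nat" where
  "prev i = Max {j \<in> {1..<i}. blk j = blk i}"

definition prefix_parity :: "(nat \<Rightarrow> bool) \<Rightarrow> nat \<Rightarrow> bool" where
  "prefix_parity \<beta> i \<longleftrightarrow> odd (card {j \<in> {1..N}. j \<le> i \<and> blk j = blk i \<and> \<beta> j})"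

lemma prev_props:
  assumes "has_prev i"
  shows "1 \<le> prev i" "prev i < i" "blk (prev i) = blk i"
    "1 \<le> j \<Longrightarrow> j < i \<Longrightarrow> blk j = blk i \<Longrightarrow> j \<le> prev i"
proof -
  have "prev i \<in> {j \<in> {1..<i}. blk j = blk i}"
    using assms unfolding has_prev_def prev_def by (intro Max_in) auto
  then show "1 \<le> prev i" "prev i < i" "blk (prev i) = blk i" by auto
  show "1 \<le> j \<Longrightarrow> j < i \<Longrightarrow> blk j = blk i \<Longrightarrow> j \<le> prev i"
    unfolding prev_def by (intro Max_ge) auto
qed

text \<open>Of two sites of a block with the same predecessor, the smaller would itself be a later
  predecessor of the larger. Injectivity lets all couplings to predecessors fit into one layer of
  gates.\<close>

lemma inj_prev: "inj_on prev {i. has_prev i}"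
proof (rule inj_onI)
  fix i j assume ij: "i \<in> {i. has_prev i}" "j \<in> {i. has_prev i}" "prev i = prev j"
  then have p: "has_prev i" "has_prev j" by auto
  have b: "blk i = blk j" using prev_props(3)[OF p(1)] prev_props(3)[OF p(2)] ij(3) by simp
  have "1 \<le> i" "1 \<le> j" using prev_props(1,2)[OF p(1)] prev_props(1,2)[OF p(2)] by auto
  then show "i = j"
    using prev_props(2)[OF p(1)] prev_props(2)[OF p(2)] prev_props(4)[OF p(2), of i]
      prev_props(4)[OF p(1), of j] b ij(3) by (cases i j rule: linorder_cases) auto
qed

lemma prefix_parity_step:
  assumes "i \<in> {1..N}"
  shows "prefix_parity \<beta> i \<longleftrightarrow> \<beta> i \<noteq> (has_prev i \<and> prefix_parity \<beta> (prev i))"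
proof -
  define X where "X = {j \<in> {1..<i}. blk j = blk i \<and> \<beta> j}"
  have "{j \<in> {1..N}. j \<le> i \<and> blk j = blk i \<and> \<beta> j} = (if \<beta> i then insert i X else X)"
    using assms by (auto simp: X_def nat_less_le)
  moreover have "finite X" "i \<notin> X" by (auto simp: X_def)
  ultimately have 1: "prefix_parity \<beta> i \<longleftrightarrow> \<beta> i \<noteq> odd (card X)"
    unfolding prefix_parity_def by auto
  show ?thesis
  proof (cases "has_prev i")
    case True
    have "{j \<in> {1..N}. j \<le> prev i \<and> blk j = blk (prev i) \<and> \<beta> j} = X"
      using prev_props[OF True] assms unfolding X_def by force
    then show ?thesis using True 1 by (simp add: prefix_parity_def)
  next
    case False
    then have "X = {}" by (auto simp: X_def has_prev_def)
    then show ?thesis using False 1 by simp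
  qed
qed

text \<open>Forward substitution: the equation at \<open>i\<close> determines membership of
  \<open>i\<close> in \<open>A\<close> from that of its predecessor in the block.\<close>

lemma chain_solution:
  assumes "A \<subseteq> {1..N}"
  shows "(\<forall>i\<in>{1..N}. \<beta> i = ((i \<in> A) \<noteq> (has_prev i \<and> prev i \<in> A))) \<longleftrightarrow> A = {i \<in> {1..N}. prefix_parity \<beta> i}"
    (is "?L \<longleftrightarrow> A = ?A")
proof
  assume L: ?L
  have "i \<in> {1..N} \<Longrightarrow> i \<in> A \<longleftrightarrow> prefix_parity \<beta> i" for i
  proof (induction i rule: less_induct)
    case (less i)
    have "has_prev i \<Longrightarrow> prev i \<in> A \<longleftrightarrow> prefix_parity \<beta> (prev i)"
      using less prev_props(1,2)[of i] by auto
    then show ?case using L less.prems prefix_parity_step[OF less.prems, of \<beta>] by blast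
  qed
  then show "A = ?A" using assms by blast
next
  assume A: "A = ?A"
  show ?L
  proof
    fix i assume i: "i \<in> {1..N}"
    have "has_prev i \<Longrightarrow> prev i \<in> {1..N}" using prev_props(1,2)[of i] i by auto
    then show "\<beta> i = ((i \<in> A) \<noteq> (has_prev i \<and> prev i \<in> A))"
      using prefix_parity_step[OF i, of \<beta>] i unfolding A by blast
  qed
qed

text \<open>
  Summing over \<open>B\<close> forces \<open>A\<close> to solve a bidiagonal linear system over the field with two
  elements, whose solution is the vector of prefix sums of \<open>\<beta>\<close>.
\<close>

lemma chain_sum:
  "(\<Sum>A\<in>Pow {1..N}. \<Sum>B\<in>Pow {1..N}. (\<Prod>i\<in>A. pm (\<alpha> i)) *
      (\<Prod>i\<in>B. pm (\<beta> i) * pm (i \<in> A) * pm (has_prev i \<and> prev i \<in> A))) =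
    2 ^ N * (\<Prod>i\<in>{1..N}. \<Prod>j\<in>{1..N}. pm (j \<le> i \<and> blk j = blk i \<and> \<alpha> i \<and> \<beta> j))"
proof -
  define A0 where "A0 = {i \<in> {1..N}. prefix_parity \<beta> i}"
  have inner: "(\<Sum>B\<in>Pow {1..N}. (\<Prod>i\<in>A. pm (\<alpha> i)) *
      (\<Prod>i\<in>B. pm (\<beta> i) * pm (i \<in> A) * pm (has_prev i \<and> prev i \<in> A))) =
      (if A = A0 then 2 ^ N * (\<Prod>i\<in>A0. pm (\<alpha> i)) else 0)" if "A \<in> Pow {1..N}" for A
  proof -
    let ?x = "\<lambda>i. pm (\<beta> i) * pm (i \<in> A) * pm (has_prev i \<and> prev i \<in> A)"
    \<comment> \<open>The sum over \<open>B\<close> is the product of these factors. It is 2 ^ N if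
      every equation of the chain holds, and one violated equation makes it 0.\<close>
    have x: "1 + ?x i = (if \<beta> i = ((i \<in> A) \<noteq> (has_prev i \<and> prev i \<in> A)) then 2 else 0)" for i
      by (auto simp: pm_def)
    have sol: "(\<forall>i\<in>{1..N}. \<beta> i = ((i \<in> A) \<noteq> (has_prev i \<and> prev i \<in> A))) \<longleftrightarrow> A = A0"
      unfolding A0_def using that by (intro chain_solution) (rule PowD)
    have "(\<Prod>i\<in>{1..N}. 1 + ?x i) = (if A = A0 then 2 ^ N else 0)"
    proof (cases "A = A0")
      case True
      then have "\<forall>i\<in>{1..N}. \<beta> i = ((i \<in> A) \<noteq> (has_prev i \<and> prev i \<in> A))"
        using sol by simp
      then have "(\<Prod>i\<in>{1..N}. 1 + ?x i) = (\<Prod>i\<in>{1..N}. 2)" unfolding x by (intro prod.cong) auto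
      then show ?thesis using True by simp
    next
      case False
      then obtain i where "i \<in> {1..N}" "\<beta> i \<noteq> ((i \<in> A) \<noteq> (has_prev i \<and> prev i \<in> A))"
        using sol by blast
      then have "\<exists>i\<in>{1..N}. 1 + ?x i = 0" unfolding x by auto
      then have "(\<Prod>i\<in>{1..N}. 1 + ?x i) = 0" by (subst prod_zero_iff) auto
      then show ?thesis using False by simp
    qed
    then show ?thesis by (simp only: sum_distrib_left[symmetric] sum_Pow_prod finite_atLeastAtMost) simp
  qed
  have "A0 \<in> Pow {1..N}" by (auto simp: A0_def)
  then have delta: "(\<Sum>A\<in>Pow {1..N}. if A = A0 then 2 ^ N * (\<Prod>i\<in>A0. pm (\<alpha> i)) else 0) =
      2 ^ N * (\<Prod>i\<in>A0. pm (\<alpha> i))"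
    by (subst sum.delta) auto
  have "(\<Prod>i\<in>A0. pm (\<alpha> i)) = (\<Prod>i\<in>{1..N}. if prefix_parity \<beta> i then pm (\<alpha> i) else 1)"
    unfolding A0_def by (rule prod.inter_filter) simp
  also have "\<dots> = (\<Prod>i\<in>{1..N}. \<Prod>j\<in>{1..N}. pm (j \<le> i \<and> blk j = blk i \<and> \<alpha> i \<and> \<beta> j))"
  proof (rule prod.cong[OF refl])
    fix i
    show "(if prefix_parity \<beta> i then pm (\<alpha> i) else 1) =
        (\<Prod>j\<in>{1..N}. pm (j \<le> i \<and> blk j = blk i \<and> \<alpha> i \<and> \<beta> j))"
    proof (cases "\<alpha> i")
      case True
      have "(if prefix_parity \<beta> i then pm True else 1) =
          (\<Prod>j\<in>{1..N}. pm (j \<le> i \<and> blk j = blk i \<and> \<beta> j))"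
        by (subst pm_odd_card[symmetric]) (simp_all only: finite_atLeastAtMost prefix_parity_def pm_def if_True)
      with True show ?thesis by (simp only: simp_thms)
    qed simp
  qed
  finally have prefix: "(\<Prod>i\<in>A0. pm (\<alpha> i)) = \<dots>" .
  show ?thesis unfolding prefix[symmetric] by (rule trans[OF sum.cong[OF refl inner] delta])
qed

end

section \<open>The measured chain that imprints a prefix form\<close>

definition pair_phase ::
    "(nat \<Rightarrow> nat) \<Rightarrow> (nat \<Rightarrow> qubit) \<Rightarrow> (nat \<Rightarrow> qubit) \<Rightarrow> nat set \<Rightarrow> nat set \<Rightarrow> qubit set \<Rightarrow> complex" where
  "pair_phase blk qa qb IA IB S = (\<Prod>i\<in>IA. \<Prod>j\<in>IB. pm (j \<le> i \<and> blk j = blk i \<and> qa i \<in> S \<and> qb j \<in> S))"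

text \<open>\<open>R\<close> carries the data, while \<open>y\<close> and \<open>z\<close> are fresh
  qubits outside it. The images of \<open>qa\<close> and \<open>qb\<close> may overlap: one ancilla
  can supply both a left and a right argument of the form, since the two couplings lie in different
  layers.\<close>

locale prefix_gadget = blocks +
  fixes y z qa qb :: "nat \<Rightarrow> qubit" and IA IB :: "nat set" and R :: "qubit set"
  assumes inj_y: "inj_on y {1..N}" and inj_z: "inj_on z {1..N}"
    and yz: "y ` {1..N} \<inter> z ` {1..N} = {}"
    and IA: "IA \<subseteq> {1..N}" and IB: "IB \<subseteq> {1..N}"
    and inj_qa: "inj_on qa IA" and inj_qb: "inj_on qb IB"
    and qa_R: "qa ` IA \<subseteq> R" and qb_R: "qb ` IB \<subseteq> R"
    and yR: "y ` {1..N} \<inter> R = {}" and zR: "z ` {1..N} \<inter> R = {}"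
begin

abbreviation "sites \<equiv> [1..<Suc N]"

lemma set_sites: "set sites = {1..N}"
  by auto

definition workspace :: "qubit list" where
  "workspace = map y sites @ map z sites"

text \<open>An outcome 1 at \<open>z j\<close> acts like a flip of the right argument at
  \<open>j\<close>, which adds a term linear in the left arguments at the sites
  \<open>i \<ge> j\<close> of the block. Collected by \<open>i\<close>, these terms are a Pauli Z
  for every odd prefix of outcomes. \<open>fix_b\<close> collects the outcomes at \<open>y\<close>
  over suffixes in the same way.\<close>

definition fix_a :: "qubit set \<Rightarrow> qubit list" where
  "fix_a W = map qa (filter (\<lambda>i. i \<in> IA \<and> odd (card {j \<in> {1..N}. j \<le> i \<and> blk j = blk i \<and> z j \<in> W})) sites)"

definition fix_b :: "qubit set \<Rightarrow> qubit list" where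
  "fix_b W = map qb (filter (\<lambda>j. j \<in> IB \<and> odd (card {i \<in> {1..N}. j \<le> i \<and> blk j = blk i \<and> y i \<in> W})) sites)"

text \<open>If \<open>A\<close> and \<open>B\<close> are the values of the \<open>y\<close> and
  \<open>z\<close> qubits, the last two coupling layers imprint the bidiagonal form that ties
  \<open>A\<close> to \<open>B\<close>. Summing over \<open>B\<close> makes \<open>A\<close> the
  prefix sums of the right arguments, and the first coupling layer multiplies these by the left
  arguments. Five layers prepare and couple, five measure and correct.\<close>

definition gadget :: adaptive_circuit where
  "gadget = [\<lambda>r. map (\<lambda>q. Gate1 q H_gate) workspace,
     \<lambda>r. map (\<lambda>i. Gate2 (qa i) (y i) CZ_gate) (filter (\<lambda>i. i \<in> IA) sites),
     \<lambda>r. map (\<lambda>i. Gate2 (qb i) (z i) CZ_gate) (filter (\<lambda>i. i \<in> IB) sites),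
     \<lambda>r. map (\<lambda>i. Gate2 (y i) (z i) CZ_gate) sites,
     \<lambda>r. map (\<lambda>i. Gate2 (y (prev i)) (z i) CZ_gate) (filter has_prev sites)] @
     X_measure workspace fix_a fix_b"

lemma length_gadget: "length gadget = 10"
  by (simp add: gadget_def X_measure_def)

lemma set_workspace: "set workspace = y ` {1..N} \<union> z ` {1..N}"
  by (simp only: workspace_def set_append set_map set_sites)

lemma distinct_workspace: "distinct workspace"
  unfolding workspace_def distinct_append distinct_map set_map set_sites
  using inj_y inj_z yz by auto

lemma workspace_R: "set workspace \<inter> R = {}"
  using yR zR by (auto simp: set_workspace)

lemma distinct_fix: "distinct (fix_a W)" "distinct (fix_b W)"
  unfolding fix_a_def fix_b_def distinct_map
  by (auto intro: inj_on_subset[OF inj_qa] inj_on_subset[OF inj_qb])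

lemma prev_site: "i \<in> {1..N} \<Longrightarrow> has_prev i \<Longrightarrow> prev i \<in> {1..N}"
  using prev_props(1,2)[of i] by auto

lemma inj_y_prev: "inj_on (\<lambda>i. y (prev i)) {i \<in> {1..N}. has_prev i}"
proof -
  have "inj_on prev {i \<in> {1..N}. has_prev i}" using inj_prev by (rule inj_on_subset) blast
  moreover have "inj_on y (prev ` {i \<in> {1..N}. has_prev i})"
    using inj_y by (rule inj_on_subset) (use prev_site in blast)
  ultimately show ?thesis using comp_inj_on[of prev _ y] by (simp only: comp_def)
qed

lemma valid_gadget: "R \<union> set workspace \<subseteq> R' \<Longrightarrow> valid_circuit R' gadget"
  unfolding gadget_def valid_circuit_append
proof (intro conjI)
  assume R': "R \<union> set workspace \<subseteq> R'"
  have f: "set (filter (\<lambda>i. i \<in> IA) sites) = IA" "set (filter (\<lambda>i. i \<in> IB) sites) = IB"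
    "set (filter has_prev sites) = {i \<in> {1..N}. has_prev i}" using IA IB by auto
  have d: "distinct (filter P sites)" for P by (intro distinct_filter distinct_upt)
  show "valid_circuit R' (X_measure workspace fix_a fix_b)"
  proof (rule valid_circuit_X_measure)
    have "set (fix_a W) \<subseteq> qa ` IA" "set (fix_b W) \<subseteq> qb ` IB" for W
      by (auto simp: fix_a_def fix_b_def)
    then show "distinct (fix_a W) \<and> distinct (fix_b W) \<and> set (fix_a W) \<subseteq> R' \<and> set (fix_b W) \<subseteq> R'" for W
      using distinct_fix qa_R qb_R R' by blast
  qed (use distinct_workspace R' in auto)
  have y': "y ` J \<subseteq> R'" "y ` J \<inter> R = {}" and z': "z ` J \<subseteq> R'" "z ` J \<inter> R = {}" if "J \<subseteq> {1..N}" for J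
    using image_mono[OF that, of y] image_mono[OF that, of z] R' yR zR unfolding set_workspace by blast+
  have "valid_layer R' (map (\<lambda>q. Gate1 q H_gate) workspace)"
    using R' distinct_workspace by (intro valid_layer_Gate1 unitary_gates) auto
  moreover have "valid_layer R' (map (\<lambda>i. Gate2 (qa i) (y i) CZ_gate) (filter (\<lambda>i. i \<in> IA) sites))"
    using R' inj_on_subset[OF inj_y IA] qa_R y'[OF IA] inj_qa
    by (intro valid_layer_Gate2 unitary_gates d; unfold f) blast+
  moreover have "valid_layer R' (map (\<lambda>i. Gate2 (qb i) (z i) CZ_gate) (filter (\<lambda>i. i \<in> IB) sites))"
    using R' inj_on_subset[OF inj_z IB] qb_R z'[OF IB] inj_qb
    by (intro valid_layer_Gate2 unitary_gates d; unfold f) blast+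
  moreover have "valid_layer R' (map (\<lambda>i. Gate2 (y i) (z i) CZ_gate) sites)"
    using inj_y inj_z yz y'(1)[OF order_refl] z'(1)[OF order_refl]
    by (intro valid_layer_Gate2 unitary_gates distinct_upt; unfold set_sites) blast+
  moreover have "valid_layer R' (map (\<lambda>i. Gate2 (y (prev i)) (z i) CZ_gate) (filter has_prev sites))"
  proof (intro valid_layer_Gate2 unitary_gates d; unfold f)
    have "(\<lambda>i. y (prev i)) ` {i \<in> {1..N}. has_prev i} \<subseteq> y ` {1..N}" using prev_site by blast
    moreover have "z ` {i \<in> {1..N}. has_prev i} \<subseteq> z ` {1..N}" by blast
    ultimately show "(\<lambda>i. y (prev i)) ` {i \<in> {1..N}. has_prev i} \<inter> z ` {i \<in> {1..N}. has_prev i} = {}"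
      "(\<lambda>i. y (prev i)) ` {i \<in> {1..N}. has_prev i} \<subseteq> R'" "z ` {i \<in> {1..N}. has_prev i} \<subseteq> R'"
      using yz y'(1)[OF order_refl] z'(1)[OF order_refl] by blast+
    show "inj_on (\<lambda>i. y (prev i)) {i \<in> {1..N}. has_prev i}" by (rule inj_y_prev)
    show "inj_on z {i \<in> {1..N}. has_prev i}" using inj_z by (rule inj_on_subset) blast
  qed
  ultimately show "valid_circuit R' [\<lambda>r. map (\<lambda>q. Gate1 q H_gate) workspace,
     \<lambda>r. map (\<lambda>i. Gate2 (qa i) (y i) CZ_gate) (filter (\<lambda>i. i \<in> IA) sites),
     \<lambda>r. map (\<lambda>i. Gate2 (qb i) (z i) CZ_gate) (filter (\<lambda>i. i \<in> IB) sites),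
     \<lambda>r. map (\<lambda>i. Gate2 (y i) (z i) CZ_gate) sites,
     \<lambda>r. map (\<lambda>i. Gate2 (y (prev i)) (z i) CZ_gate) (filter has_prev sites)]"
    by (simp add: valid_circuit_def)
qed

definition coupling :: "qubit set \<Rightarrow> complex" where
  "coupling S = (\<Prod>i\<in>IA. pm (qa i \<in> S \<and> y i \<in> S)) * (\<Prod>i\<in>IB. pm (qb i \<in> S \<and> z i \<in> S)) *
     (\<Prod>i\<in>{1..N}. pm (y i \<in> S \<and> z i \<in> S)) *
     (\<Prod>i\<in>{i \<in> {1..N}. has_prev i}. pm (y (prev i) \<in> S \<and> z i \<in> S))"

lemma coupling_sum:
  assumes S: "S \<inter> set workspace = {}"
  defines "a \<equiv> \<lambda>i. i \<in> IA \<and> qa i \<in> S" and "b \<equiv> \<lambda>i. i \<in> IB \<and> qb i \<in> S"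
  shows "(\<Sum>U\<in>Pow (set workspace). parity_sign U W * coupling (S \<union> U)) =
    2 ^ N * (\<Prod>i\<in>{1..N}. \<Prod>j\<in>{1..N}.
      pm (j \<le> i \<and> blk j = blk i \<and> (a i \<noteq> (y i \<in> W)) \<and> (b j \<noteq> (z j \<in> W))))"
proof -
  have term_eq: "parity_sign (y ` A \<union> z ` B) W * coupling (S \<union> (y ` A \<union> z ` B)) =
      (\<Prod>i\<in>A. pm (a i \<noteq> (y i \<in> W))) *
      (\<Prod>i\<in>B. pm (b i \<noteq> (z i \<in> W)) * pm (i \<in> A) * pm (has_prev i \<and> prev i \<in> A))"
    if AB: "A \<in> Pow {1..N}" "B \<in> Pow {1..N}" for A B
  proof -
    define S' where "S' = S \<union> (y ` A \<union> z ` B)"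
    have sub: "A \<subseteq> {1..N}" "B \<subseteq> {1..N}" using AB by auto
    have fin: "finite A" "finite B" using sub by (auto intro: finite_subset)
    have img: "y ` A \<subseteq> y ` {1..N}" "z ` B \<subseteq> z ` {1..N}" using sub by blast+
    have y: "y i \<in> S' \<longleftrightarrow> i \<in> A" and z: "z i \<in> S' \<longleftrightarrow> i \<in> B" if i: "i \<in> {1..N}" for i
    proof -
      have "y i \<in> y ` {1..N}" "z i \<in> z ` {1..N}" using i by blast+
      then have "y i \<notin> S" "z i \<notin> S" "y i \<notin> z ` B" "z i \<notin> y ` A"
        using S img yz unfolding set_workspace by blast+
      then show "y i \<in> S' \<longleftrightarrow> i \<in> A" "z i \<in> S' \<longleftrightarrow> i \<in> B"
        using inj_on_image_mem_iff[OF inj_y i sub(1)] inj_on_image_mem_iff[OF inj_z i sub(2)]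
        unfolding S'_def by simp_all
    qed
    have R: "q \<in> S' \<longleftrightarrow> q \<in> S" if q: "q \<in> R" for q
    proof -
      have "q \<notin> y ` {1..N}" "q \<notin> z ` {1..N}" using q yR zR by blast+
      then show ?thesis using img unfolding S'_def by blast
    qed
    have qa: "qa i \<in> S' \<longleftrightarrow> qa i \<in> S" if "i \<in> IA" for i using that qa_R by (intro R) blast
    have qb: "qb i \<in> S' \<longleftrightarrow> qb i \<in> S" if "i \<in> IB" for i using that qb_R by (intro R) blast
    have c1: "(\<Prod>i\<in>IA. pm (qa i \<in> S' \<and> y i \<in> S')) = (\<Prod>i\<in>A. pm (a i))"
      unfolding prod_pm_superset[OF finite_atLeastAtMost IA] prod_pm_superset[OF finite_atLeastAtMost sub(1)]
      using y qa by (intro prod.cong refl arg_cong[of _ _ pm]) (auto simp: a_def)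
    have c2: "(\<Prod>i\<in>IB. pm (qb i \<in> S' \<and> z i \<in> S')) = (\<Prod>i\<in>B. pm (b i))"
      unfolding prod_pm_superset[OF finite_atLeastAtMost IB] prod_pm_superset[OF finite_atLeastAtMost sub(2)]
      using z qb by (intro prod.cong refl arg_cong[of _ _ pm]) (auto simp: b_def)
    have c3: "(\<Prod>i\<in>{1..N}. pm (y i \<in> S' \<and> z i \<in> S')) = (\<Prod>i\<in>B. pm (i \<in> A))"
      unfolding prod_pm_superset[OF finite_atLeastAtMost sub(2)]
      using y z by (intro prod.cong refl arg_cong[of _ _ pm]) auto
    have c4: "(\<Prod>i\<in>{i \<in> {1..N}. has_prev i}. pm (y (prev i) \<in> S' \<and> z i \<in> S')) =
        (\<Prod>i\<in>B. pm (has_prev i \<and> prev i \<in> A))"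
      unfolding prod_pm_superset[OF finite_atLeastAtMost sub(2)]
        prod_pm_superset[OF finite_atLeastAtMost, of "{i \<in> {1..N}. has_prev i}" 1 N, OF Collect_restrict]
      using y z prev_site by (intro prod.cong refl arg_cong[of _ _ pm]) auto
    have "parity_sign (y ` A \<union> z ` B) W = parity_sign (y ` A) W * parity_sign (z ` B) W"
      unfolding parity_sign_def using fin sub yz by (intro prod.union_disjoint) auto
    also have "\<dots> = (\<Prod>i\<in>A. pm (y i \<in> W)) * (\<Prod>i\<in>B. pm (z i \<in> W))"
      unfolding parity_sign_def
      using inj_on_subset[OF inj_y sub(1)] inj_on_subset[OF inj_z sub(2)] by (simp add: prod.reindex)
    finally have c0: "parity_sign (y ` A \<union> z ` B) W = (\<Prod>i\<in>A. pm (y i \<in> W)) * (\<Prod>i\<in>B. pm (z i \<in> W))" .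
    show ?thesis
      unfolding S'_def[symmetric] coupling_def c0 c1 c2 c3 c4 pm_mult[symmetric] prod.distrib by (simp only: mult_ac)
  qed
  have "(\<Sum>U\<in>Pow (set workspace). parity_sign U W * coupling (S \<union> U)) =
     (\<Sum>A\<in>Pow {1..N}. \<Sum>B\<in>Pow {1..N}. parity_sign (y ` A \<union> z ` B) W * coupling (S \<union> (y ` A \<union> z ` B)))"
    unfolding set_workspace by (rule sum_Pow_images[OF inj_y inj_z yz])
  also have "\<dots> = (\<Sum>A\<in>Pow {1..N}. \<Sum>B\<in>Pow {1..N}. (\<Prod>i\<in>A. pm (a i \<noteq> (y i \<in> W))) *
      (\<Prod>i\<in>B. pm (b i \<noteq> (z i \<in> W)) * pm (i \<in> A) * pm (has_prev i \<and> prev i \<in> A)))"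
    by (intro sum.cong refl term_eq)
  finally show ?thesis unfolding chain_sum .
qed

text \<open>For data bits a, b and outcome bits u, w the product of a + u and b + w is a b + a w + u
  b + u w over the field with two elements. \<open>fix_a\<close> removes a w, \<open>fix_b\<close>
  removes u b, and u w does not depend on the data.\<close>

lemma correction_phase:
  assumes "W \<subseteq> set workspace"
  defines "a \<equiv> \<lambda>S i. i \<in> IA \<and> qa i \<in> S" and "b \<equiv> \<lambda>S i. i \<in> IB \<and> qb i \<in> S"
  shows "(\<Prod>i\<in>{1..N}. \<Prod>j\<in>{1..N}.
      pm (j \<le> i \<and> blk j = blk i \<and> (a S i \<noteq> (y i \<in> W)) \<and> (b S j \<noteq> (z j \<in> W)))) *
      (parity_sign (set (fix_a W)) S * parity_sign (set (fix_b W)) S) =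
    (\<Prod>i\<in>{1..N}. \<Prod>j\<in>{1..N}. pm (j \<le> i \<and> blk j = blk i \<and> y i \<in> W \<and> z j \<in> W)) * pair_phase blk qa qb IA IB S"
proof -
  let ?I = "{1..N}" and ?c = "\<lambda>i j. j \<le> i \<and> blk j = blk i"
  have fa: "parity_sign (set (fix_a W)) S = (\<Prod>i\<in>?I. \<Prod>j\<in>?I. pm (?c i j \<and> a S i \<and> z j \<in> W))"
  proof -
    let ?odd = "\<lambda>i. odd (card {j \<in> ?I. ?c i j \<and> z j \<in> W})"
    have "{i \<in> {1..N}. i \<in> IA \<and> ?odd i} = {i \<in> IA. ?odd i}" using IA by blast
    then have "set (fix_a W) = qa ` {i \<in> IA. ?odd i}"
      unfolding fix_a_def set_map set_filter set_sites by (simp only: conj_assoc)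
    then have "parity_sign (set (fix_a W)) S = (\<Prod>i\<in>{i \<in> IA. ?odd i}. pm (qa i \<in> S))"
      unfolding parity_sign_def using inj_on_subset[OF inj_qa, of "{i \<in> IA. ?odd i}"]
      by (simp add: prod.reindex)
    also have "\<dots> = (\<Prod>i\<in>?I. pm (i \<in> {i \<in> IA. ?odd i} \<and> qa i \<in> S))"
      using IA by (intro prod_pm_superset) auto
    also have "\<dots> = (\<Prod>i\<in>?I. \<Prod>j\<in>?I. pm (?c i j \<and> a S i \<and> z j \<in> W))"
    proof (rule prod.cong[OF refl])
      fix i
      show "pm (i \<in> {i \<in> IA. ?odd i} \<and> qa i \<in> S) = (\<Prod>j\<in>?I. pm (?c i j \<and> a S i \<and> z j \<in> W))"
        by (cases "a S i") (auto simp flip: pm_odd_card simp: a_def)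
    qed
    finally show ?thesis .
  qed
  have fb: "parity_sign (set (fix_b W)) S = (\<Prod>i\<in>?I. \<Prod>j\<in>?I. pm (?c i j \<and> y i \<in> W \<and> b S j))"
  proof -
    let ?odd = "\<lambda>j. odd (card {i \<in> ?I. ?c i j \<and> y i \<in> W})"
    have "{j \<in> {1..N}. j \<in> IB \<and> ?odd j} = {j \<in> IB. ?odd j}" using IB by blast
    then have "set (fix_b W) = qb ` {j \<in> IB. ?odd j}"
      unfolding fix_b_def set_map set_filter set_sites by (simp only: conj_assoc)
    then have "parity_sign (set (fix_b W)) S = (\<Prod>j\<in>{j \<in> IB. ?odd j}. pm (qb j \<in> S))"
      unfolding parity_sign_def using inj_on_subset[OF inj_qb, of "{j \<in> IB. ?odd j}"]
      by (simp add: prod.reindex)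
    also have "\<dots> = (\<Prod>j\<in>?I. pm (j \<in> {j \<in> IB. ?odd j} \<and> qb j \<in> S))"
      using IB by (intro prod_pm_superset) auto
    also have "\<dots> = (\<Prod>j\<in>?I. \<Prod>i\<in>?I. pm (?c i j \<and> y i \<in> W \<and> b S j))"
    proof (rule prod.cong[OF refl])
      fix j
      show "pm (j \<in> {j \<in> IB. ?odd j} \<and> qb j \<in> S) = (\<Prod>i\<in>?I. pm (?c i j \<and> y i \<in> W \<and> b S j))"
        by (cases "b S j") (auto simp flip: pm_odd_card simp: b_def)
    qed
    finally show ?thesis by (subst prod.swap)
  qed
  have pp: "pair_phase blk qa qb IA IB S = (\<Prod>i\<in>?I. \<Prod>j\<in>?I. pm (?c i j \<and> a S i \<and> b S j))"
  proof -
    have inner: "(\<Prod>j\<in>?I. pm (?c i j \<and> a S i \<and> b S j)) =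
        (if i \<in> IA then \<Prod>j\<in>IB. pm (j \<le> i \<and> blk j = blk i \<and> qa i \<in> S \<and> qb j \<in> S) else 1)" for i
    proof (cases "i \<in> IA")
      case True
      then show ?thesis
        unfolding prod_pm_superset[OF finite_atLeastAtMost IB] a_def b_def by (auto intro!: prod.cong arg_cong[of _ _ pm])
    qed (simp add: a_def)
    have IA': "?I \<inter> IA = IA" using IA by blast
    have "(\<Prod>i\<in>?I \<inter> IA. G i) = (\<Prod>i\<in>?I. if i \<in> IA then G i else 1)" for G :: "nat \<Rightarrow> complex"
      by (rule prod.inter_restrict) simp
    from this[unfolded IA'] show ?thesis unfolding inner pair_phase_def .
  qed
  have key: "pm (c \<and> (p \<noteq> u) \<and> (q \<noteq> w)) * (pm (c \<and> p \<and> w) * pm (c \<and> u \<and> q)) = pm (c \<and> u \<and> w) * pm (c \<and> p \<and> q)"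
    for c p q u w by (auto simp: pm_def)
  show ?thesis
    unfolding fa fb pp prod.distrib[symmetric]
    by (intro prod.cong refl) (use key in \<open>simp only: conj_assoc[symmetric]\<close>)
qed

text \<open>Every outcome yields the same phase up to a scalar that depends on the outcome alone, so
  no outcome has to be discarded.\<close>

lemma realizes_gadget:
  "realizes (state_of R) gadget {\<lambda>\<psi> S. c * pair_phase blk qa qb IA IB S * \<psi> S | c. True}"
  unfolding gadget_def
proof (rule realizes_append)
  let ?Q = "set workspace" and ?c = "(1 / complex_of_real (sqrt 2)) ^ length workspace"
  define F where "F = (\<lambda>\<psi> S. ?c * (coupling S * \<psi> (S - ?Q)))"
  show "realizes (state_of R) [\<lambda>r. map (\<lambda>q. Gate1 q H_gate) workspace,
     \<lambda>r. map (\<lambda>i. Gate2 (qa i) (y i) CZ_gate) (filter (\<lambda>i. i \<in> IA) sites),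
     \<lambda>r. map (\<lambda>i. Gate2 (qb i) (z i) CZ_gate) (filter (\<lambda>i. i \<in> IB) sites),
     \<lambda>r. map (\<lambda>i. Gate2 (y i) (z i) CZ_gate) sites,
     \<lambda>r. map (\<lambda>i. Gate2 (y (prev i)) (z i) CZ_gate) (filter has_prev sites)] {F}" (is "realizes _ ?Ls _")
  proof -
    have f: "set (filter (\<lambda>i. i \<in> IA) sites) = IA" "set (filter (\<lambda>i. i \<in> IB) sites) = IB"
      "set (filter has_prev sites) = {i \<in> {1..N}. has_prev i}" using IA IB by auto
    have d: "distinct (filter P sites)" for P by (intro distinct_filter distinct_upt)
    have ne: "\<forall>i\<in>set (filter (\<lambda>i. i \<in> IA) sites). qa i \<noteq> y i"
      "\<forall>i\<in>set (filter (\<lambda>i. i \<in> IB) sites). qb i \<noteq> z i"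
      "\<forall>i\<in>set sites. y i \<noteq> z i" "\<forall>i\<in>set (filter has_prev sites). y (prev i) \<noteq> z i"
      unfolding f set_sites
    proof (safe del: notI, goal_cases)
      case (1 i)
      then have "qa i \<in> R" "y i \<in> y ` {1..N}" using qa_R IA by blast+
      then show ?case using yR by (metis disjoint_iff)
    next
      case (2 i)
      then have "qb i \<in> R" "z i \<in> z ` {1..N}" using qb_R IB by blast+
      then show ?case using zR by (metis disjoint_iff)
    next
      case (3 i)
      then have "y i \<in> y ` {1..N}" "z i \<in> z ` {1..N}" by blast+
      then show ?case using yz by (metis disjoint_iff)
    next
      case (4 i)
      then have "y (prev i) \<in> y ` {1..N}" "z i \<in> z ` {1..N}" using prev_site by blast+
      then show ?case using yz by (metis disjoint_iff)
    qed
    have "circuit_branches ?Ls (r, \<psi>) = {(r, F \<psi>)}" if "state_of R \<psi>" for r \<psi>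
      by (simp only: circuit_branches.simps fst_conv layer_H_vacuum[OF distinct_workspace workspace_R that] layer_CZ[OF d ne(1)]
        layer_CZ[OF d ne(2)] layer_CZ[OF distinct_upt ne(3)] layer_CZ[OF d ne(4)] f set_sites
        F_def coupling_def UN_insert UN_empty Un_empty_right mult_ac)
    then show ?thesis by (rule realizes_singleton)
  qed
  show "realizes (\<lambda>_. True) (X_measure workspace fix_a fix_b) {X_measured workspace fix_a fix_b W | W. W \<subseteq> ?Q}"
    by (intro realizes_X_measure distinct_workspace conjI distinct_fix)
  fix F' G assume "F' \<in> {F}" and "G \<in> {X_measured workspace fix_a fix_b W | W. W \<subseteq> ?Q}"
  then obtain W where F': "F' = F" and W: "W \<subseteq> ?Q" and G: "G = X_measured workspace fix_a fix_b W" by blast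
  define K where "K = ?c * (?c * (2 ^ N *
     (\<Prod>i\<in>{1..N}. \<Prod>j\<in>{1..N}. pm (j \<le> i \<and> blk j = blk i \<and> y i \<in> W \<and> z j \<in> W))))"
  have "G (F' \<psi>) S = K * pair_phase blk qa qb IA IB S * \<psi> S" if "state_of R \<psi>" for \<psi> S
  proof (cases "S \<inter> ?Q = {}")
    case True
    have "S \<union> U - ?Q = S" if "U \<in> Pow ?Q" for U using that True by auto
    then have "(\<Sum>U\<in>Pow ?Q. parity_sign U W * F \<psi> (S \<union> U)) =
        (\<Sum>U\<in>Pow ?Q. (?c * \<psi> S) * (parity_sign U W * coupling (S \<union> U)))"
      unfolding F_def by (intro sum.cong refl) (simp add: mult_ac)
    also have "\<dots> = (?c * \<psi> S) * (\<Sum>U\<in>Pow ?Q. parity_sign U W * coupling (S \<union> U))"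
      by (rule sum_distrib_left[symmetric])
    finally have "G (F' \<psi>) S = ?c * ((?c * \<psi> S) * (\<Sum>U\<in>Pow ?Q. parity_sign U W * coupling (S \<union> U))) *
        (parity_sign (set (fix_a W)) S * parity_sign (set (fix_b W)) S)"
      unfolding F' G X_measured_def using True by simp
    also have "\<dots> = K * pair_phase blk qa qb IA IB S * \<psi> S"
      unfolding K_def coupling_sum[OF True] using correction_phase[OF W, of S]
      by (simp only: mult_ac)
    finally show ?thesis .
  next
    case False
    then have "\<not> S \<subseteq> R" using workspace_R by auto
    then show ?thesis using False that by (auto simp: G X_measured_def state_of_def)
  qed
  then show "\<exists>K\<in>{\<lambda>\<psi> S. c * pair_phase blk qa qb IA IB S * \<psi> S | c. True}. \<forall>\<psi>. state_of R \<psi> \<longrightarrow> K \<psi> = G (F' \<psi>)"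
    by (intro bexI[of _ "\<lambda>\<psi> S. K * pair_phase blk qa qb IA IB S * \<psi> S"]) auto
qed auto

end

section \<open>The circuit\<close>

text \<open>
  The highest binary digit in which two numbers differ decides which one is smaller. Each factor
  compares one digit of numbers that agree in all higher digits, so that among the sites of one
  block the comparison is between fixed sets.
\<close>

lemma pm_less_digits:
  fixes a b :: nat
  shows "(\<Prod>k<K. pm (b div 2 ^ Suc k = a div 2 ^ Suc k \<and> odd (a div 2 ^ k) \<and> even (b div 2 ^ k))) =
    pm (b div 2 ^ K = a div 2 ^ K \<and> b < a)"
proof (induction K)
  case 0
  then show ?case by (simp add: pm_def)
next
  case (Suc K)
  let ?x = "a div 2 ^ K" and ?y = "b div 2 ^ K"
  have s: "b div 2 ^ Suc K = ?y div 2" "a div 2 ^ Suc K = ?x div 2"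
    by (simp_all add: power_Suc2 div_mult2_eq del: power_Suc)
  have less: "b < a" if "?y < ?x" using that div_le_mono[of a b "2 ^ K"] by linarith
  have less': "\<not> b < a" if "?x < ?y" using that div_le_mono[of b a "2 ^ K"] by linarith
  have last: "y = x \<or> y < x \<and> odd x \<and> even y \<or> x < y \<and> even x" if "y div 2 = x div 2" for x y :: nat
    using that by presburger
  have "pm (?y = ?x \<and> b < a) * pm (?y div 2 = ?x div 2 \<and> odd ?x \<and> even ?y) = pm (?y div 2 = ?x div 2 \<and> b < a)"
  proof (cases "?y div 2 = ?x div 2")
    case True
    consider "?y = ?x" | "?y < ?x" "odd ?x" "even ?y" | "?x < ?y" "even ?x"
      using last[OF True] by blast
    then show ?thesis
    proof cases
      case 1
      then show ?thesis by simp
    next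
      case 2
      then show ?thesis using True less by simp
    next
      case 3
      then show ?thesis using True less' by simp
    qed
  next
    case False
    then have "?y \<noteq> ?x" by auto
    then show ?thesis using False by simp
  qed
  then show ?case unfolding s prod.lessThan_Suc Suc by (simp only: s)
qed

lemma realizes_concat_phases:
  assumes "\<And>g ph. (g, ph) \<in> set gs \<Longrightarrow> realizes (state_of R) g {\<lambda>\<psi> S. c * ph S * \<psi> S | c. True}"
  shows "realizes (state_of R) (concat (map fst gs)) {\<lambda>\<psi> S. c * (\<Prod>(g, ph)\<leftarrow>gs. ph S) * \<psi> S | c. True}"
  using assms
proof (induction gs)
  case Nil
  show ?case by (rule realizes_mono[OF _ _ ]) (auto intro!: realizes_Nil exI[of _ 1])
next
  case (Cons x gs)
  obtain g ph where x: "x = (g, ph)" by (cases x)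
  have cc: "concat (map fst (x # gs)) = g @ concat (map fst gs)" by (simp add: x)
  show ?case
    unfolding cc
  proof (rule realizes_append)
    show "realizes (state_of R) g {\<lambda>\<psi> S. c * ph S * \<psi> S | c. True}" using Cons.prems x by simp
    show "realizes (state_of R) (concat (map fst gs)) {\<lambda>\<psi> S. c * (\<Prod>(g, ph)\<leftarrow>gs. ph S) * \<psi> S | c. True}"
      using Cons by simp
    fix F G assume "F \<in> {\<lambda>\<psi> S. c * ph S * \<psi> S | c. True}"
      "G \<in> {\<lambda>\<psi> S. c * (\<Prod>(g, ph)\<leftarrow>gs. ph S) * \<psi> S | c. True}"
    then obtain c d where F: "F = (\<lambda>\<psi> S. c * ph S * \<psi> S)" and G: "G = (\<lambda>\<psi> S. d * (\<Prod>(g, ph)\<leftarrow>gs. ph S) * \<psi> S)"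
      by blast
    let ?K = "\<lambda>\<psi> S. (c * d) * (\<Prod>(g, ph)\<leftarrow>x # gs. ph S) * \<psi> S"
    have "?K \<in> {\<lambda>\<psi> S. c * (\<Prod>(g, ph)\<leftarrow>x # gs. ph S) * \<psi> S | c. True}" by blast
    moreover have "\<forall>\<psi>. ?K \<psi> = G (F \<psi>)" unfolding F G by (simp add: x mult_ac)
    ultimately show "\<exists>K\<in>{\<lambda>\<psi> S. c * (\<Prod>(g, ph)\<leftarrow>x # gs. ph S) * \<psi> S | c. True}.
        \<forall>\<psi>. state_of R \<psi> \<longrightarrow> K \<psi> = G (F \<psi>)" by (intro bexI[of _ ?K]) simp_all
  next
    fix F \<psi> assume "F \<in> {\<lambda>\<psi> S. c * ph S * \<psi> S | c. True}" "state_of R \<psi>"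
    then show "state_of R (F \<psi>)" by (auto intro: state_of_scale)
  qed
qed

section \<open>Imprinting the sign of one layer of edges\<close>

context edge_layers
begin

text \<open>The ancilla of an edge is labelled by the source; this inverse of \<open>tgt\<close>
  finds it from the target, so that it can also take part in a chain at the target site.\<close>

definition origin :: "nat \<Rightarrow> nat \<Rightarrow> nat" where
  "origin l = inv_into (src l) (tgt l)"

lemma origin_tgt [simp]: "i \<in> src l \<Longrightarrow> origin l (tgt l i) = i"
  unfolding origin_def using tgt_inj by (rule inv_into_f_f)

lemma inj_origin: "inj_on (origin l) (tgt l ` src l)"
  unfolding origin_def by (rule inj_on_inv_into) simp

lemma tgt_subset: "tgt l ` src l \<subseteq> {1..N}"
  using tgt_in by blast

definition register :: "nat \<Rightarrow> qubit set" where
  "register l = phys_qubits N \<union> aux_qubits N (l - 1) \<union> Anc ` {1..N}"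

lemma prefix_gadget_intro:
  assumes "1 \<le> l" "IA \<subseteq> {1..N}" "IB \<subseteq> {1..N}" "inj_on qa IA" "inj_on qb IB"
    "qa ` IA \<subseteq> register l" "qb ` IB \<subseteq> register l"
  shows "prefix_gadget N (\<lambda>i. Anc (N + i)) (\<lambda>i. Aux i l) qa qb IA IB (register l)"
proof unfold_locales
  show "(\<lambda>i. Anc (N + i)) ` {1..N} \<inter> register l = {}"
    by (auto simp: register_def phys_qubits_def aux_qubits_def)
  show "(\<lambda>i. Aux i l) ` {1..N} \<inter> register l = {}"
    using assms(1) by (auto simp: register_def phys_qubits_def aux_qubits_def)
qed (use assms in \<open>auto simp: inj_on_def\<close>)

definition gadget_of ::
    "nat \<Rightarrow> (nat \<Rightarrow> nat) \<times> (nat \<Rightarrow> qubit) \<times> (nat \<Rightarrow> qubit) \<times> nat set \<times> nat set \<Rightarrow> adaptive_circuit" where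
  "gadget_of l = (\<lambda>(blk, qa, qb, IA, IB).
     prefix_gadget.gadget N blk (\<lambda>i. Anc (N + i)) (\<lambda>i. Aux i l) qa qb IA IB)"

definition phase_of ::
    "(nat \<Rightarrow> nat) \<times> (nat \<Rightarrow> qubit) \<times> (nat \<Rightarrow> qubit) \<times> nat set \<times> nat set \<Rightarrow> qubit set \<Rightarrow> complex" where
  "phase_of = (\<lambda>(blk, qa, qb, IA, IB). pair_phase blk qa qb IA IB)"

text \<open>These are the four factors of \<open>frame_sign\<close> in order, the last one spread
  over \<open>K\<close> binary digits. An ancilla is placed at the site of its source or, through
  \<open>origin\<close>, at that of its target. In the digit forms a block consists of the sources
  whose targets agree above digit \<open>k\<close>, and digit 1 is paired with digit 0.\<close>

definition couplings ::
    "nat \<Rightarrow> nat \<Rightarrow> ((nat \<Rightarrow> nat) \<times> (nat \<Rightarrow> qubit) \<times> (nat \<Rightarrow> qubit) \<times> nat set \<times> nat set) list" where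
  "couplings K l =
     [(\<lambda>_. 0, Anc, Phys, src l, {1..N}),
      (\<lambda>_. 0, \<lambda>j. Anc (origin l j), Phys, tgt l ` src l, {1..N}),
      (\<lambda>_. 0, \<lambda>j. Anc (origin l j), Anc, tgt l ` src l, src l)] @
     map (\<lambda>k. (\<lambda>i. tgt l i div 2 ^ Suc k, Anc, Anc,
        {i \<in> src l. odd (tgt l i div 2 ^ k)}, {i \<in> src l. even (tgt l i div 2 ^ k)})) [0..<K]"

lemma prefix_gadget_couplings:
  assumes "1 \<le> l" "(blk, qa, qb, IA, IB) \<in> set (couplings K l)"
  shows "prefix_gadget N (\<lambda>i. Anc (N + i)) (\<lambda>i. Aux i l) qa qb IA IB (register l)"
proof -
  have A: "Anc ` J \<subseteq> register l" if "J \<subseteq> src l" for J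
    using that src_subset[of l] by (auto simp: register_def)
  have P: "Phys ` {1..N} \<subseteq> register l" by (auto simp: register_def phys_qubits_def)
  have O: "(\<lambda>j. Anc (origin l j)) ` (tgt l ` src l) \<subseteq> register l"
    using A[OF order_refl] by (auto simp: image_subset_iff)
  have iO: "inj_on (\<lambda>j. Anc (origin l j)) (tgt l ` src l)"
    using inj_origin by (auto simp: inj_on_def)
  have iA: "inj_on Anc J" "inj_on Phys J" for J by (auto simp: inj_on_def)
  have sub: "{i \<in> src l. P i} \<subseteq> {1..N}" for P using src_subset[of l] by blast
  from assms(2) consider
      "qa = Anc" "qb = Phys" "IA = src l" "IB = {1..N}"
    | "qa = (\<lambda>j. Anc (origin l j))" "qb = Phys" "IA = tgt l ` src l" "IB = {1..N}"
    | "qa = (\<lambda>j. Anc (origin l j))" "qb = Anc" "IA = tgt l ` src l" "IB = src l"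
    | k where "qa = Anc" "qb = Anc" "IA = {i \<in> src l. odd (tgt l i div 2 ^ k)}" "IB = {i \<in> src l. even (tgt l i div 2 ^ k)}"
    unfolding couplings_def by auto
  then show ?thesis
  proof cases
    case 1
    show ?thesis unfolding 1 by (intro prefix_gadget_intro assms(1) src_subset order_refl iA A P)
  next
    case 2
    show ?thesis unfolding 2 by (intro prefix_gadget_intro assms(1) src_subset tgt_subset order_refl iA iO A P O)
  next
    case 3
    show ?thesis unfolding 3 by (intro prefix_gadget_intro assms(1) src_subset tgt_subset order_refl iA iO A P O)
  next
    case 4
    show ?thesis unfolding 4 by (intro prefix_gadget_intro assms(1) sub iA A) blast+
  qed
qed

lemma realizes_couplings:
  assumes "1 \<le> l"
  shows "realizes (state_of (register l)) (concat (map (gadget_of l) (couplings K l)))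
    {\<lambda>\<psi> S. c * (\<Prod>x\<leftarrow>couplings K l. phase_of x S) * \<psi> S | c. True}"
proof -
  have "realizes (state_of (register l)) (gadget_of l x) {\<lambda>\<psi> S. c * phase_of x S * \<psi> S | c. True}"
    if x: "x \<in> set (couplings K l)" for x
  proof -
    obtain blk qa qb IA IB where x': "x = (blk, qa, qb, IA, IB)" by (cases x) auto
    from prefix_gadget.realizes_gadget[OF prefix_gadget_couplings[OF assms x[unfolded x']], of blk]
    show ?thesis unfolding x' gadget_of_def phase_of_def by simp
  qed
  then have "realizes (state_of (register l)) (concat (map fst (map (\<lambda>x. (gadget_of l x, phase_of x)) (couplings K l))))
    {\<lambda>\<psi> S. c * (\<Prod>(g, ph)\<leftarrow>map (\<lambda>x. (gadget_of l x, phase_of x)) (couplings K l). ph S) * \<psi> S | c. True}"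
    by (intro realizes_concat_phases) auto
  then show ?thesis by (simp add: comp_def)
qed

lemma length_couplings:
  assumes "1 \<le> l"
  shows "length (concat (map (gadget_of l) (couplings K l))) = 10 * (3 + K)"
proof -
  have "length (gadget_of l x) = 10" if x: "x \<in> set (couplings K l)" for x
  proof -
    obtain blk qa qb IA IB where x': "x = (blk, qa, qb, IA, IB)" by (cases x) auto
    from prefix_gadget.length_gadget[OF prefix_gadget_couplings[OF assms x[unfolded x']], of blk]
    show ?thesis unfolding x' gadget_of_def by simp
  qed
  then have "map (length \<circ> gadget_of l) (couplings K l) = map (\<lambda>_. 10) (couplings K l)" by simp
  then have "length (concat (map (gadget_of l) (couplings K l))) = sum_list (map (\<lambda>_. 10) (couplings K l))"
    unfolding length_concat map_map by (rule arg_cong)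
  also have "\<dots> = 10 * (3 + K)" by (simp add: couplings_def sum_list_triv)
  finally show ?thesis .
qed

lemma valid_couplings:
  assumes "1 \<le> l" "register l \<union> (\<lambda>i. Anc (N + i)) ` {1..N} \<union> (\<lambda>i. Aux i l) ` {1..N} \<subseteq> R'"
  shows "valid_circuit R' (concat (map (gadget_of l) (couplings K l)))"
proof -
  have "valid_circuit R' (gadget_of l x)" if x: "x \<in> set (couplings K l)" for x
  proof -
    obtain blk qa qb IA IB where x': "x = (blk, qa, qb, IA, IB)" by (cases x) auto
    note pg = prefix_gadget_couplings[OF assms(1) x[unfolded x']]
    have "register l \<union> set (prefix_gadget.workspace N (\<lambda>i. Anc (N + i)) (\<lambda>i. Aux i l)) \<subseteq> R'"
      unfolding prefix_gadget.set_workspace[OF pg] using assms(2) by (simp only: Un_assoc)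
    from prefix_gadget.valid_gadget[OF pg this] show ?thesis unfolding x' gadget_of_def by simp
  qed
  then show ?thesis by (auto simp: valid_circuit_def)
qed

definition frame_prefix :: "nat \<Rightarrow> qubit set \<Rightarrow> complex" where
  "frame_prefix i S = (\<Prod>j\<in>{1..N}. pm (j \<le> i \<and> Phys j \<in> S))"

definition frame_sign :: "nat \<Rightarrow> nat set \<Rightarrow> qubit set \<Rightarrow> complex" where
  "frame_sign l T S = (\<Prod>i\<in>T. frame_prefix i S) * (\<Prod>i\<in>T. frame_prefix (tgt l i) S) *
     (\<Prod>i\<in>T. \<Prod>i'\<in>T. pm (i' \<le> tgt l i)) * (\<Prod>i\<in>T. \<Prod>i'\<in>T. pm (i' < i \<and> tgt l i' < tgt l i))"

lemma edge_sign_frame: "edge_sign N (tgt l) l T S = frame_sign l T (vmap (l - 1) S)"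
  unfolding edge_sign_def frame_sign_def prefix_sign_def frame_prefix_def ..

lemma prod_src_restrict:
  "(\<Prod>i\<in>src l. \<Prod>j\<in>src l. pm (P i j \<and> Anc i \<in> S \<and> Anc j \<in> S)) =
    (\<Prod>i\<in>{i \<in> src l. Anc i \<in> S}. \<Prod>j\<in>{i \<in> src l. Anc i \<in> S}. pm (P i j))"
proof -
  let ?T = "{i \<in> src l. Anc i \<in> S}"
  have sub: "?T \<subseteq> src l" by blast
  have "(\<Prod>j\<in>src l. pm (P i j \<and> Anc i \<in> S \<and> Anc j \<in> S)) =
      (if Anc i \<in> S then \<Prod>j\<in>?T. pm (P i j) else 1)" for i
  proof (cases "Anc i \<in> S")
    case True
    then show ?thesis
      unfolding prod_pm_superset[OF finite_src sub] by (auto intro!: prod.cong arg_cong[of _ _ pm])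
  qed simp
  then show ?thesis by (simp only: prod.inter_filter[OF finite_src])
qed

lemma phase_couplings:
  assumes K: "N < 2 ^ K"
  shows "(\<Prod>x\<leftarrow>couplings K l. phase_of x S) = frame_sign l {i \<in> src l. Anc i \<in> S} S"
proof -
  let ?T = "{i \<in> src l. Anc i \<in> S}" and ?I = "{1..N}"
  note ph = pair_phase_def
  have pref: "(\<Prod>i\<in>src l. \<Prod>j\<in>?I. pm (j \<le> f i \<and> Anc i \<in> S \<and> Phys j \<in> S)) = (\<Prod>i\<in>?T. frame_prefix (f i) S)"
    for f :: "nat \<Rightarrow> nat"
    unfolding prod.inter_filter[OF finite_src] frame_prefix_def by (rule prod.cong) auto
  have re: "(\<Prod>j\<in>tgt l ` src l. g (origin l j) j) = (\<Prod>i\<in>src l. g i (tgt l i))" for g :: "nat \<Rightarrow> nat \<Rightarrow> complex"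
    by (simp add: prod.reindex[OF tgt_inj])
  have 1: "phase_of (\<lambda>_. 0, Anc, Phys, src l, ?I) S = (\<Prod>i\<in>?T. frame_prefix i S)"
    unfolding phase_of_def prod.case by (simp add: ph pref[of "\<lambda>i. i", symmetric])
  have 2: "phase_of (\<lambda>_. 0, \<lambda>j. Anc (origin l j), Phys, tgt l ` src l, ?I) S = (\<Prod>i\<in>?T. frame_prefix (tgt l i) S)"
    unfolding phase_of_def prod.case
    by (simp add: ph re[of "\<lambda>i i'. \<Prod>j\<in>?I. pm (j \<le> i' \<and> Anc i \<in> S \<and> Phys j \<in> S)", simplified] pref[of "tgt l", symmetric])
  have 3: "phase_of (\<lambda>_. 0, \<lambda>j. Anc (origin l j), Anc, tgt l ` src l, src l) S =
      (\<Prod>i\<in>?T. \<Prod>i'\<in>?T. pm (i' \<le> tgt l i))"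
    unfolding phase_of_def prod.case
    by (simp add: ph re[of "\<lambda>i i'. \<Prod>j\<in>src l. pm (j \<le> i' \<and> Anc i \<in> S \<and> Anc j \<in> S)", simplified] prod_src_restrict[symmetric])
  have 4: "(\<Prod>k<K. phase_of (\<lambda>i. tgt l i div 2 ^ Suc k, Anc, Anc,
      {i \<in> src l. odd (tgt l i div 2 ^ k)}, {i \<in> src l. even (tgt l i div 2 ^ k)}) S) =
      (\<Prod>i\<in>?T. \<Prod>i'\<in>?T. pm (i' < i \<and> tgt l i' < tgt l i))"
  proof -
    let ?d = "\<lambda>k i j. tgt l j div 2 ^ Suc k = tgt l i div 2 ^ Suc k \<and> odd (tgt l i div 2 ^ k) \<and> even (tgt l j div 2 ^ k)"
    have "phase_of (\<lambda>i. tgt l i div 2 ^ Suc k, Anc, Anc,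
        {i \<in> src l. odd (tgt l i div 2 ^ k)}, {i \<in> src l. even (tgt l i div 2 ^ k)}) S =
        (\<Prod>i\<in>src l. \<Prod>j\<in>src l. pm (j \<le> i \<and> Anc i \<in> S \<and> Anc j \<in> S \<and> ?d k i j))" for k
      unfolding phase_of_def prod.case ph prod.inter_filter[OF finite_src]
      by (auto intro!: prod.cong arg_cong[of _ _ pm])
    then have "(\<Prod>k<K. phase_of (\<lambda>i. tgt l i div 2 ^ Suc k, Anc, Anc,
        {i \<in> src l. odd (tgt l i div 2 ^ k)}, {i \<in> src l. even (tgt l i div 2 ^ k)}) S) =
        (\<Prod>k<K. \<Prod>i\<in>src l. \<Prod>j\<in>src l. pm (j \<le> i \<and> Anc i \<in> S \<and> Anc j \<in> S \<and> ?d k i j))"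
      by (simp only:)
    also have "\<dots> = (\<Prod>i\<in>src l. \<Prod>k<K. \<Prod>j\<in>src l. pm (j \<le> i \<and> Anc i \<in> S \<and> Anc j \<in> S \<and> ?d k i j))"
      by (rule prod.swap)
    also have "\<dots> = (\<Prod>i\<in>src l. \<Prod>j\<in>src l. \<Prod>k<K. pm (j \<le> i \<and> Anc i \<in> S \<and> Anc j \<in> S \<and> ?d k i j))"
      by (rule prod.cong[OF refl], rule prod.swap)
    also have "\<dots> = (\<Prod>i\<in>src l. \<Prod>j\<in>src l. pm ((j < i \<and> tgt l j < tgt l i) \<and> Anc i \<in> S \<and> Anc j \<in> S))"
    proof (rule prod.cong[OF refl], rule prod.cong[OF refl])
      fix i j assume ij: "i \<in> src l" "j \<in> src l"
      \<comment> \<open>Both targets become 0 after division by 2 ^ K, so the digits decide the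
        comparison without a further condition.\<close>
      have "tgt l i < 2 ^ K" "tgt l j < 2 ^ K" using tgt_in[OF ij(1)] tgt_in[OF ij(2)] K by auto
      then have dig: "(\<Prod>k<K. pm (?d k i j)) = pm (tgt l j < tgt l i)" unfolding pm_less_digits by simp
      show "(\<Prod>k<K. pm (j \<le> i \<and> Anc i \<in> S \<and> Anc j \<in> S \<and> ?d k i j)) =
          pm ((j < i \<and> tgt l j < tgt l i) \<and> Anc i \<in> S \<and> Anc j \<in> S)"
      proof (cases "j \<le> i \<and> Anc i \<in> S \<and> Anc j \<in> S")
        case True
        then have "(\<Prod>k<K. pm (j \<le> i \<and> Anc i \<in> S \<and> Anc j \<in> S \<and> ?d k i j)) = (\<Prod>k<K. pm (?d k i j))" by simp
        also have "\<dots> = pm ((j < i \<and> tgt l j < tgt l i) \<and> Anc i \<in> S \<and> Anc j \<in> S)"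
          unfolding dig using True by (cases "j = i") auto
        finally show ?thesis .
      next
        case False
        then have "(\<Prod>k<K. pm (j \<le> i \<and> Anc i \<in> S \<and> Anc j \<in> S \<and> ?d k i j)) = (\<Prod>k<K. 1)"
          by (intro prod.cong refl) (auto simp: pm_def)
        then show ?thesis using False by (auto simp: pm_def)
      qed
    qed
    also have "\<dots> = (\<Prod>i\<in>?T. \<Prod>i'\<in>?T. pm (i' < i \<and> tgt l i' < tgt l i))" by (rule prod_src_restrict)
    finally show ?thesis .
  qed
  have "(\<Prod>x\<leftarrow>couplings K l. phase_of x S) =
      (\<Prod>i\<in>?T. frame_prefix i S) * ((\<Prod>i\<in>?T. frame_prefix (tgt l i) S) *
       ((\<Prod>i\<in>?T. \<Prod>i'\<in>?T. pm (i' \<le> tgt l i)) *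
        (\<Prod>k<K. phase_of (\<lambda>i. tgt l i div 2 ^ Suc k, Anc, Anc,
      {i \<in> src l. odd (tgt l i div 2 ^ k)}, {i \<in> src l. even (tgt l i div 2 ^ k)}) S)))"
    unfolding couplings_def append_Cons append_Nil list.map prod_list.Cons 1 2 3 map_map comp_def
    by (simp add: prod.distinct_set_conv_list[symmetric] atLeast0LessThan del: power_Suc)
  then show ?thesis unfolding 4 frame_sign_def by (simp only: mult_ac)
qed

end

section \<open>The parity frame as an involution of basis vectors\<close>

lemma Aux_vmap [simp]: "Aux i m \<in> vmap l S \<longleftrightarrow> Aux i m \<in> S"
  by (simp add: vmap_def)

lemma Anc_vmap [simp]: "Anc i \<in> vmap l S \<longleftrightarrow> Anc i \<in> S"
  by (simp add: vmap_def)

lemma Phys_vmap: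
  "Phys i \<in> vmap l S \<longleftrightarrow> (Phys i \<in> S) \<noteq> odd (card {m \<in> {1..l}. Aux i m \<in> S})"
  by (simp add: vmap_def)

lemma qubit_set_eqI:
  assumes "\<And>i. Phys i \<in> S \<longleftrightarrow> Phys i \<in> S'" "\<And>i m. Aux i m \<in> S \<longleftrightarrow> Aux i m \<in> S'"
    "\<And>i. Anc i \<in> S \<longleftrightarrow> Anc i \<in> S'"
  shows "S = S'"
proof (rule set_eqI)
  fix q show "q \<in> S \<longleftrightarrow> q \<in> S'" using assms by (cases q) auto
qed

lemma vmap_vmap [simp]: "vmap l (vmap l S) = S"
  by (rule qubit_set_eqI) (auto simp: Phys_vmap)

lemma vmap_0 [simp]: "vmap 0 S = S"
  by (rule qubit_set_eqI) (auto simp: Phys_vmap)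

text \<open>Only the layers up to \<open>l\<close> enter the site parities, so flips in higher
  layers and of ancillas commute with the change of frame.\<close>

lemma vmap_sd:
  assumes "\<And>i. Phys i \<notin> X" "\<And>i m. Aux i m \<in> X \<Longrightarrow> l < m"
  shows "vmap l (sd S X) = sd (vmap l S) X"
proof (rule qubit_set_eqI)
  fix i
  have "{m \<in> {1..l}. Aux i m \<in> sd S X} = {m \<in> {1..l}. Aux i m \<in> S}"
    using assms(2) by fastforce
  then show "Phys i \<in> vmap l (sd S X) \<longleftrightarrow> Phys i \<in> sd (vmap l S) X"
    using assms(1) by (simp add: Phys_vmap)
qed auto

lemma state_of_vmap:
  assumes "state_of (phys_qubits N \<union> aux_qubits N n) \<psi>"
  shows "state_of (phys_qubits N \<union> aux_qubits N n) (\<lambda>S. \<psi> (vmap l S))"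
proof (rule state_ofI, rule ccontr)
  let ?R = "phys_qubits N \<union> aux_qubits N n"
  fix S assume S: "\<not> S \<subseteq> ?R" and nz: "\<psi> (vmap l S) \<noteq> 0"
  have sub: "vmap l S \<subseteq> ?R" using nz assms by (auto simp: state_of_def)
  obtain q where q: "q \<in> S" "q \<notin> ?R" using S by blast
  show False
  proof (cases q)
    case (Phys i)
    have "Phys i \<notin> vmap l S" using q sub Phys by blast
    then have "odd (card {m \<in> {1..l}. Aux i m \<in> S})" using q Phys by (simp add: Phys_vmap)
    then have "{m \<in> {1..l}. Aux i m \<in> S} \<noteq> {}" by (metis card.empty even_zero)
    then obtain m where "Aux i m \<in> S" by blast
    then have "Aux i m \<in> ?R" using sub Aux_vmap[of i m l S] by blast
    then show False using q Phys by (auto simp: phys_qubits_def aux_qubits_def)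
  next
    case (Aux i m)
    then show False using q sub Aux_vmap[of i m l S] by blast
  next
    case (Anc i)
    then show False using q sub Anc_vmap[of i l S] by blast
  qed
qed

section \<open>One round of the circuit\<close>

context edge_layers
begin

definition site_flip :: "nat \<Rightarrow> qubit set \<Rightarrow> qubit set" where
  "site_flip l S = sd S (Phys ` {i \<in> {1..N}. Aux i l \<in> S})"

text \<open>A controlled flip from layer \<open>l + 1\<close> onto the physical qubit adds the one
  summand by which the two parities differ. The circuit has such gates at the sites 1 to
  \<open>N\<close> only, whereas \<open>vmap\<close> ranges over all sites; hence the
  hypothesis.\<close>

lemma vmap_site_flip:
  assumes "\<And>i. Aux i (Suc l) \<in> S \<Longrightarrow> i \<in> {1..N}"
  shows "vmap l (site_flip (Suc l) S) = vmap (Suc l) S"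
proof (rule qubit_set_eqI)
  fix i
  let ?X = "{m \<in> {1..l}. Aux i m \<in> S}"
  have 1: "{m \<in> {1..l}. Aux i m \<in> site_flip (Suc l) S} = ?X" by (auto simp: site_flip_def)
  have 2: "{m \<in> {1..Suc l}. Aux i m \<in> S} = (if Aux i (Suc l) \<in> S then insert (Suc l) ?X else ?X)"
    by (auto simp: le_Suc_eq)
  have "odd (card {m \<in> {1..Suc l}. Aux i m \<in> S}) \<longleftrightarrow> odd (card ?X) \<noteq> (Aux i (Suc l) \<in> S)"
    unfolding 2 by auto
  moreover have "Phys i \<in> site_flip (Suc l) S \<longleftrightarrow> (Phys i \<in> S) \<noteq> (Aux i (Suc l) \<in> S)"
    using assms by (auto simp: site_flip_def)
  ultimately show "Phys i \<in> vmap l (site_flip (Suc l) S) \<longleftrightarrow> Phys i \<in> vmap (Suc l) S"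
    unfolding Phys_vmap 1 by blast
qed (auto simp: site_flip_def)

lemma edge_flip_Aux:
  assumes "T \<subseteq> src l"
  shows "Phys i \<notin> edge_flip (tgt l) l T" "Anc i \<notin> edge_flip (tgt l) l T"
    "Aux i m \<in> edge_flip (tgt l) l T \<Longrightarrow> m = l \<and> i \<in> {1..N}"
proof -
  show "Phys i \<notin> edge_flip (tgt l) l T" "Anc i \<notin> edge_flip (tgt l) l T"
    by (auto simp: edge_flip_def)
  have "T \<subseteq> {1..N}" "tgt l ` T \<subseteq> {1..N}" using assms src_subset[of l] tgt_subset[of l] by blast+
  then show "Aux i m \<in> edge_flip (tgt l) l T \<Longrightarrow> m = l \<and> i \<in> {1..N}"
    unfolding edge_flip_def in_sd by blast
qed

lemma frame_sign_cong:
  "(\<And>j. Phys j \<in> S \<longleftrightarrow> Phys j \<in> S') \<Longrightarrow> frame_sign l T S = frame_sign l T S'"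
  by (simp add: frame_sign_def frame_prefix_def)

definition sources :: "nat \<Rightarrow> nat list" where
  "sources l = filter (\<lambda>i. i \<in> src l) [1..<Suc N]"

lemma set_sources [simp]: "set (sources l) = src l"
  using src_subset[of l] by (auto simp: sources_def)

lemma distinct_sources [simp]: "distinct (sources l)" "distinct (map Anc (sources l))"
  by (simp_all add: sources_def distinct_map inj_on_def)

definition active :: "nat \<Rightarrow> qubit set \<Rightarrow> nat set" where
  "active l S = {i \<in> src l. Anc i \<in> S}"

text \<open>The sign is imprinted before the flips: it belongs to the unflipped vector, and the
  gadgets borrow the qubits of layer \<open>l\<close> while they are empty. Two layers of flips are
  needed because each ancilla controls both end points. The final layer passes to the next frame.
  The depth is 1 + 10 * (3 + K) + 2 + 5 + 1.\<close>

definition layer_round :: "nat \<Rightarrow> nat \<Rightarrow> adaptive_circuit" where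
  "layer_round K l =
     ((([\<lambda>r. map (\<lambda>q. Gate1 q H_gate) (map Anc (sources l))] @
        concat (map (gadget_of l) (couplings K l))) @
       [\<lambda>r. map (\<lambda>i. Gate2 (Anc i) (Aux i l) CX_gate) (sources l),
        \<lambda>r. map (\<lambda>i. Gate2 (Anc i) (Aux (tgt l i) l) CX_gate) (sources l)]) @
      X_measure (map Anc (sources l)) (\<lambda>_. []) (\<lambda>_. [])) @
     [\<lambda>r. map (\<lambda>i. Gate2 (Aux i l) (Phys i) CX_gate) [1..<Suc N]]"

lemma length_layer_round: "1 \<le> l \<Longrightarrow> length (layer_round K l) = 39 + 10 * K"
  by (simp add: layer_round_def length_couplings X_measure_def del: length_concat)

lemma realizes_round_phases:
  assumes l: "1 \<le> l" and K: "N < 2 ^ K"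
  shows "realizes (state_of (phys_qubits N \<union> aux_qubits N (l - 1)))
    ([\<lambda>r. map (\<lambda>q. Gate1 q H_gate) (map Anc (sources l))] @ concat (map (gadget_of l) (couplings K l)))
    {\<lambda>\<eta> S. c * frame_sign l (active l S) S * \<eta> (S - Anc ` src l) | c. True}"
proof (rule realizes_append)
  let ?R = "phys_qubits N \<union> aux_qubits N (l - 1)" and ?Q = "Anc ` src l"
  let ?F = "\<lambda>\<eta> S. (1 / complex_of_real (sqrt 2)) ^ length (map Anc (sources l)) * \<eta> (S - ?Q)"
  have set: "set (map Anc (sources l)) = ?Q" by simp
  have dis: "set (map Anc (sources l)) \<inter> ?R = {}" by (auto simp: phys_qubits_def aux_qubits_def)
  show "realizes (state_of ?R) [\<lambda>r. map (\<lambda>q. Gate1 q H_gate) (map Anc (sources l))] {?F}"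
  proof (rule realizes_singleton)
    fix r \<psi> assume "state_of ?R \<psi>"
    from layer_H_vacuum[OF distinct_sources(2) dis this]
    show "circuit_branches [\<lambda>r. map (\<lambda>q. Gate1 q H_gate) (map Anc (sources l))] (r, \<psi>) = {(r, ?F \<psi>)}"
      unfolding circuit_branches.simps set by simp
  qed
  show "realizes (state_of (register l)) (concat (map (gadget_of l) (couplings K l)))
      {\<lambda>\<psi> S. c * (\<Prod>x\<leftarrow>couplings K l. phase_of x S) * \<psi> S | c. True}"
    by (rule realizes_couplings[OF l])
  fix F assume F: "F \<in> {?F}"
  show "state_of (register l) (F \<eta>)" if \<eta>: "state_of ?R \<eta>" for \<eta>
  proof (rule state_ofI)
    fix S assume S: "\<not> S \<subseteq> register l"
    have "?Q \<subseteq> Anc ` {1..N}" using src_subset[of l] by blast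
    then have "\<not> S - ?Q \<subseteq> ?R" using S unfolding register_def by blast
    then show "F \<eta> S = 0" using \<eta> F by (auto simp: state_of_def)
  qed
  fix G assume "G \<in> {\<lambda>\<psi> S. c * (\<Prod>x\<leftarrow>couplings K l. phase_of x S) * \<psi> S | c. True}"
  then obtain c where G: "G = (\<lambda>\<psi> S. c * frame_sign l (active l S) S * \<psi> S)"
    unfolding phase_couplings[OF K] active_def[symmetric] by blast
  let ?K = "\<lambda>\<eta> S. (c * (1 / complex_of_real (sqrt 2)) ^ length (map Anc (sources l))) *
    frame_sign l (active l S) S * \<eta> (S - ?Q)"
  have "?K \<in> {\<lambda>\<eta> S. c * frame_sign l (active l S) S * \<eta> (S - ?Q) | c. True}" by blast
  moreover have "\<forall>\<eta>. ?K \<eta> = G (F \<eta>)" using F G by (simp add: mult_ac)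
  ultimately show "\<exists>K\<in>{\<lambda>\<eta> S. c * frame_sign l (active l S) S * \<eta> (S - ?Q) | c. True}.
      \<forall>\<eta>. state_of ?R \<eta> \<longrightarrow> K \<eta> = G (F \<eta>)" by (intro bexI[of _ ?K]) simp_all
qed

lemma realizes_round_flips:
  "realizes P [\<lambda>r. map (\<lambda>i. Gate2 (Anc i) (Aux i l) CX_gate) (sources l),
        \<lambda>r. map (\<lambda>i. Gate2 (Anc i) (Aux (tgt l i) l) CX_gate) (sources l)]
     {\<lambda>\<psi> S. \<psi> (sd S (edge_flip (tgt l) l (active l S)))}"
proof (rule realizes_singleton)
  fix r \<psi>
  let ?A = "\<lambda>S. (\<lambda>i. Aux i l) ` {i \<in> set (sources l). Anc i \<in> S}"
  let ?B = "\<lambda>S. (\<lambda>i. Aux (tgt l i) l) ` {i \<in> set (sources l). Anc i \<in> S}"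
  have A: "layer_branches (map (\<lambda>i. Gate2 (Anc i) (Aux i l) CX_gate) (sources l)) (r, \<psi>) =
      {(r, \<lambda>S. \<psi> (sd S (?A S)))}" for \<psi>
    by (rule layer_CX) (auto simp: inj_on_def)
  have B: "layer_branches (map (\<lambda>i. Gate2 (Anc i) (Aux (tgt l i) l) CX_gate) (sources l)) (r, \<psi>) =
      {(r, \<lambda>S. \<psi> (sd S (?B S)))}" for \<psi>
    using tgt_inj[of l] by (intro layer_CX) (auto simp: inj_on_def)
  have "sd (sd S (?B S)) (?A (sd S (?B S))) = sd S (edge_flip (tgt l) l (active l S))" for S
  proof -
    have "?A (sd S (?B S)) = ?A S" by (intro arg_cong[of _ _ "image (\<lambda>i. Aux i l)"]) auto
    moreover have "edge_flip (tgt l) l (active l S) = sd (?A S) (?B S)"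
      by (simp add: edge_flip_def active_def)
    moreover have "sd (sd S Y) X = sd S (sd X Y)" for X Y by auto
    ultimately show ?thesis by (simp only:)
  qed
  then show "circuit_branches [\<lambda>r. map (\<lambda>i. Gate2 (Anc i) (Aux i l) CX_gate) (sources l),
        \<lambda>r. map (\<lambda>i. Gate2 (Anc i) (Aux (tgt l i) l) CX_gate) (sources l)] (r, \<psi>) =
     {(r, \<lambda>S. \<psi> (sd S (edge_flip (tgt l) l (active l S))))}"
    by (simp only: circuit_branches.simps fst_conv A B UN_insert UN_empty Un_empty_right)
qed

definition signed_sum :: "nat \<Rightarrow> (nat \<Rightarrow> complex) \<Rightarrow> state \<Rightarrow> state" where
  "signed_sum l s \<eta> = (\<lambda>S. \<Sum>T\<in>Pow (src l). (\<Prod>i\<in>T. s i) *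
     (frame_sign l T (sd S (edge_flip (tgt l) l T)) * \<eta> (sd S (edge_flip (tgt l) l T))))"

text \<open>The value of the ancillas is the edge set \<open>T\<close>, and the flips do not change
  it. The overlap with the measured X basis vector is thus the sum over \<open>T\<close>, in which
  an outcome 1 at \<open>Anc i\<close> gives the edge the sign -1.\<close>

lemma measured_sum:
  assumes \<eta>: "state_of (phys_qubits N \<union> aux_qubits N (l - 1)) \<eta>"
    and \<theta>: "\<theta> = (\<lambda>S. c * frame_sign l (active l (sd S (edge_flip (tgt l) l (active l S)))) (sd S (edge_flip (tgt l) l (active l S))) *
      \<eta> (sd S (edge_flip (tgt l) l (active l S)) - Anc ` src l))"
  shows "X_measured (map Anc (sources l)) (\<lambda>_. []) (\<lambda>_. []) W \<theta> S =
    (1 / complex_of_real (sqrt 2)) ^ length (sources l) * c * signed_sum l (\<lambda>i. pm (Anc i \<in> W)) \<eta> S"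
proof (cases "S \<inter> Anc ` src l = {}")
  case True
  have "(\<Sum>U\<in>Pow (Anc ` src l). parity_sign U W * \<theta> (S \<union> U)) =
      (\<Sum>T\<in>Pow (src l). parity_sign (Anc ` T) W * \<theta> (S \<union> Anc ` T))"
  proof -
    have inj: "inj_on Anc (src l)" by (auto simp: inj_on_def)
    have "Pow (Anc ` src l) = (`) Anc ` Pow (src l)" by (rule image_Pow_surj[OF refl, symmetric])
    then show ?thesis using inj_on_image_Pow[OF inj] by (simp add: sum.reindex)
  qed
  also have "\<dots> = (\<Sum>T\<in>Pow (src l). c * ((\<Prod>i\<in>T. pm (Anc i \<in> W)) *
     (frame_sign l T (sd S (edge_flip (tgt l) l T)) * \<eta> (sd S (edge_flip (tgt l) l T)))))"
  proof (rule sum.cong[OF refl])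
    fix T assume T: "T \<in> Pow (src l)"
    let ?fl = "edge_flip (tgt l) l T"
    have fl: "Anc i \<notin> ?fl" for i using edge_flip_Aux T by blast
    have a1: "active l (S \<union> Anc ` T) = T" using True T by (auto simp: active_def)
    have a2: "active l (sd (S \<union> Anc ` T) ?fl) = T" using a1 fl by (auto simp: active_def)
    have a3: "sd (S \<union> Anc ` T) ?fl - Anc ` src l = sd S ?fl"
    proof (rule qubit_set_eqI)
      fix i show "Anc i \<in> sd (S \<union> Anc ` T) ?fl - Anc ` src l \<longleftrightarrow> Anc i \<in> sd S ?fl"
        using fl[of i] True T by auto
    qed auto
    have a4: "frame_sign l T (sd (S \<union> Anc ` T) ?fl) = frame_sign l T (sd S ?fl)"
      by (rule frame_sign_cong) auto
    have a5: "parity_sign (Anc ` T) W = (\<Prod>i\<in>T. pm (Anc i \<in> W))"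
      by (simp add: parity_sign_def prod.reindex inj_on_def)
    show "parity_sign (Anc ` T) W * \<theta> (S \<union> Anc ` T) = c * ((\<Prod>i\<in>T. pm (Anc i \<in> W)) *
        (frame_sign l T (sd S ?fl) * \<eta> (sd S ?fl)))"
      unfolding \<theta> a1 a2 a3 a4 a5 by (simp only: mult_ac)
  qed
  finally have sum: "(\<Sum>U\<in>Pow (Anc ` src l). parity_sign U W * \<theta> (S \<union> U)) =
      c * signed_sum l (\<lambda>i. pm (Anc i \<in> W)) \<eta> S"
    unfolding signed_sum_def sum_distrib_left[symmetric] .
  show ?thesis
    unfolding X_measured_def using True by (simp add: sum) (simp add: parity_sign_def)
next
  case False
  then obtain i where i: "Anc i \<in> S" by blast
  have "\<eta> (sd S (edge_flip (tgt l) l T)) = 0" if T: "T \<in> Pow (src l)" for T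
  proof -
    have "Anc i \<in> sd S (edge_flip (tgt l) l T)" using edge_flip_Aux(2) T i by auto
    then have "\<not> sd S (edge_flip (tgt l) l T) \<subseteq> phys_qubits N \<union> aux_qubits N (l - 1)"
      by (auto simp: phys_qubits_def aux_qubits_def subset_iff simp del: in_sd)
    then show ?thesis using \<eta> by (auto simp: state_of_def)
  qed
  then have "signed_sum l (\<lambda>i. pm (Anc i \<in> W)) \<eta> S = 0" unfolding signed_sum_def by simp
  then show ?thesis using False by (simp add: X_measured_def)
qed

text \<open>In the frame, \<open>frame_sign\<close> is \<open>edge_sign\<close> and the flips of
  layer \<open>l\<close> commute with the frame of the lower layers. So the sum becomes a projection
  once input and output are read in the frames before and after the round.\<close>

lemma signed_sum_site_flip:
  assumes l: "1 \<le> l" and \<eta>: "state_of (phys_qubits N \<union> aux_qubits N (l - 1)) \<eta>"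
  shows "signed_sum l s \<eta> (site_flip l S) =
    layer_projection l s (\<lambda>S. \<eta> (vmap (l - 1) S)) (vmap l S)"
  unfolding signed_sum_def layer_projection_def
proof (rule sum.cong[OF refl])
  fix T assume "T \<in> Pow (src l)"
  then have T: "T \<subseteq> src l" by blast
  let ?fl = "edge_flip (tgt l) l T"
  have vfl: "vmap (l - 1) (sd X ?fl) = sd (vmap (l - 1) X) ?fl" for X
  proof (rule vmap_sd)
    show "l - 1 < m" if "Aux i m \<in> ?fl" for i m using edge_flip_Aux(3)[OF T that] l by simp
  qed (rule edge_flip_Aux(1)[OF T])
  have "frame_sign l T (sd (site_flip l S) ?fl) * \<eta> (sd (site_flip l S) ?fl) =
      frame_sign l T (sd (vmap (l - 1) (vmap l S)) ?fl) * \<eta> (sd (vmap (l - 1) (vmap l S)) ?fl)"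
  \<comment> \<open>For a layer qubit outside the sites 1 to \<open>N\<close> the circuit and the
    change of frame differ, but then the amplitudes on both sides are 0.\<close>
  proof (cases "\<exists>i. Aux i l \<in> S \<and> i \<notin> {1..N}")
    case True
    then obtain i where i: "Aux i l \<in> S" "i \<notin> {1..N}" by blast
    have z: "\<eta> (sd X ?fl) = 0" if "Aux i l \<in> X" for X
    proof -
      have "Aux i l \<in> sd X ?fl" using that edge_flip_Aux(3)[OF T, of i l] i(2) by auto
      then have "\<not> sd X ?fl \<subseteq> phys_qubits N \<union> aux_qubits N (l - 1)"
        using i(2) by (auto simp: phys_qubits_def aux_qubits_def subset_iff simp del: in_sd)
      then show ?thesis using \<eta> by (auto simp: state_of_def)
    qed
    have "Aux i l \<in> site_flip l S" using i(1) by (auto simp: site_flip_def)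
    moreover have "Aux i l \<in> vmap (l - 1) (vmap l S)" using i(1) by simp
    ultimately show ?thesis by (simp add: z)
  next
    case False
    then have "vmap (l - 1) (site_flip l S) = vmap l S"
      using l vmap_site_flip[of "l - 1" S] by (cases l) auto
    then have "vmap (l - 1) (vmap l S) = site_flip l S" by (metis vmap_vmap)
    then show ?thesis by simp
  qed
  then show "(\<Prod>i\<in>T. s i) * (frame_sign l T (sd (site_flip l S) ?fl) * \<eta> (sd (site_flip l S) ?fl)) =
      (\<Prod>i\<in>T. s i) * layer_product l T (\<lambda>S. \<eta> (vmap (l - 1) S)) (vmap l S)"
    unfolding edge_product_def edge_sign_frame vfl by simp
qed

lemma layer_CX_site_flip:
  "layer_branches (map (\<lambda>i. Gate2 (Aux i l) (Phys i) CX_gate) [1..<Suc N]) (r, \<psi>) =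
    {(r, \<lambda>S. \<psi> (site_flip l S))}"
proof -
  have set: "set [1..<Suc N] = {1..N}" by auto
  have "layer_branches (map (\<lambda>i. Gate2 (Aux i l) (Phys i) CX_gate) [1..<Suc N]) (r, \<psi>) =
    {(r, \<lambda>S. \<psi> (sd S (Phys ` {i \<in> set [1..<Suc N]. Aux i l \<in> S})))}"
    by (rule layer_CX[OF distinct_upt]) (auto simp: inj_on_def)
  then show ?thesis unfolding set site_flip_def .
qed

lemma realizes_layer_round:
  assumes l: "1 \<le> l" and K: "N < 2 ^ K"
  shows "realizes (state_of (phys_qubits N \<union> aux_qubits N (l - 1))) (layer_round K l)
    {\<lambda>\<eta> S. c * layer_projection l s (\<lambda>S. \<eta> (vmap (l - 1) S)) (vmap l S) | c s. \<forall>i. s i \<in> {1, -1}}"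
proof -
  let ?P = "state_of (phys_qubits N \<union> aux_qubits N (l - 1))"
  let ?fl = "\<lambda>S. sd S (edge_flip (tgt l) l (active l S))"
  let ?X1 = "{\<lambda>\<eta> S. c * frame_sign l (active l S) S * \<eta> (S - Anc ` src l) | c. True}"
  let ?X2 = "{\<lambda>\<eta> S. c * frame_sign l (active l (?fl S)) (?fl S) * \<eta> (?fl S - Anc ` src l) | c. True}"
  let ?X3 = "{\<lambda>\<eta> S. c * signed_sum l s \<eta> S | c s. \<forall>i. s i \<in> {1, -1}}"
  let ?X4 = "{\<lambda>\<eta> S. c * layer_projection l s (\<lambda>S. \<eta> (vmap (l - 1) S)) (vmap l S) | c s. \<forall>i. s i \<in> {1, -1}}"
  show ?thesis
    unfolding layer_round_def
  proof (rule realizes_append[where X = ?X3 and Q = "\<lambda>_. True"])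
    show "realizes (\<lambda>_. True) [\<lambda>r. map (\<lambda>i. Gate2 (Aux i l) (Phys i) CX_gate) [1..<Suc N]] {\<lambda>\<psi> S. \<psi> (site_flip l S)}"
      by (rule realizes_singleton)
        (simp only: circuit_branches.simps fst_conv layer_CX_site_flip UN_insert UN_empty Un_empty_right)
    show "realizes ?P ((([\<lambda>r. map (\<lambda>q. Gate1 q H_gate) (map Anc (sources l))] @
        concat (map (gadget_of l) (couplings K l))) @
       [\<lambda>r. map (\<lambda>i. Gate2 (Anc i) (Aux i l) CX_gate) (sources l),
        \<lambda>r. map (\<lambda>i. Gate2 (Anc i) (Aux (tgt l i) l) CX_gate) (sources l)]) @
      X_measure (map Anc (sources l)) (\<lambda>_. []) (\<lambda>_. [])) ?X3"
    proof (rule realizes_append[where X = ?X2 and Q = "\<lambda>_. True"])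
      show "realizes (\<lambda>_. True) (X_measure (map Anc (sources l)) (\<lambda>_. []) (\<lambda>_. []))
          {X_measured (map Anc (sources l)) (\<lambda>_. []) (\<lambda>_. []) W | W. W \<subseteq> set (map Anc (sources l))}"
        by (rule realizes_X_measure) auto
      show "realizes ?P (([\<lambda>r. map (\<lambda>q. Gate1 q H_gate) (map Anc (sources l))] @
        concat (map (gadget_of l) (couplings K l))) @
       [\<lambda>r. map (\<lambda>i. Gate2 (Anc i) (Aux i l) CX_gate) (sources l),
        \<lambda>r. map (\<lambda>i. Gate2 (Anc i) (Aux (tgt l i) l) CX_gate) (sources l)]) ?X2"
        by (rule realizes_append[OF realizes_round_phases[OF l K] realizes_round_flips[of "\<lambda>_. True"]]) auto
      fix F G assume "F \<in> ?X2"
        and "G \<in> {X_measured (map Anc (sources l)) (\<lambda>_. []) (\<lambda>_. []) W | W. W \<subseteq> set (map Anc (sources l))}"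
      then obtain c W where
        F: "F = (\<lambda>\<eta> S. c * frame_sign l (active l (?fl S)) (?fl S) * \<eta> (?fl S - Anc ` src l))"
        and G: "G = X_measured (map Anc (sources l)) (\<lambda>_. []) (\<lambda>_. []) W" by blast
      let ?K = "\<lambda>\<eta> S. ((1 / complex_of_real (sqrt 2)) ^ length (sources l) * c) * signed_sum l (\<lambda>i. pm (Anc i \<in> W)) \<eta> S"
      have "\<forall>i. pm (Anc i \<in> W) \<in> {1, -1}" by (simp add: pm_def)
      then have "?K \<in> ?X3" by blast
      moreover have "\<forall>\<eta>. ?P \<eta> \<longrightarrow> ?K \<eta> = G (F \<eta>)"
        unfolding F G using measured_sum by (intro allI impI ext) simp
      ultimately show "\<exists>K\<in>?X3. \<forall>\<eta>. ?P \<eta> \<longrightarrow> K \<eta> = G (F \<eta>)" by (rule bexI[of _ ?K, rotated])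
    qed simp
    fix F G assume "F \<in> ?X3" "G \<in> {\<lambda>(\<psi> :: state) S. \<psi> (site_flip l S)}"
    then obtain c s where F: "F = (\<lambda>\<eta> S. c * signed_sum l s \<eta> S)" and s: "\<forall>i. s i \<in> {1, -1}"
      and G: "G = (\<lambda>\<psi> S. \<psi> (site_flip l S))" by blast
    let ?K = "\<lambda>\<eta> S. c * layer_projection l s (\<lambda>S. \<eta> (vmap (l - 1) S)) (vmap l S)"
    have "?K \<in> ?X4" using s by blast
    moreover have "\<forall>\<eta>. ?P \<eta> \<longrightarrow> ?K \<eta> = G (F \<eta>)"
      unfolding F G using signed_sum_site_flip[OF l] by (intro allI impI ext) simp
    ultimately show "\<exists>K\<in>?X4. \<forall>\<eta>. ?P \<eta> \<longrightarrow> K \<eta> = G (F \<eta>)" by (rule bexI[of _ ?K, rotated])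
  qed simp
qed

lemma valid_layer_site_flip:
  assumes "l \<in> {1..n}" "phys_qubits N \<union> aux_qubits N n \<subseteq> R"
  shows "valid_layer R (map (\<lambda>i. Gate2 (Aux i l) (Phys i) CX_gate) [1..<Suc N])"
proof (intro valid_layer_Gate2 unitary_gates distinct_upt)
  have set: "set [1..<Suc N] = {1..N}" by auto
  have "(\<lambda>i. Aux i l) ` {1..N} \<subseteq> aux_qubits N n" "Phys ` {1..N} \<subseteq> phys_qubits N"
    using assms(1) by (auto simp: phys_qubits_def aux_qubits_def)
  then show "(\<lambda>i. Aux i l) ` set [1..<Suc N] \<subseteq> R" "Phys ` set [1..<Suc N] \<subseteq> R"
    unfolding set using assms(2) by blast+
qed (auto simp: inj_on_def)

lemma valid_layer_round:
  assumes l: "1 \<le> l" "l \<le> n" and m: "2 * N \<le> m"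
  shows "valid_circuit (phys_qubits N \<union> aux_qubits N n \<union> anc_qubits m) (layer_round K l)"
proof -
  let ?R = "phys_qubits N \<union> aux_qubits N n \<union> anc_qubits m"
  have A: "Aux i l' \<in> ?R" if "i \<in> {1..N}" "l' \<in> {1..n}" for i l' using that by (simp add: aux_qubits_def)
  have C: "Anc k \<in> ?R" if "k \<in> {1..2 * N}" for k using that m by (simp add: anc_qubits_def)
  have "l - 1 \<le> n" using l by simp
  then have "aux_qubits N (l - 1) \<subseteq> aux_qubits N n" by (rule aux_qubits_mono)
  moreover have "Anc ` {1..N} \<subseteq> ?R" using C by (intro image_subsetI) simp
  ultimately have reg: "register l \<subseteq> ?R" unfolding register_def by blast
  have srcN: "i \<in> {1..N}" if "i \<in> src l" for i using that src_subset[of l] by blast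
  have "Anc ` src l \<subseteq> register l" using image_mono[OF src_subset[of l], of Anc] unfolding register_def by blast
  then have anc: "set (map Anc (sources l)) \<subseteq> ?R" using reg by simp
  have 1: "valid_circuit ?R [\<lambda>r. map (\<lambda>q. Gate1 q H_gate) (map Anc (sources l))]"
    unfolding valid_circuit_def using valid_layer_Gate1[OF distinct_sources(2) anc unitary_gates(1)] by simp
  have 2: "valid_circuit ?R (concat (map (gadget_of l) (couplings K l)))"
  proof (rule valid_couplings[OF l(1)], intro Un_least reg)
    show "(\<lambda>i. Anc (N + i)) ` {1..N} \<subseteq> ?R" using C by (intro image_subsetI) simp
    show "(\<lambda>i. Aux i l) ` {1..N} \<subseteq> ?R" using A l by (intro image_subsetI) simp
  qed
  have 3: "valid_layer ?R (map (\<lambda>i. Gate2 (Anc i) (Aux i l) CX_gate) (sources l))"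
    using anc A srcN l by (intro valid_layer_Gate2 unitary_gates) (auto simp: inj_on_def)
  have tgtR: "Aux (tgt l i) l \<in> ?R" if "i \<in> src l" for i using A[OF tgt_in[OF that], of l] l by simp
  have 4: "valid_layer ?R (map (\<lambda>i. Gate2 (Anc i) (Aux (tgt l i) l) CX_gate) (sources l))"
    using anc tgtR tgt_inj[of l] by (intro valid_layer_Gate2 unitary_gates) (auto simp: inj_on_def)
  have 5: "valid_circuit ?R (X_measure (map Anc (sources l)) (\<lambda>_. []) (\<lambda>_. []))"
    by (rule valid_circuit_X_measure[OF distinct_sources(2) anc]) simp
  have "valid_layer ?R (map (\<lambda>i. Gate2 (Aux i l) (Phys i) CX_gate) [1..<Suc N])"
    using l by (intro valid_layer_site_flip[of l n]) auto
  then show ?thesis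
    unfolding layer_round_def valid_circuit_append using 1 2 3 4 5 by (simp add: valid_circuit_def)
qed

section \<open>All rounds and the return from the frame\<close>

definition layer_rounds :: "nat \<Rightarrow> nat \<Rightarrow> adaptive_circuit" where
  "layer_rounds K n = concat (map (layer_round K) [1..<Suc n])"

lemma layer_rounds_simps:
  "layer_rounds K 0 = []"
  "layer_rounds K (Suc n) = layer_rounds K n @ layer_round K (Suc n)"
  by (simp_all add: layer_rounds_def)

lemma length_layer_rounds: "length (layer_rounds K n) = n * (39 + 10 * K)"
  by (induction n) (simp_all add: layer_rounds_simps length_layer_round)

lemma layer_projection_scale:
  "layer_projection l s (\<lambda>S. c * \<psi> S) = (\<lambda>S. c * layer_projection l s \<psi> S)"
  unfolding layer_projection_def edge_product_def sum_distrib_left by (simp only: mult_ac)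

lemma code_state_cong:
  "(\<And>l. l \<le> n \<Longrightarrow> s l = s' l) \<Longrightarrow> code_state s n \<psi> = code_state s' n \<psi>"
  by (induction n) simp_all

lemma realizes_layer_rounds:
  assumes K: "N < 2 ^ K"
  shows "realizes (state_of (phys_qubits N)) (layer_rounds K n)
    {\<lambda>\<phi> S. c * code_state s n \<phi> (vmap n S) | c s. \<forall>l i. s l i \<in> {1, -1}}"
proof (induction n)
  case 0
  show ?case unfolding layer_rounds_simps
  proof (rule realizes_mono[OF realizes_Nil])
    fix F assume F: "F \<in> {\<lambda>\<psi> :: state. \<psi>}"
    let ?G = "\<lambda>\<phi> S. 1 * code_state (\<lambda>_ _. 1) 0 \<phi> (vmap 0 S)"
    have "?G \<in> {\<lambda>\<phi> S. c * code_state s 0 \<phi> (vmap 0 S) | c s. \<forall>l i. s l i \<in> {1, -1}}" by blast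
    moreover have "\<forall>\<psi>. state_of (phys_qubits N) \<psi> \<longrightarrow> F \<psi> = ?G \<psi>" using F by simp
    ultimately show "\<exists>G\<in>{\<lambda>\<phi> S. c * code_state s 0 \<phi> (vmap 0 S) | c s. \<forall>l i. s l i \<in> {1, -1}}.
        \<forall>\<psi>. state_of (phys_qubits N) \<psi> \<longrightarrow> F \<psi> = G \<psi>" by (rule bexI[of _ ?G, rotated])
  qed
next
  case (Suc n)
  let ?X = "\<lambda>n. {\<lambda>\<phi> S. c * code_state s n \<phi> (vmap n S) | c s. \<forall>l i. s l i \<in> {1, -1}}"
  have n: "1 \<le> Suc n" by simp
  show ?case unfolding layer_rounds_simps
  proof (rule realizes_append[OF Suc realizes_layer_round[OF n K]])
    fix F \<phi> assume "F \<in> ?X n" and \<phi>: "state_of (phys_qubits N) \<phi>"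
    then obtain c s where "F = (\<lambda>\<phi> S. c * code_state s n \<phi> (vmap n S))" by blast
    then show "state_of (phys_qubits N \<union> aux_qubits N (Suc n - 1)) (F \<phi>)"
      using state_of_scale[OF state_of_vmap[OF state_of_code_state[OF \<phi>]], where c = "\<lambda>_. c"] by simp
  next
    fix F G assume "F \<in> ?X n" and "G \<in> {\<lambda>\<eta> S. c * layer_projection (Suc n) s
      (\<lambda>S. \<eta> (vmap (Suc n - 1) S)) (vmap (Suc n) S) | c s. \<forall>i. s i \<in> {1, -1}}"
    then obtain c s d t where F: "F = (\<lambda>\<phi> S. c * code_state s n \<phi> (vmap n S))" and s: "\<forall>l i. s l i \<in> {1, -1}"
      and G: "G = (\<lambda>\<eta> S. d * layer_projection (Suc n) t (\<lambda>S. \<eta> (vmap (Suc n - 1) S)) (vmap (Suc n) S))"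
      and t: "\<forall>i. t i \<in> {1, -1}" by blast
    \<comment> \<open>The signs of the new round extend those of the earlier rounds, whose code
      state only sees layers up to \<open>n\<close>.\<close>
    define s' where "s' = s(Suc n := t)"
    have s': "\<forall>l i. s' l i \<in> {1, -1}" using s t by (simp add: s'_def)
    have eq: "code_state s n \<phi> = code_state s' n \<phi>" for \<phi> by (rule code_state_cong) (simp add: s'_def)
    let ?K = "\<lambda>\<phi> S. (d * c) * code_state s' (Suc n) \<phi> (vmap (Suc n) S)"
    have "?K \<in> ?X (Suc n)" using s' by blast
    moreover have "\<forall>\<phi>. state_of (phys_qubits N) \<phi> \<longrightarrow> ?K \<phi> = G (F \<phi>)"
      unfolding F G eq by (simp add: layer_projection_scale s'_def mult.assoc)
    ultimately show "\<exists>K\<in>?X (Suc n). \<forall>\<phi>. state_of (phys_qubits N) \<phi> \<longrightarrow> K \<phi> = G (F \<phi>)"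
      by (rule bexI[of _ ?K, rotated])
  qed
qed

text \<open>One layer of controlled flips for each auxiliary layer composes to
  \<open>vmap n\<close>, which is its own inverse and so removes the frame left by the
  rounds.\<close>

definition unwind :: "nat \<Rightarrow> adaptive_circuit" where
  "unwind n = map (\<lambda>l r. map (\<lambda>i. Gate2 (Aux i l) (Phys i) CX_gate) [1..<Suc N]) [1..<Suc n]"

lemma unwind_simps:
  "unwind 0 = []"
  "unwind (Suc n) = unwind n @ [\<lambda>r. map (\<lambda>i. Gate2 (Aux i (Suc n)) (Phys i) CX_gate) [1..<Suc N]]"
  by (simp_all add: unwind_def)

lemma length_unwind: "length (unwind n) = n"
  by (simp add: unwind_def)

lemma realizes_unwind:
  "realizes (state_of (phys_qubits N \<union> aux_qubits N n')) (unwind n) {\<lambda>\<psi> S. \<psi> (vmap n S)}"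
proof (induction n)
  case 0
  show ?case unfolding unwind_simps by (simp add: realizes_Nil)
next
  case (Suc n)
  have last: "realizes (\<lambda>_. True) [\<lambda>r. map (\<lambda>i. Gate2 (Aux i (Suc n)) (Phys i) CX_gate) [1..<Suc N]]
      {\<lambda>\<psi> S. \<psi> (site_flip (Suc n) S)}"
    by (rule realizes_singleton)
      (simp only: circuit_branches.simps fst_conv layer_CX_site_flip UN_insert UN_empty Un_empty_right)
  have eq: "\<psi> (vmap (Suc n) S) = \<psi> (vmap n (site_flip (Suc n) S))"
    if \<psi>: "state_of (phys_qubits N \<union> aux_qubits N n') \<psi>" for \<psi> S
  proof (cases "\<exists>i. Aux i (Suc n) \<in> S \<and> i \<notin> {1..N}")
    case True
    then obtain i where i: "Aux i (Suc n) \<in> S" "i \<notin> {1..N}" by blast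
    then have "Aux i (Suc n) \<notin> phys_qubits N \<union> aux_qubits N n'" by (auto simp: phys_qubits_def aux_qubits_def)
    moreover have "Aux i (Suc n) \<in> vmap (Suc n) S" "Aux i (Suc n) \<in> vmap n (site_flip (Suc n) S)"
      using i(1) by (auto simp: site_flip_def)
    ultimately have "\<not> vmap (Suc n) S \<subseteq> phys_qubits N \<union> aux_qubits N n'"
      "\<not> vmap n (site_flip (Suc n) S) \<subseteq> phys_qubits N \<union> aux_qubits N n'" by blast+
    then show ?thesis using \<psi> unfolding state_of_def by metis
  next
    case False
    then show ?thesis using vmap_site_flip[of n S] by auto
  qed
  show ?case unfolding unwind_simps
    by (rule realizes_append[OF Suc last]) (use eq in auto)
qed

lemma realizes_preparation:
  assumes K: "N < 2 ^ K"
  shows "realizes (state_of (phys_qubits N)) (layer_rounds K n @ unwind n)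
    {\<lambda>\<phi> S. c * code_state s n \<phi> S | c s. \<forall>l i. s l i \<in> {1, -1}}"
proof (rule realizes_append[OF realizes_layer_rounds[OF K] realizes_unwind[of n n]])
  let ?X = "{\<lambda>\<phi> S. c * code_state s n \<phi> (vmap n S) | c s. \<forall>l i. s l i \<in> {1, -1}}"
  let ?Y = "{\<lambda>\<phi> S. c * code_state s n \<phi> S | c s. \<forall>l i. s l i \<in> {1, -1}}"
  fix F assume "F \<in> ?X"
  then obtain c s where F: "F = (\<lambda>\<phi> S. c * code_state s n \<phi> (vmap n S))" and s: "\<forall>l i. s l i \<in> {1, -1}" by blast
  show "state_of (phys_qubits N \<union> aux_qubits N n) (F \<phi>)" if \<phi>: "state_of (phys_qubits N) \<phi>" for \<phi>
    unfolding F using state_of_scale[OF state_of_vmap[OF state_of_code_state[OF \<phi>]], where c = "\<lambda>_. c"] by simp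
  fix G assume "G \<in> {\<lambda>\<psi> :: state. \<lambda>S. \<psi> (vmap n S)}"
  then have G: "G = (\<lambda>\<psi> S. \<psi> (vmap n S))" by simp
  let ?K = "\<lambda>\<phi> S. c * code_state s n \<phi> S"
  have "?K \<in> ?Y" using s by blast
  moreover have "\<forall>\<phi>. state_of (phys_qubits N) \<phi> \<longrightarrow> ?K \<phi> = G (F \<phi>)" unfolding F G by simp
  ultimately show "\<exists>K\<in>?Y. \<forall>\<phi>. state_of (phys_qubits N) \<phi> \<longrightarrow> K \<phi> = G (F \<phi>)" by (rule bexI[of _ ?K, rotated])
qed

lemma valid_preparation:
  assumes m: "2 * N \<le> m"
  shows "valid_circuit (phys_qubits N \<union> aux_qubits N n \<union> anc_qubits m) (layer_rounds K n @ unwind n)"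
proof -
  let ?R = "phys_qubits N \<union> aux_qubits N n \<union> anc_qubits m"
  have "valid_circuit ?R (layer_round K l)" if "l \<in> set [1..<Suc n]" for l
    using that by (intro valid_layer_round m) auto
  then have 1: "valid_circuit ?R (layer_rounds K n)" by (auto simp: layer_rounds_def valid_circuit_def)
  have "valid_layer ?R (map (\<lambda>i. Gate2 (Aux i l) (Phys i) CX_gate) [1..<Suc N])" if "l \<in> {1..n}" for l
    using that by (rule valid_layer_site_flip) blast
  then have "valid_circuit ?R (unwind n)" by (auto simp: unwind_def valid_circuit_def simp del: upt_Suc)
  with 1 show ?thesis by (simp add: valid_circuit_append)
qed

end

section \<open>Normalization, the product form of the output and the constants\<close>

lemma exists_power_two_bound:
  fixes N :: nat
  obtains K where "N < 2 ^ K" "real K \<le> 2 * log_ge1 (real N)"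
proof (cases "N = 0")
  case True
  show ?thesis by (rule that[of 0]) (simp_all add: True log_ge1_def)
next
  case False
  \<comment> \<open>This is the number of binary digits of \<open>N\<close>; it is at most
    \<open>log 2 N + 1\<close>, hence at most twice \<open>log_ge1 N\<close>.\<close>
  define K where "K = nat \<lfloor>log 2 (real N)\<rfloor> + 1"
  have nn: "0 \<le> log 2 (real N)" using False by simp
  then have K: "real K = of_int \<lfloor>log 2 (real N)\<rfloor> + 1" by (simp add: K_def)
  have "log 2 (real N) < real K" unfolding K by linarith
  then have "real N < 2 powr real K" using False by (simp add: log_less_iff)
  then have "real N < 2 ^ K" by (simp add: powr_realpow)
  then have "N < 2 ^ K" by (metis of_nat_less_numeral_power_cancel_iff)
  moreover have "real K \<le> log 2 (real N) + 1" unfolding K by linarith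
  then have "real K \<le> 2 * log_ge1 (real N)" unfolding log_ge1_def by linarith
  ultimately show ?thesis by (rule that)
qed

definition vacuum :: state where
  "vacuum = (\<lambda>S. if S = {} then 1 else 0)"

lemma fermionic_product_vacuum:
  assumes "state_of (phys_qubits N) \<phi>"
  shows "fermionic_product N \<nu> \<phi> vacuum = \<phi>"
proof
  fix S
  show "fermionic_product N \<nu> \<phi> vacuum S = \<phi> S"
  proof (cases "S \<subseteq> phys_qubits N")
    case True
    then have "S \<inter> phys_qubits N = S" "S \<inter> aux_qubits N \<nu> = {}" "S \<subseteq> phys_qubits N \<union> aux_qubits N \<nu>"
      by (auto simp: phys_qubits_def aux_qubits_def)
    then show ?thesis by (simp add: fermionic_product_def vacuum_def jw_sign_def)
  next
    case False
    then have "\<phi> S = 0" using assms by (auto simp: state_of_def)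
    moreover have "fermionic_product N \<nu> \<phi> vacuum S = 0"
    proof (cases "S \<subseteq> phys_qubits N \<union> aux_qubits N \<nu>")
      case True
      then have "S \<inter> aux_qubits N \<nu> \<noteq> {}" using False by blast
      then show ?thesis by (simp add: fermionic_product_def vacuum_def)
    qed (simp add: fermionic_product_def)
    ultimately show ?thesis by simp
  qed
qed

lemma normalize_state:
  assumes "state_of R \<psi>" "finite R" "\<psi> S \<noteq> 0"
  defines "n \<equiv> sqrt (\<Sum>S\<in>Pow R. (cmod (\<psi> S))\<^sup>2)"
  shows "n \<noteq> 0" "unit_state_of R (\<lambda>S. \<psi> S / complex_of_real n)"
proof -
  have S: "S \<in> Pow R" using assms(1,3) by (auto simp: state_of_def)
  have "0 < (cmod (\<psi> S))\<^sup>2" using assms(3) by simp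
  also have "\<dots> \<le> (\<Sum>S\<in>Pow R. (cmod (\<psi> S))\<^sup>2)"
    using S assms(2) by (intro member_le_sum) auto
  finally have pos: "0 < (\<Sum>S\<in>Pow R. (cmod (\<psi> S))\<^sup>2)" .
  then show "n \<noteq> 0" by (simp add: n_def)
  have n2: "n\<^sup>2 = (\<Sum>S\<in>Pow R. (cmod (\<psi> S))\<^sup>2)" using pos by (simp add: n_def)
  have "(\<Sum>S\<in>Pow R. (cmod (\<psi> S / complex_of_real n))\<^sup>2) = (\<Sum>S\<in>Pow R. (cmod (\<psi> S))\<^sup>2 / n\<^sup>2)"
    by (simp add: norm_divide power_divide)
  also have "\<dots> = 1" unfolding sum_divide_distrib[symmetric] n2 using pos by simp
  finally show "unit_state_of R (\<lambda>S. \<psi> S / complex_of_real n)"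
    using assms(1) by (simp add: unit_state_of_def state_of_def)
qed

text \<open>Since all ancillas end in state 0, the scalar of a branch can be moved into their
  factor.\<close>

lemma tensor_state_vacuum:
  assumes "state_of R \<psi>" "R \<inter> R' = {}"
  shows "tensor_state R R' \<psi> (\<lambda>S. if S = {} then c else 0) = (\<lambda>S. c * \<psi> S)"
proof
  fix S
  show "tensor_state R R' \<psi> (\<lambda>S. if S = {} then c else 0) S = c * \<psi> S"
  proof (cases "S \<subseteq> R")
    case True
    then have "S \<inter> R = S" "S \<inter> R' = {}" "S \<subseteq> R \<union> R'" using assms(2) by auto
    then show ?thesis by (simp add: tensor_state_def)
  next
    case False
    then have "\<psi> S = 0" using assms(1) by (auto simp: state_of_def)
    moreover have "S \<subseteq> R \<union> R' \<Longrightarrow> S \<inter> R' \<noteq> {}" using False by blast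
    ultimately show ?thesis by (simp add: tensor_state_def)
  qed
qed

text \<open>Choice over the records fixes the scalar and the signs independently of \<phi>, which
  gives one \<Psi> per record. The resulting operator sends \<phi> to a multiple of the fermionic
  product of \<phi> with the projected vacuum \<open>G r\<close>.\<close>

lemma (in edge_layers) prepared_state:
  assumes K: "N < 2 ^ K"
  shows "\<exists>(s :: bool list \<Rightarrow> nat \<Rightarrow> nat \<Rightarrow> complex) \<Psi>. (\<forall>r l i. s r l i \<in> {1, -1}) \<and>
    (\<forall>\<phi> r \<xi>. state_of (phys_qubits N) \<phi> \<longrightarrow>
       (r, \<xi>) \<in> circuit_branches (layer_rounds K \<nu> @ unwind \<nu>) ([], \<phi>) \<longrightarrow> (\<exists>S. \<xi> S \<noteq> 0) \<longrightarrow>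
       unit_state_of (aux_qubits N \<nu>) (\<Psi> r) \<and>
       (\<exists>c. \<xi> = (\<lambda>S. c * fermionic_product N \<nu> \<phi> (\<Psi> r) S)) \<and>
       (\<forall>l\<in>{1..\<nu>}. \<forall>i\<in>src l. (\<lambda>S. s r l i * stabilizer l i (tgt l i) (\<Psi> r) S) = \<Psi> r))"
proof -
  let ?circ = "layer_rounds K \<nu> @ unwind \<nu>"
  have realized: "\<exists>F\<in>{\<lambda>\<phi> S. c * code_state s \<nu> \<phi> S | c s. \<forall>l i. s l i \<in> {1, -1}}.
      \<forall>\<phi> \<xi>. state_of (phys_qubits N) \<phi> \<and> (r, \<xi>) \<in> circuit_branches ?circ ([], \<phi>) \<longrightarrow> \<xi> = F \<phi>" for r
    by (rule allE[OF allE[OF conjunct2[OF realizes_preparation[OF K, of \<nu>, unfolded realizes_def]]]])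
  define Q where "Q r c s \<longleftrightarrow> (\<forall>l i. s l i \<in> {1, -1}) \<and> (\<forall>\<phi> \<xi>. state_of (phys_qubits N) \<phi> \<and>
      (r, \<xi>) \<in> circuit_branches ?circ ([], \<phi>) \<longrightarrow> \<xi> = (\<lambda>S. c * code_state s \<nu> \<phi> S))" for r c s
  have "\<exists>c s. Q r c s" for r
  proof -
    obtain F where F: "F \<in> {\<lambda>\<phi> S. c * code_state s \<nu> \<phi> S | c s. \<forall>l i. s l i \<in> {1, -1}}"
      "\<forall>\<phi> \<xi>. state_of (phys_qubits N) \<phi> \<and> (r, \<xi>) \<in> circuit_branches ?circ ([], \<phi>) \<longrightarrow> \<xi> = F \<phi>"
      using realized[of r] by (rule bexE)
    from F(1) obtain c s where cs: "F = (\<lambda>\<phi> S. c * code_state s \<nu> \<phi> S)" "\<forall>l i. s l i \<in> {1, -1}" by blast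
    have "Q r c s" unfolding Q_def using cs(2) F(2)[unfolded cs(1)] by (rule conjI)
    then show ?thesis by (intro exI)
  qed
  then have "\<forall>r. \<exists>c. \<exists>s. Q r c s" by (rule allI)
  from choice[OF this] obtain c where "\<forall>r. \<exists>s. Q r (c r) s" by (elim exE)
  from choice[OF this] obtain s where Q: "\<forall>r. Q r (c r) (s r)" by (elim exE)
  have s: "s r l i \<in> {1, -1}" for r l i using Q unfolding Q_def by meson
  have \<xi>: "\<xi> = (\<lambda>S. c r * code_state (s r) \<nu> \<phi> S)" if "state_of (phys_qubits N) \<phi>"
    "(r, \<xi>) \<in> circuit_branches ?circ ([], \<phi>)" for r \<phi> \<xi>
    using Q that unfolding Q_def by meson
  define G where "G r = code_state (s r) \<nu> vacuum" for r
  define n where "n r = sqrt (\<Sum>S\<in>Pow (aux_qubits N \<nu>). (cmod (G r S))\<^sup>2)" for r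
  define \<Psi> where "\<Psi> r = (\<lambda>S. G r S / complex_of_real (n r))" for r
  have vac: "state_of {} vacuum" by (simp add: state_of_def vacuum_def)
  have G: "state_of (aux_qubits N \<nu>) (G r)" for r
    using state_of_code_state[OF vac, of \<nu> "s r"] by (simp add: G_def)
  have "unit_state_of (aux_qubits N \<nu>) (\<Psi> r) \<and>
       (\<exists>c. \<xi> = (\<lambda>S. c * fermionic_product N \<nu> \<phi> (\<Psi> r) S)) \<and>
       (\<forall>l\<in>{1..\<nu>}. \<forall>i\<in>src l. (\<lambda>S. s r l i * stabilizer l i (tgt l i) (\<Psi> r) S) = \<Psi> r)"
    if \<phi>: "state_of (phys_qubits N) \<phi>" and br: "(r, \<xi>) \<in> circuit_branches ?circ ([], \<phi>)" and nz: "\<exists>S. \<xi> S \<noteq> 0"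
    for \<phi> r \<xi>
  proof -
    have "code_state (s r) \<nu> \<phi> = fermionic_product N \<nu> \<phi> (G r)"
      unfolding G_def code_state_fermionic_product[OF order_refl vac, symmetric] fermionic_product_vacuum[OF \<phi>] ..
    then have \<xi>': "\<xi> = (\<lambda>S. c r * fermionic_product N \<nu> \<phi> (G r) S)" using \<xi>[OF \<phi> br] by simp
    obtain S where "\<xi> S \<noteq> 0" using nz by blast
    \<comment> \<open>A nonzero amplitude of the branch contains a nonzero amplitude of
      \<open>G r\<close> as a factor, so for records that occur \<open>G r\<close> can be
      normalized.\<close>
    then have "G r (S \<inter> aux_qubits N \<nu>) \<noteq> 0"
      unfolding \<xi>' fermionic_product_def by (auto split: if_splits)
    from normalize_state[OF G finite_mode_qubits(2) this]
    have n: "n r \<noteq> 0" and unit: "unit_state_of (aux_qubits N \<nu>) (\<Psi> r)"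
      unfolding n_def[symmetric] \<Psi>_def by auto
    have "\<xi> = (\<lambda>S. (c r * complex_of_real (n r)) * fermionic_product N \<nu> \<phi> (\<Psi> r) S)"
      unfolding \<xi>' \<Psi>_def fermionic_product_def using n by auto
    moreover have "(\<lambda>S. s r l i * stabilizer l i (tgt l i) (\<Psi> r) S) = \<Psi> r" if "l \<in> {1..\<nu>}" "i \<in> src l" for l i
    proof -
      have sq: "s r l i * s r l i = 1" using s[of r l i] by auto
      have "stabilizer l i (tgt l i) (G r) = (\<lambda>S. s r l i * G r S)"
        unfolding G_def using that sq vac by (intro stabilizer_code_state[where Q = "{}"]) auto
      then have "stabilizer l i (tgt l i) (\<lambda>S. (1 / complex_of_real (n r)) * G r S) =
          (\<lambda>S. (1 / complex_of_real (n r)) * (s r l i * G r S))"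
        unfolding stabilizer_scale by simp
      then have "stabilizer l i (tgt l i) (\<Psi> r) = (\<lambda>S. s r l i * \<Psi> r S)"
        unfolding \<Psi>_def by (simp add: mult_ac)
      then show ?thesis using sq by (simp flip: mult.assoc)
    qed
    ultimately show ?thesis using unit by blast
  qed
  with s show ?thesis by (intro exI[of _ s] exI[of _ \<Psi>] conjI allI impI) simp_all
qed

theorem mainTheorem3:
  shows "\<exists>C::real. \<forall>(N::nat) (E::nat set set) (k::nat) (\<nu>::nat) (col::nat set \<Rightarrow> nat)
           (D::(nat \<times> nat) set).
    simple_graph {1..N} E \<and> k = chromatic_index E \<and> k \<ge> 1 \<and>
    proper_edge_coloring E k col \<and> \<nu> = nat \<lceil>real k / 2\<rceil> \<and>
    orientation E D \<and>
    (\<forall>l\<in>{1..\<nu>}. at_most_one_out_in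
       {(i, j) \<in> D. {i, j} \<in> color_class E col (2 * l - 1) \<union> color_class E col (2 * l)})
    \<longrightarrow>
    (\<exists>(m::nat) (circ::adaptive_circuit) (s::bool list \<Rightarrow> nat \<times> nat \<Rightarrow> complex)
       (\<Psi>::bool list \<Rightarrow> state).
       \<nu> * N + m = (2 * \<nu> + 1) * N \<and>
       valid_circuit (phys_qubits N \<union> aux_qubits N \<nu> \<union> anc_qubits m) circ \<and>
       real (circuit_depth circ) \<le> C * (k * log_ge1 k + k * log_ge1 N) \<and>
       (\<forall>r. \<forall>a\<in>D. s r a \<in> {1, -1}) \<and>
       (\<forall>\<phi> r \<xi>. unit_state_of (phys_qubits N) \<phi> \<and>
          (r, \<xi>) \<in> circuit_branches circ ([], \<phi>) \<and> (\<exists>S. \<xi> S \<noteq> 0) \<longrightarrow>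
          unit_state_of (aux_qubits N \<nu>) (\<Psi> r) \<and>
          (\<exists>\<alpha>. state_of (anc_qubits m) \<alpha> \<and>
             \<xi> = tensor_state (phys_qubits N \<union> aux_qubits N \<nu>) (anc_qubits m)
                   (fermionic_product N \<nu> \<phi> (\<Psi> r)) \<alpha>) \<and>
          (\<forall>l\<in>{1..\<nu>}. \<forall>(i, j)\<in>D.
             {i, j} \<in> color_class E col (2 * l - 1) \<union> color_class E col (2 * l) \<longrightarrow>
             (\<lambda>S. s r (i, j) * stabilizer l i j (\<Psi> r) S) = \<Psi> r)))"
proof (rule exI[of _ 60], intro allI impI, elim conjE)
  fix N k \<nu> :: nat and E :: "nat set set" and col :: "nat set \<Rightarrow> nat" and D :: "(nat \<times> nat) set"
  assume graph: "simple_graph {1..N} E" and k1: "k \<ge> 1" and \<nu>: "\<nu> = nat \<lceil>real k / 2\<rceil>"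
    and orient: "orientation E D"
    and inout: "\<forall>l\<in>{1..\<nu>}. at_most_one_out_in
       {(i, j) \<in> D. {i, j} \<in> color_class E col (2 * l - 1) \<union> color_class E col (2 * l)}"
  define EE where "EE l = {(i, j) \<in> D. {i, j} \<in> color_class E col (2 * l - 1) \<union> color_class E col (2 * l)}" for l
  \<comment> \<open>\<open>edge_layers\<close> speaks of every natural number \<open>l\<close>, so
    the layers outside 1 to \<nu>, about which the hypotheses say nothing, are made empty.\<close>
  define DD where "DD l = (if l \<in> {1..\<nu>} then EE l else {})" for l
  have EE_D: "EE l \<subseteq> D" for l unfolding EE_def by blast
  have DD_EE: "DD l \<subseteq> EE l" for l unfolding DD_def by (rule subsetI) (simp split: if_splits)
  define src where "src l = {i. \<exists>j. (i, j) \<in> DD l}" for l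
  define tgt where "tgt l i = (SOME j. (i, j) \<in> DD l)" for l i
  have amo: "at_most_one_out_in (DD l)" for l
  proof (cases "l \<in> {1..\<nu>}")
    case True
    then show ?thesis using bspec[OF inout True] unfolding DD_def EE_def[symmetric] by (simp only: if_True)
  next
    case False
    then show ?thesis unfolding DD_def by (simp only: if_False) (simp add: at_most_one_out_in_def)
  qed
  have tgt: "tgt l i = j" if "(i, j) \<in> DD l" for l i j
  proof -
    have "(i, tgt l i) \<in> DD l" unfolding tgt_def using that by (rule someI)
    then show ?thesis using amo[of l] that unfolding at_most_one_out_in_def by metis
  qed
  have edge: "i \<in> {1..N} \<and> j \<in> {1..N} \<and> i \<noteq> j" if "(i, j) \<in> DD l" for l i j
  proof -
    have "(i, j) \<in> D" using that EE_D DD_EE by blast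
    moreover have "\<forall>(i, j)\<in>D. {i, j} \<in> E" using orient unfolding orientation_def by (rule conjunct1)
    ultimately have "{i, j} \<in> E" by fast
    moreover have "\<forall>e\<in>E. e \<subseteq> {1..N} \<and> card e = 2" using graph unfolding simple_graph_def by (rule conjunct2)
    ultimately have e: "{i, j} \<subseteq> {1..N} \<and> card {i, j} = 2" by (rule bspec[rotated])
    then have "i \<noteq> j" by auto
    then show ?thesis using e by simp
  qed
  have src: "(i, tgt l i) \<in> DD l" if "i \<in> src l" for l i
    using that unfolding src_def tgt_def by (auto intro: someI)
  interpret edge_layers N src tgt
  proof
    show "src l \<subseteq> {1..N}" for l using edge[OF src] by (intro subsetI) blast
    show "tgt l i \<in> {1..N}" "tgt l i \<noteq> i" if "i \<in> src l" for i l
      using edge[OF src[OF that]] by simp_all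
    show "inj_on (tgt l) (src l)" for l
    proof (rule inj_onI)
      fix i i' assume i: "i \<in> src l" "i' \<in> src l" "tgt l i = tgt l i'"
      then show "i = i'"
        using amo[of l] src[OF i(1)] src[OF i(2)] unfolding at_most_one_out_in_def by metis
    qed
  qed
  obtain K where K: "N < 2 ^ K" "real K \<le> 2 * log_ge1 (real N)" by (rule exists_power_two_bound)
  let ?circ = "layer_rounds K \<nu> @ unwind \<nu>"
  obtain s \<Psi> where s: "\<forall>r l i. s r l i \<in> {1, -1}" and prep: "\<And>\<phi> r \<xi>. state_of (phys_qubits N) \<phi> \<Longrightarrow>
       (r, \<xi>) \<in> circuit_branches ?circ ([], \<phi>) \<Longrightarrow> (\<exists>S. \<xi> S \<noteq> 0) \<Longrightarrow>
       unit_state_of (aux_qubits N \<nu>) (\<Psi> r) \<and>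
       (\<exists>c. \<xi> = (\<lambda>S. c * fermionic_product N \<nu> \<phi> (\<Psi> r) S)) \<and>
       (\<forall>l\<in>{1..\<nu>}. \<forall>i\<in>src l. (\<lambda>S. s r l i * stabilizer l i (tgt l i) (\<Psi> r) S) = \<Psi> r)"
    using prepared_state[OF K(1), of \<nu>] by blast
  \<comment> \<open>The prescribed total minus the \<nu> * N auxiliary qubits; a round occupies 2 *
    N ancillas, and these are available because \<nu> is at least 1.\<close>
  define m where "m = (\<nu> + 1) * N"
  \<comment> \<open>Layer \<open>l\<close> has the colors 2 * l - 1 and 2 * l, so this quotient
    recovers the layer of an edge from its color.\<close>
  define sg where "sg = (\<lambda>r (i, j). s r ((col {i, j} + 1) div 2) i)"
  have \<nu>1: "1 \<le> \<nu>" and \<nu>k: "\<nu> \<le> k" unfolding \<nu> using k1 by linarith+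
  have "\<nu> * N + m = (2 * \<nu> + 1) * N" by (simp add: m_def algebra_simps)
  moreover have "valid_circuit (phys_qubits N \<union> aux_qubits N \<nu> \<union> anc_qubits m) ?circ"
    using \<nu>1 by (intro valid_preparation) (simp add: m_def)
  moreover have "real (circuit_depth ?circ) \<le> 60 * (k * log_ge1 k + k * log_ge1 N)"
  proof -
    have L: "1 \<le> log_ge1 x" for x by (simp add: log_ge1_def)
    \<comment> \<open>A round has depth 39 + 10 * K, and its frame costs one more layer to remove.
      With \<open>K\<close> at most twice \<open>log_ge1 N\<close> and \<open>log_ge1 N\<close> at
      least 1, each layer costs at most 40 + 20 = 60 times \<open>log_ge1 N\<close>; this is the
      constant.\<close>
    have "real (circuit_depth ?circ) = real \<nu> * (40 + 10 * real K)"
      by (simp add: circuit_depth_def length_layer_rounds length_unwind algebra_simps)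
    also have "\<dots> \<le> real k * (60 * log_ge1 N)"
      using \<nu>k K(2) L[of "real N"] by (intro mult_mono) auto
    also have "\<dots> \<le> 60 * (k * log_ge1 k + k * log_ge1 N)"
      using L[of "real k"] by simp
    finally show ?thesis .
  qed
  moreover have "\<forall>r. \<forall>a\<in>D. sg r a \<in> {1, -1}" using s by (auto simp: sg_def)
  moreover have "\<forall>\<phi> r \<xi>. unit_state_of (phys_qubits N) \<phi> \<and>
      (r, \<xi>) \<in> circuit_branches ?circ ([], \<phi>) \<and> (\<exists>S. \<xi> S \<noteq> 0) \<longrightarrow>
      unit_state_of (aux_qubits N \<nu>) (\<Psi> r) \<and>
      (\<exists>\<alpha>. state_of (anc_qubits m) \<alpha> \<and>
         \<xi> = tensor_state (phys_qubits N \<union> aux_qubits N \<nu>) (anc_qubits m)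
               (fermionic_product N \<nu> \<phi> (\<Psi> r)) \<alpha>) \<and>
      (\<forall>l\<in>{1..\<nu>}. \<forall>(i, j)\<in>D.
         {i, j} \<in> color_class E col (2 * l - 1) \<union> color_class E col (2 * l) \<longrightarrow>
         (\<lambda>S. sg r (i, j) * stabilizer l i j (\<Psi> r) S) = \<Psi> r)"
  proof (intro allI impI, elim conjE)
    fix \<phi> r \<xi> assume \<phi>: "unit_state_of (phys_qubits N) \<phi>"
      and br: "(r, \<xi>) \<in> circuit_branches ?circ ([], \<phi>)" and nz: "\<exists>S. \<xi> S \<noteq> 0"
    have "state_of (phys_qubits N) \<phi>" using \<phi> by (simp add: unit_state_of_def)
    from prep[OF this br nz] obtain c where unit: "unit_state_of (aux_qubits N \<nu>) (\<Psi> r)"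
      and \<xi>: "\<xi> = (\<lambda>S. c * fermionic_product N \<nu> \<phi> (\<Psi> r) S)"
      and stab: "\<And>l i. l \<in> {1..\<nu>} \<Longrightarrow> i \<in> src l \<Longrightarrow>
        (\<lambda>S. s r l i * stabilizer l i (tgt l i) (\<Psi> r) S) = \<Psi> r" by blast
    \<comment> \<open>The witness for \<alpha> is the reset ancilla state scaled by
      \<open>c\<close>, which carries the norm and the phase of the branch.\<close>
    have "\<xi> = tensor_state (phys_qubits N \<union> aux_qubits N \<nu>) (anc_qubits m)
               (fermionic_product N \<nu> \<phi> (\<Psi> r)) (\<lambda>S. if S = {} then c else 0)"
      unfolding \<xi> by (subst tensor_state_vacuum)
        (auto simp: state_of_def fermionic_product_def phys_qubits_def aux_qubits_def anc_qubits_def)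
    moreover have "state_of (anc_qubits m) (\<lambda>S. if S = {} then c else 0)" by (simp add: state_of_def)
    moreover have "(\<lambda>S. sg r (i, j) * stabilizer l i j (\<Psi> r) S) = \<Psi> r"
      if "l \<in> {1..\<nu>}" "(i, j) \<in> D" "{i, j} \<in> color_class E col (2 * l - 1) \<union> color_class E col (2 * l)" for l i j
    proof -
      have "(i, j) \<in> EE l" unfolding EE_def using that(2,3) by blast
      then have ij: "(i, j) \<in> DD l" using that(1) by (simp add: DD_def)
      have "col {i, j} = 2 * l - 1 \<or> col {i, j} = 2 * l" using that(3) by (auto simp: color_class_def)
      then have "(col {i, j} + 1) div 2 = l" using that(1) by auto
      then show ?thesis using stab[OF that(1), of i] tgt[OF ij] ij by (auto simp: sg_def src_def)
    qed
    ultimately show "unit_state_of (aux_qubits N \<nu>) (\<Psi> r) \<and>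
      (\<exists>\<alpha>. state_of (anc_qubits m) \<alpha> \<and>
         \<xi> = tensor_state (phys_qubits N \<union> aux_qubits N \<nu>) (anc_qubits m)
               (fermionic_product N \<nu> \<phi> (\<Psi> r)) \<alpha>) \<and>
      (\<forall>l\<in>{1..\<nu>}. \<forall>(i, j)\<in>D.
         {i, j} \<in> color_class E col (2 * l - 1) \<union> color_class E col (2 * l) \<longrightarrow>
         (\<lambda>S. sg r (i, j) * stabilizer l i j (\<Psi> r) S) = \<Psi> r)"
      using unit by blast
  qed
  ultimately show "\<exists>(m::nat) (circ::adaptive_circuit) (s::bool list \<Rightarrow> nat \<times> nat \<Rightarrow> complex)
       (\<Psi>::bool list \<Rightarrow> state).
       \<nu> * N + m = (2 * \<nu> + 1) * N \<and>
       valid_circuit (phys_qubits N \<union> aux_qubits N \<nu> \<union> anc_qubits m) circ \<and>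
       real (circuit_depth circ) \<le> 60 * (k * log_ge1 k + k * log_ge1 N) \<and>
       (\<forall>r. \<forall>a\<in>D. s r a \<in> {1, -1}) \<and>
       (\<forall>\<phi> r \<xi>. unit_state_of (phys_qubits N) \<phi> \<and>
          (r, \<xi>) \<in> circuit_branches circ ([], \<phi>) \<and> (\<exists>S. \<xi> S \<noteq> 0) \<longrightarrow>
          unit_state_of (aux_qubits N \<nu>) (\<Psi> r) \<and>
          (\<exists>\<alpha>. state_of (anc_qubits m) \<alpha> \<and>
             \<xi> = tensor_state (phys_qubits N \<union> aux_qubits N \<nu>) (anc_qubits m)
                   (fermionic_product N \<nu> \<phi> (\<Psi> r)) \<alpha>) \<and>
          (\<forall>l\<in>{1..\<nu>}. \<forall>(i, j)\<in>D.
             {i, j} \<in> color_class E col (2 * l - 1) \<union> color_class E col (2 * l) \<longrightarrow>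
             (\<lambda>S. s r (i, j) * stabilizer l i j (\<Psi> r) S) = \<Psi> r))"
    by (intro exI[of _ m] exI[of _ ?circ] exI[of _ sg] exI[of _ \<Psi>] conjI)
qed

end
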